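(* There exists $\tau_0>0$ such that the following holds for every $\gamma\in[0,1]$ and every $\tau\ge\tau_0$. Let $\Omega\subset\mathbb{R}^n$ be an open set, let $\varphi=\widetilde{\exp}_{\gamma,\tau}$, and let $u\in W^1K_{\varphi}(\Omega)$. Suppose that either $|Du|\in L^1(\Omega)$, or $\Omega$ has finite Lebesgue measure. Then there exists a sequence $(u_h)_h\subset C^\infty(\Omega)\cap W^1K_{\varphi}(\Omega)$ such that $(u_h)_h$ is mean convergent to $u$ (with respect to the modular $N_\varphi$) and $(|Du_h|)_h$ is $\varphi$-energy convergent to $|Du|$, that is, $$\lim_{h\to\infty}N_{\varphi}(u_h-u)=0\qquad\text{and}\qquad \lim_{h\to\infty}N_{\varphi}(|Du_h|)=N_{\varphi}(|Du|).$$
   Context: For $0\le\gamma\le1$, $\tau>1$ and $t\ge0$ set $$\exp_{\gamma,\tau}(t):=\exp\left(\frac{t}{(\log(t+\tau))^\gamma}\right),\qquad \widetilde{\exp}_{\gamma,\tau}(t):=\exp_{\gamma,\tau}(t)-1-\frac{t}{(\log\tau)^\gamma}.$$ For $\tau\ge\tau_0$ the function $\widetilde{\exp}_{\gamma,\tau}$ is an $N$-function, i.e. it has the form $t\mapsto\int_0^t a(s)\,\mathrm{d}s$ with $a:[0,\infty)\to[0,\infty)$ nondecreasing, right continuous, $a(0)=0$, $a(t)>0$ for $t>0$, and $a(t)\to\infty$ as $t\to\infty$. For measurable $v:\Omega\to\mathbb{R}$ the modular is $N_\varphi(v):=\int_\Omega\varphi(|v(x)|)\,\mathrm{d}x$.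 The Orlicz class $K_\varphi(\Omega)$ is the set of (a.e. equivalence classes of) measurable functions $v:\Omega\to\mathbb{R}$ with $N_\varphi(v)<\infty$, and the Orlicz space $L_\varphi(\Omega)$ is its linear hull. The Orlicz–Sobolev class $W^1K_\varphi(\Omega)$ is the set of $v\in K_\varphi(\Omega)\cap W^{1,1}_{\rm loc}(\Omega)$ whose weak derivatives satisfy $D_iv\in K_\varphi(\Omega)$ for each $i=1,\dots,n$; $Dv=(D_1v,\dots,D_nv)$ and $|\cdot|$ is the Euclidean norm. A sequence $(v_h)_h\subset L_\varphi(\Omega)$ is mean convergent to $v\in L_\varphi(\Omega)$ if $N_\varphi(v_h-v)\to0$ as $h\to\infty$. A sequence $(v_h)_h\subset K_\varphi(\Omega)$ is $\varphi$-energy convergent to $v\in K_\varphi(\Omega)$ if $N_\varphi(v_h)\to N_\varphi(v)$ as $h\to\infty$; in particular, this notion includes that $N_\varphi(v_h)$ and $N_\varphi(v)$ are finite.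
   Formalization: For n≥2, membership of u in W^1K_φ(Ω) does not force |Du| into K_φ(Ω), so N_φ(|Du|) may be infinite; the limit of N_φ(|Du_h|) is therefore stated in [0,∞], and φ-energy convergence (with finiteness) is claimed only when |Du| lies in K_φ(Ω). *)

theory Defs
  imports "HOL-Analysis.Analysis"
begin

text \<open>
  The dimension \<open>n\<close> is a natural number, because the constant \<open>\<tau>\<^sub>0\<close> of the theorem must not depend on
  it.  A point of \<open>\<real>\<^sup>n\<close> is a function in \<open>{..<n} \<rightarrow>\<^sub>E UNIV\<close>; this is both the carrier of the
  topology and that of the measure below.  Coordinates are numbered from \<open>0\<close> to \<open>n - 1\<close>.
\<close>

abbreviation Rn_top :: "nat \<Rightarrow> (nat \<Rightarrow> real) topology" where
  "Rn_top n \<equiv> product_topology (\<lambda>_. euclideanreal) {..<n}"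

definition Rn_leb :: "nat \<Rightarrow> (nat \<Rightarrow> real) measure" where
  "Rn_leb n = completion (Pi\<^sub>M {..<n} (\<lambda>_. lborel))"

definition Rn_leb_on :: "nat \<Rightarrow> (nat \<Rightarrow> real) set \<Rightarrow> (nat \<Rightarrow> real) measure" where
  "Rn_leb_on n \<Omega> = restrict_space (Rn_leb n) \<Omega>"


text \<open>Only the values for \<open>\<tau> > 1\<close> and \<open>t \<ge> 0\<close> are meaningful; then \<open>ln (t + \<tau>) > 0\<close>.\<close>

definition exp_gt :: "real \<Rightarrow> real \<Rightarrow> real \<Rightarrow> real" where
  "exp_gt \<gamma> \<tau> t = exp (t / (ln (t + \<tau>)) powr \<gamma>)"

definition exp_tilde :: "real \<Rightarrow> real \<Rightarrow> real \<Rightarrow> real" where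
  "exp_tilde \<gamma> \<tau> t = exp_gt \<gamma> \<tau> t - 1 - t / (ln \<tau>) powr \<gamma>"


text \<open>
  For open \<open>\<Omega>\<close>, values of functions outside \<open>\<Omega>\<close> never matter: at a point of \<open>\<Omega>\<close> a partial
  derivative in a direction \<open>i < n\<close> only depends on the values nearby.
\<close>

definition partial :: "nat \<Rightarrow> ((nat \<Rightarrow> real) \<Rightarrow> real) \<Rightarrow> (nat \<Rightarrow> real) \<Rightarrow> real" where
  "partial i v x = deriv (\<lambda>t. v (x(i := t))) (x i)"

definition C_inf :: "nat \<Rightarrow> (nat \<Rightarrow> real) set \<Rightarrow> ((nat \<Rightarrow> real) \<Rightarrow> real) set" where
  "C_inf n \<Omega> = {v. \<forall>is. set is \<subseteq> {..<n} \<longrightarrow>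
     continuous_map (subtopology (Rn_top n) \<Omega>) euclideanreal (foldr partial is v) \<and>
     (\<forall>i<n. \<forall>x\<in>\<Omega>. (\<lambda>t. foldr partial is v (x(i := t))) differentiable (at (x i)))}"

definition test_fun :: "nat \<Rightarrow> (nat \<Rightarrow> real) set \<Rightarrow> ((nat \<Rightarrow> real) \<Rightarrow> real) set" where
  "test_fun n \<Omega> = {\<psi> \<in> C_inf n (topspace (Rn_top n)).
     \<exists>K. compactin (Rn_top n) K \<and> K \<subseteq> \<Omega> \<and> (\<forall>x \<in> topspace (Rn_top n) - K. \<psi> x = 0)}"

definition L1_loc :: "nat \<Rightarrow> (nat \<Rightarrow> real) set \<Rightarrow> ((nat \<Rightarrow> real) \<Rightarrow> real) set" where
  "L1_loc n \<Omega> = {v \<in> borel_measurable (Rn_leb_on n \<Omega>).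
     \<forall>K. compactin (Rn_top n) K \<and> K \<subseteq> \<Omega> \<longrightarrow> integrable (Rn_leb_on n K) v}"

definition has_weak_deriv ::
  "nat \<Rightarrow> (nat \<Rightarrow> real) set \<Rightarrow> nat \<Rightarrow> ((nat \<Rightarrow> real) \<Rightarrow> real) \<Rightarrow> ((nat \<Rightarrow> real) \<Rightarrow> real) \<Rightarrow> bool" where
  "has_weak_deriv n \<Omega> i v g \<longleftrightarrow> g \<in> L1_loc n \<Omega> \<and>
     (\<forall>\<psi> \<in> test_fun n \<Omega>. (LINT x|Rn_leb_on n \<Omega>. v x * partial i \<psi> x) =
                         - (LINT x|Rn_leb_on n \<Omega>. g x * \<psi> x))"

definition W11_loc :: "nat \<Rightarrow> (nat \<Rightarrow> real) set \<Rightarrow> ((nat \<Rightarrow> real) \<Rightarrow> real) set" where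
  "W11_loc n \<Omega> = {v \<in> L1_loc n \<Omega>. \<forall>i<n. \<exists>g. has_weak_deriv n \<Omega> i v g}"

text \<open>
  Functions stand for their classes modulo equality almost everywhere.  A weak derivative is
  determined up to a null set, and no notion below depends on the representative chosen here.
\<close>

definition weak_deriv ::
  "nat \<Rightarrow> (nat \<Rightarrow> real) set \<Rightarrow> nat \<Rightarrow> ((nat \<Rightarrow> real) \<Rightarrow> real) \<Rightarrow> (nat \<Rightarrow> real) \<Rightarrow> real" where
  "weak_deriv n \<Omega> i v = (SOME g. has_weak_deriv n \<Omega> i v g)"

definition grad_norm ::
  "nat \<Rightarrow> (nat \<Rightarrow> real) set \<Rightarrow> ((nat \<Rightarrow> real) \<Rightarrow> real) \<Rightarrow> (nat \<Rightarrow> real) \<Rightarrow> real" where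
  "grad_norm n \<Omega> v x = L2_set (\<lambda>i. weak_deriv n \<Omega> i v x) {..<n}"


definition modular ::
  "nat \<Rightarrow> (nat \<Rightarrow> real) set \<Rightarrow> (real \<Rightarrow> real) \<Rightarrow> ((nat \<Rightarrow> real) \<Rightarrow> real) \<Rightarrow> ennreal" where
  "modular n \<Omega> \<phi> v = (\<integral>\<^sup>+x. ennreal (\<phi> \<bar>v x\<bar>) \<partial>Rn_leb_on n \<Omega>)"

definition Orlicz_class ::
  "nat \<Rightarrow> (nat \<Rightarrow> real) set \<Rightarrow> (real \<Rightarrow> real) \<Rightarrow> ((nat \<Rightarrow> real) \<Rightarrow> real) set" where
  "Orlicz_class n \<Omega> \<phi> = {v \<in> borel_measurable (Rn_leb_on n \<Omega>). modular n \<Omega> \<phi> v < \<infinity>}"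

definition Orlicz_space ::
  "nat \<Rightarrow> (nat \<Rightarrow> real) set \<Rightarrow> (real \<Rightarrow> real) \<Rightarrow> ((nat \<Rightarrow> real) \<Rightarrow> real) set" where
  "Orlicz_space n \<Omega> \<phi> = {v. \<exists>(m::nat) c w. (\<forall>j<m. w j \<in> Orlicz_class n \<Omega> \<phi>) \<and>
     (\<forall>x\<in>\<Omega>. v x = (\<Sum>j<m. c j * w j x))}"

definition W1K ::
  "nat \<Rightarrow> (nat \<Rightarrow> real) set \<Rightarrow> (real \<Rightarrow> real) \<Rightarrow> ((nat \<Rightarrow> real) \<Rightarrow> real) set" where
  "W1K n \<Omega> \<phi> = {v \<in> Orlicz_class n \<Omega> \<phi> \<inter> W11_loc n \<Omega>.
     \<forall>i<n. weak_deriv n \<Omega> i v \<in> Orlicz_class n \<Omega> \<phi>}"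

definition mean_convergent ::
  "nat \<Rightarrow> (nat \<Rightarrow> real) set \<Rightarrow> (real \<Rightarrow> real) \<Rightarrow> (nat \<Rightarrow> (nat \<Rightarrow> real) \<Rightarrow> real) \<Rightarrow>
   ((nat \<Rightarrow> real) \<Rightarrow> real) \<Rightarrow> bool" where
  "mean_convergent n \<Omega> \<phi> vs v \<longleftrightarrow>
     (\<forall>h. vs h \<in> Orlicz_space n \<Omega> \<phi>) \<and> v \<in> Orlicz_space n \<Omega> \<phi> \<and>
     (\<lambda>h. modular n \<Omega> \<phi> (\<lambda>x. vs h x - v x)) \<longlonglongrightarrow> 0"

text \<open>
  Note that for \<open>n \<ge> 2\<close> membership in \<^const>\<open>W1K\<close> does not force \<open>\<bar>Dv\<bar>\<close> into the Orlicz class: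
  for \<open>\<gamma> = 0\<close>, \<open>v(x, y) = g(x + y)\<close> with \<open>g'(s) = c ln (1/\<bar>s\<bar>)\<close> near \<open>0\<close> and \<open>1/sqrt 2 \<le> c < 1\<close>, both
  partial derivatives have finite modular and \<open>\<bar>Dv\<bar> = sqrt 2 \<bar>g'\<bar>\<close> has not.  As the following notion
  includes finiteness, it is only available when \<open>\<bar>Dv\<bar>\<close> is in the class.
\<close>

definition energy_convergent ::
  "nat \<Rightarrow> (nat \<Rightarrow> real) set \<Rightarrow> (real \<Rightarrow> real) \<Rightarrow> (nat \<Rightarrow> (nat \<Rightarrow> real) \<Rightarrow> real) \<Rightarrow>
   ((nat \<Rightarrow> real) \<Rightarrow> real) \<Rightarrow> bool" where
  "energy_convergent n \<Omega> \<phi> vs v \<longleftrightarrow>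
     (\<forall>h. vs h \<in> Orlicz_class n \<Omega> \<phi>) \<and> v \<in> Orlicz_class n \<Omega> \<phi> \<and>
     (\<lambda>h. modular n \<Omega> \<phi> (vs h)) \<longlonglongrightarrow> modular n \<Omega> \<phi> v"

end

theory Submission
  imports Defs
begin

text \<open>
  Meyers--Serrin with the twist that \<open>\<phi>\<close> grows too fast for modular convergence to survive multiplication
  by constants.  For a partition of unity \<open>\<zeta>\<^sub>j\<close> put \<open>u\<^sub>h = \<Sum>\<^sub>j \<zeta>\<^sub>j (\<eta>\<^sub>j * u)\<close>, where the cutoff is applied
  after the mollification.  As \<open>\<Sum>\<^sub>j D \<zeta>\<^sub>j = 0\<close>,
  \<open>D u\<^sub>h = \<Sum>\<^sub>j \<zeta>\<^sub>j (\<eta>\<^sub>j * D u) + \<Sum>\<^sub>j (D \<zeta>\<^sub>j) (\<eta>\<^sub>j * u - u)\<close>.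
  The first sum is a convex combination of averages, so by Jensen's inequality \<open>\<phi>\<close> of its norm is at most
  \<open>\<Sum>\<^sub>j \<zeta>\<^sub>j (\<eta>\<^sub>j * \<phi>(|D u|))\<close>, which tends to \<open>\<phi>(|D u|)\<close> in \<open>L\<^sup>1\<close>.  The second sum is uniformly as small as
  desired, with small integral, since \<open>D u\<close> is locally in \<open>L\<^bsup>2n\<^esup>\<close> and hence \<open>\<eta>\<^sub>j * u\<close> converges to \<open>u\<close> locally
  uniformly; it is absorbed by \<open>\<phi>(t + s) \<le> \<phi>(t) + C s (1 + \<phi>(t))\<close> for \<open>s \<le> 1\<close>.  Fatou's lemma gives the
  lower bound, also when \<open>\<phi>(|D u|)\<close> is not integrable.
\<close>

section \<open>Euclidean space as an extensional function space\<close>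

text \<open>The obstacle is the failure of a doubling condition: \<open>\<phi>(2 t)\<close> is not
  controlled by \<open>\<phi>(t)\<close>, so neither a constant in front of the gradient nor an
  error that is small merely in modular can be absorbed. Hence gradients are only ever averaged, and
  all other errors are made small in the sup norm with bounds that also sum in \<open>L^1\<close>.
  Uniform smallness comes from the power \<open>2 n\<close>: a kernel of scale \<open>s\<close> has
  size \<open>s^(-n)\<close>, so an \<open>L^(2n)\<close> gradient has mollifications of size
  \<open>s^(-1/2)\<close>, and integration over the scales leaves \<open>sqrt s\<close>. As
  \<open>n\<close> is arbitrary, every power must be available locally, which holds because
  \<open>\<phi>\<close> beats all polynomials. Jensen's inequality is run for the norm of an
  arbitrary subfamily of the partial derivatives: singletons give membership in the class even when
  the full norm has infinite modular. The threshold 8 for \<open>\<tau>\<close> makes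
  \<open>\<phi>\<close> convex for all \<open>\<gamma>\<close> at once. Lebesgue measurable
  functions are replaced by Borel representatives, so that convolutions live on the uncompleted
  product measure.\<close>

abbreviation Rn :: "nat \<Rightarrow> (nat \<Rightarrow> real) set" where
  "Rn n \<equiv> Pi\<^sub>E {..<n} (\<lambda>_. UNIV)"

abbreviation lebn :: "nat \<Rightarrow> (nat \<Rightarrow> real) measure" where
  "lebn n \<equiv> Pi\<^sub>M {..<n} (\<lambda>_. lborel)"

text \<open>Sup-norm balls stand in for metric balls in every epsilon-delta argument on
  \<open>Rn_top n\<close>. Only the coordinates of the centre below \<open>n\<close> enter, so the
  centre may be any function.\<close>

definition cube :: "nat \<Rightarrow> (nat \<Rightarrow> real) \<Rightarrow> real \<Rightarrow> (nat \<Rightarrow> real) set" where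
  "cube n x d = {y \<in> Rn n. \<forall>i<n. \<bar>y i - x i\<bar> < d}"

lemma mem_cube: "y \<in> cube n x d \<longleftrightarrow> y \<in> Rn n \<and> (\<forall>i<n. \<bar>y i - x i\<bar> < d)"
  by (simp add: cube_def)

lemma cube_mono: "d \<le> e \<Longrightarrow> cube n x d \<subseteq> cube n x e"
  unfolding cube_def subset_iff mem_Collect_eq by (smt (verit))

lemma cube_trans: "y \<in> cube n x d \<Longrightarrow> z \<in> cube n y e \<Longrightarrow> z \<in> cube n x (d + e)"
  unfolding mem_cube by (smt (verit))

lemma cube_self: "x \<in> Rn n \<Longrightarrow> 0 < d \<Longrightarrow> x \<in> cube n x d"
  by (simp add: cube_def)

lemma Rn_upd: "x \<in> Rn n \<Longrightarrow> i < n \<Longrightarrow> x(i := t) \<in> Rn n"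
  using PiE_fun_upd[of t "\<lambda>_. UNIV" i x "{..<n}"] by (simp add: insert_absorb)

lemma cube_upd: "x \<in> Rn n \<Longrightarrow> i < n \<Longrightarrow> \<bar>t - x i\<bar> < d \<Longrightarrow> x(i := t) \<in> cube n x d"
  unfolding mem_cube using Rn_upd[of x n i t] by (smt (verit) fun_upd_apply)

lemma space_lebn [simp]: "space (lebn n) = Rn n"
  by (simp add: space_PiM)

lemma topspace_Rn: "topspace (Rn_top n) = Rn n"
  by simp

lemma openin_Rn_iff:
  "openin (Rn_top n) U \<longleftrightarrow> U \<subseteq> Rn n \<and> (\<forall>x\<in>U. \<exists>d>0. cube n x d \<subseteq> U)"
proof
  assume U: "openin (Rn_top n) U"
  have "\<exists>d>0. cube n x d \<subseteq> U" if x: "x \<in> U" for x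
  proof -
    obtain V where V: "\<And>i. i < n \<Longrightarrow> open (V i)" "x \<in> Pi\<^sub>E {..<n} V" "Pi\<^sub>E {..<n} V \<subseteq> U"
      using U x unfolding openin_product_topology_alt by (auto simp: Ball_def) metis
    have "\<exists>d>0. \<forall>y. \<bar>y - x i\<bar> < d \<longrightarrow> y \<in> V i" if "i < n" for i
      using V(1)[OF that] V(2) that unfolding open_dist dist_real_def by (auto simp: PiE_iff)
    then obtain d where d: "\<And>i. i < n \<Longrightarrow> d i > 0 \<and> (\<forall>y. \<bar>y - x i\<bar> < d i \<longrightarrow> y \<in> V i)"
      by metis
    \<comment> \<open>The inserted 1 keeps the minimum defined in dimension 0.\<close>
    define e where "e = Min (insert 1 (d ` {..<n}))"
    have e: "e > 0" "\<And>i. i < n \<Longrightarrow> e \<le> d i"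
      using d by (auto simp: e_def)
    have "cube n x e \<subseteq> Pi\<^sub>E {..<n} V"
    proof
      fix y assume y: "y \<in> cube n x e"
      have "y i \<in> V i" if "i < n" for i
        using y d[OF that] e(2)[OF that] that by (force simp: cube_def)
      with y show "y \<in> Pi\<^sub>E {..<n} V" by (auto simp: cube_def PiE_iff)
    qed
    with V(3) e(1) show ?thesis by blast
  qed
  moreover have "U \<subseteq> Rn n" using openin_subset[OF U] by simp
  ultimately show "U \<subseteq> Rn n \<and> (\<forall>x\<in>U. \<exists>d>0. cube n x d \<subseteq> U)" by blast
next
  assume U: "U \<subseteq> Rn n \<and> (\<forall>x\<in>U. \<exists>d>0. cube n x d \<subseteq> U)"
  show "openin (Rn_top n) U"
    unfolding openin_product_topology_alt
  proof
    fix x assume x: "x \<in> U"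
    then obtain d where d: "d > 0" "cube n x d \<subseteq> U" using U by blast
    have "Pi\<^sub>E {..<n} (\<lambda>i. ball (x i) d) \<subseteq> cube n x d"
    proof
      fix y assume y: "y \<in> Pi\<^sub>E {..<n} (\<lambda>i. ball (x i) d)"
      have "\<bar>y i - x i\<bar> < d" if "i < n" for i
        using PiE_mem[OF y, of i] that by (simp add: dist_real_def abs_minus_commute)
      with y show "y \<in> cube n x d" by (simp add: cube_def PiE_iff)
    qed
    moreover have "x \<in> Pi\<^sub>E {..<n} (\<lambda>i. ball (x i) d)" using x U d by (auto simp: PiE_iff subset_iff)
    ultimately show "\<exists>V. finite {i \<in> {..<n}. V i \<noteq> topspace euclideanreal} \<and>
      (\<forall>i\<in>{..<n}. openin euclideanreal (V i)) \<and> x \<in> Pi\<^sub>E {..<n} V \<and> Pi\<^sub>E {..<n} V \<subseteq> U"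
      using d by (intro exI[of _ "\<lambda>i. ball (x i) d"]) auto
  qed
qed

lemma openin_Rn_UNIV: "openin (Rn_top n) (Rn n)"
  using openin_topspace[of "Rn_top n"] by simp

lemma openin_cube: "x \<in> Rn n \<Longrightarrow> openin (Rn_top n) (cube n x d)"
  unfolding openin_Rn_iff
proof (intro conjI ballI)
  fix y assume y: "y \<in> cube n x d"
  define e where "e = Min (insert 1 ((\<lambda>i. d - \<bar>y i - x i\<bar>) ` {..<n}))"
  have e: "e > 0" "\<And>i. i < n \<Longrightarrow> e \<le> d - \<bar>y i - x i\<bar>"
    using y by (auto simp: e_def cube_def)
  have "cube n y e \<subseteq> cube n x d"
    using e(2) by (fastforce simp: cube_def)
  with e(1) show "\<exists>e>0. cube n y e \<subseteq> cube n x d" by blast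
qed (auto simp: cube_def)

text \<open>Points of the cube outside \<open>\<Omega>\<close> need no exclusion:
  \<open>\<Omega>\<close> is open, so \<open>d\<close> can be shrunk until there are none.\<close>

lemma continuous_map_Rn_iff:
  assumes "openin (Rn_top n) \<Omega>"
  shows "continuous_map (subtopology (Rn_top n) \<Omega>) euclideanreal v \<longleftrightarrow>
    (\<forall>x\<in>\<Omega>. \<forall>e>0. \<exists>d>0. \<forall>y\<in>cube n x d. \<bar>v y - v x\<bar> < e)" (is "?L \<longleftrightarrow> ?R")
proof
  have sub: "\<Omega> \<subseteq> Rn n" using openin_subset[OF assms] by simp
  then have ts: "Rn n \<inter> \<Omega> = \<Omega>" by blast
  {
    assume L: ?L
    show ?R
    proof (intro ballI allI impI)
      fix x and e :: real assume x: "x \<in> \<Omega>" and e: "e > 0"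
      have "openin (subtopology (Rn_top n) \<Omega>) {y \<in> \<Omega>. v y \<in> ball (v x) e}"
        using L ts unfolding continuous_map by (auto dest!: spec[of _ "ball (v x) e"])
      then have "openin (Rn_top n) {y \<in> \<Omega>. v y \<in> ball (v x) e}"
        using assms openin_open_subtopology by blast
      then obtain d where "d > 0" "cube n x d \<subseteq> {y \<in> \<Omega>. v y \<in> ball (v x) e}"
        unfolding openin_Rn_iff using x e by auto
      then show "\<exists>d>0. \<forall>y\<in>cube n x d. \<bar>v y - v x\<bar> < e"
        by (intro exI[of _ d]) (auto simp: dist_real_def abs_minus_commute)
    qed
  next
    assume R: ?R
    have "openin (Rn_top n) {x \<in> \<Omega>. v x \<in> V}" if V: "open V" for V
      unfolding openin_Rn_iff
    proof (intro conjI ballI)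
      fix x assume x: "x \<in> {x \<in> \<Omega>. v x \<in> V}"
      obtain e where e: "e > 0" "\<And>y. \<bar>y - v x\<bar> < e \<Longrightarrow> y \<in> V"
        using V x unfolding open_dist dist_real_def by blast
      obtain d where d: "d > 0" "\<forall>y\<in>cube n x d. \<bar>v y - v x\<bar> < e" using R x e by blast
      obtain d' where d': "d' > 0" "cube n x d' \<subseteq> \<Omega>"
        using assms x unfolding openin_Rn_iff by blast
      have "cube n x (min d d') \<subseteq> cube n x d" "cube n x (min d d') \<subseteq> cube n x d'"
        by (auto intro: cube_mono[THEN subsetD, rotated])
      then have "cube n x (min d d') \<subseteq> {x \<in> \<Omega>. v x \<in> V}"
        using d d' e by blast
      then show "\<exists>d>0. cube n x d \<subseteq> {x \<in> \<Omega>. v x \<in> V}"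
        using d(1) d'(1) by (intro exI[of _ "min d d'"]) auto
    qed (use sub in auto)
    then show ?L
      using ts assms by (auto simp: continuous_map openin_open_subtopology)
  }
qed

text \<open>Bridge to the full sequence space, whose countable product sigma-algebra is known to be
  the Borel one: extension by zero is a measurable map into it.\<close>

lemma sets_lebn_restrict_vimage:
  assumes "open (W :: (nat \<Rightarrow> real) set)"
  shows "{x \<in> Rn n. (\<lambda>i. if i < n then x i else 0) \<in> W} \<in> sets (lebn n)"
proof -
  have [measurable]: "(\<lambda>x i. if i < n then x i else (0::real)) \<in> lebn n \<rightarrow>\<^sub>M Pi\<^sub>M UNIV (\<lambda>_. borel)"
  proof (rule measurable_PiM_single')
    show "(\<lambda>x. if i < n then x i else (0::real)) \<in> borel_measurable (lebn n)" for i
      by (cases "i < n") (simp_all add: measurable_component_singleton[of i "{..<n}" "\<lambda>_. lborel", simplified])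
  qed auto
  have "W \<in> sets (Pi\<^sub>M UNIV (\<lambda>_::nat. borel :: real measure))"
    using assms sets_PiM_equal_borel by (metis borel_open)
  then have "(\<lambda>x i. if i < n then x i else (0::real)) -` W \<inter> space (lebn n) \<in> sets (lebn n)"
    by measurable
  then show ?thesis by (simp add: vimage_def Int_def conj_commute)
qed

text \<open>Topology and measure are both product constructions but otherwise unrelated. An open
  \<open>U\<close> is pulled back along restriction to an open set \<open>W\<close> of sequences,
  which is measurable; padding with zeros and restricting again recovers \<open>U\<close>.\<close>

lemma openin_imp_sets_lebn:
  assumes "openin (Rn_top n) U" shows "U \<in> sets (lebn n)"
proof -
  define W where "W = {x :: nat \<Rightarrow> real. restrict x {..<n} \<in> U}"
  have "openin (product_topology (\<lambda>_. euclideanreal) UNIV) W"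
    unfolding openin_product_topology_alt
  proof
    fix x assume x: "x \<in> W"
    then obtain d where d: "d > 0" "cube n (restrict x {..<n}) d \<subseteq> U"
      using assms by (auto simp: W_def openin_Rn_iff)
    define V where "V i = (if i < n then ball (x i) d else UNIV)" for i
    have "{i \<in> UNIV. V i \<noteq> topspace euclideanreal} \<subseteq> {..<n}" by (auto simp: V_def split: if_splits)
    then have "finite {i \<in> UNIV. V i \<noteq> topspace euclideanreal}" by (rule finite_subset) simp
    moreover have "x \<in> Pi\<^sub>E UNIV V" using d by (auto simp: V_def)
    moreover have "Pi\<^sub>E UNIV V \<subseteq> W"
    proof
      fix y assume y: "y \<in> Pi\<^sub>E UNIV V"
      have "\<bar>y i - x i\<bar> < d" if "i < n" for i
        using y that by (auto simp: V_def PiE_iff dist_real_def abs_minus_commute dest!: spec[of _ i])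
      then have "restrict y {..<n} \<in> cube n (restrict x {..<n}) d"
        by (auto simp: cube_def)
      with d show "y \<in> W" by (auto simp: W_def)
    qed
    ultimately show "\<exists>V. finite {i \<in> UNIV. V i \<noteq> topspace euclideanreal} \<and>
      (\<forall>i\<in>UNIV. openin euclideanreal (V i)) \<and> x \<in> Pi\<^sub>E UNIV V \<and> Pi\<^sub>E UNIV V \<subseteq> W"
      by (intro exI[of _ V]) (auto simp: V_def)
  qed
  then have "open W" unfolding open_fun_def by simp
  from sets_lebn_restrict_vimage[OF this, of n]
  have "{x \<in> Rn n. restrict (\<lambda>i. if i < n then x i else 0) {..<n} \<in> U} \<in> sets (lebn n)"
    by (simp add: W_def)
  also have "{x \<in> Rn n. restrict (\<lambda>i. if i < n then x i else 0) {..<n} \<in> U} = U"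
  proof -
    have "restrict (\<lambda>i. if i < n then x i else 0) {..<n} = x" if "x \<in> Rn n" for x
      using that by (auto simp: fun_eq_iff PiE_iff extensional_def)
    moreover have "U \<subseteq> Rn n" using openin_subset[OF assms] by simp
    ultimately show ?thesis by auto
  qed
  finally show ?thesis .
qed

section \<open>Compact sets: measurability, finite measure, and the Heine-Borel criterion\<close>

lemma Hausdorff_Rn: "Hausdorff_space (Rn_top n)"
  by (simp add: Hausdorff_space_product_topology)

lemma compactin_Rn_closedin: "compactin (Rn_top n) K \<Longrightarrow> closedin (Rn_top n) K"
  by (rule compactin_imp_closedin[OF Hausdorff_Rn])

lemma compactin_Rn_sets: "compactin (Rn_top n) K \<Longrightarrow> K \<in> sets (lebn n)"
proof -
  assume K: "compactin (Rn_top n) K"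
  then have "openin (Rn_top n) (Rn n - K)"
    using compactin_Rn_closedin[OF K] by (simp add: closedin_def)
  then have "Rn n - K \<in> sets (lebn n)" by (rule openin_imp_sets_lebn)
  then have "space (lebn n) - (Rn n - K) \<in> sets (lebn n)" by (rule sets.compl_sets)
  moreover have "K \<subseteq> Rn n" using compactin_subset_topspace[OF K] by simp
  ultimately show ?thesis by (simp add: double_diff)
qed

lemma compactin_Rn_bounded:
  assumes K: "compactin (Rn_top n) K"
  obtains R where "R > 0" "\<And>x i. x \<in> K \<Longrightarrow> i < n \<Longrightarrow> \<bar>x i\<bar> \<le> R"
proof -
  have "\<exists>R. \<forall>x\<in>K. \<bar>x i\<bar> \<le> R" if "i < n" for i
  proof -
    have "continuous_map (Rn_top n) euclideanreal (\<lambda>x. x i)"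
      using that by (intro continuous_map_product_projection) auto
    then have "compactin euclideanreal ((\<lambda>x. x i) ` K)"
      using K by (rule image_compactin[rotated])
    then have "compact ((\<lambda>x. x i) ` K)" by simp
    then have "bounded ((\<lambda>x. x i) ` K)" by (rule compact_imp_bounded)
    then show ?thesis by (auto simp: bounded_iff)
  qed
  then obtain R where R: "\<And>i. i < n \<Longrightarrow> \<forall>x\<in>K. \<bar>x i\<bar> \<le> R i" by metis
  show ?thesis
  proof (rule that)
    show "0 < 1 + (\<Sum>i<n. \<bar>R i\<bar>)" by (smt (verit) sum_nonneg abs_ge_zero)
    fix x i assume "x \<in> K" "i < n"
    then have "\<bar>x i\<bar> \<le> \<bar>R i\<bar>" using R by force
    also have "\<bar>R i\<bar> \<le> (\<Sum>i<n. \<bar>R i\<bar>)" using \<open>i < n\<close> by (intro member_le_sum) auto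
    finally show "\<bar>x i\<bar> \<le> 1 + (\<Sum>i<n. \<bar>R i\<bar>)" by simp
  qed
qed

interpretation lebn: product_sigma_finite "\<lambda>_. lborel :: real measure" ..

lemma sigma_finite_lebn: "sigma_finite_measure (lebn n)"
  by (rule lebn.sigma_finite) simp

interpretation lebn2: pair_sigma_finite "lebn n" "lebn n" for n
  by (simp add: pair_sigma_finite_def sigma_finite_lebn)

lemma emeasure_box_finite:
  "emeasure (lebn n) (Pi\<^sub>E {..<n} (\<lambda>_. {-R..R::real})) < \<infinity>"
proof -
  have "emeasure lborel {-R..R::real} < top" using emeasure_lborel_cbox_finite[of "-R" R] by (simp add: less_top)
  then show ?thesis by (subst lebn.emeasure_PiM) (auto simp: power_less_top_ennreal)
qed

lemma emeasure_bounded_finite: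
  assumes "K \<subseteq> Rn n" "\<And>x i. x \<in> K \<Longrightarrow> i < n \<Longrightarrow> \<bar>x i\<bar> \<le> R"
  shows "emeasure (lebn n) K < \<infinity>"
proof -
  have "K \<subseteq> Pi\<^sub>E {..<n} (\<lambda>_. {-R..R::real})"
  proof
    fix x assume "x \<in> K"
    then show "x \<in> Pi\<^sub>E {..<n} (\<lambda>_. {-R..R::real})"
      using assms(1) assms(2)[of x] by (auto simp: PiE_iff abs_le_iff) (smt (verit))
  qed
  then have "emeasure (lebn n) K \<le> emeasure (lebn n) (Pi\<^sub>E {..<n} (\<lambda>_. {-R..R::real}))"
    by (intro emeasure_mono sets_PiM_I_finite) auto
  then show ?thesis using emeasure_box_finite[of n R] by simp
qed

lemma compactin_Rn_finite:
  assumes K: "compactin (Rn_top n) K" shows "emeasure (lebn n) K < \<infinity>"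
proof -
  obtain R where "\<And>x i. x \<in> K \<Longrightarrow> i < n \<Longrightarrow> \<bar>x i\<bar> \<le> R" using compactin_Rn_bounded[OF K] by blast
  moreover have "K \<subseteq> Rn n" using compactin_subset_topspace[OF K] by simp
  ultimately show ?thesis using emeasure_bounded_finite by blast
qed

text \<open>The last hypothesis is closedness, and a closed subset of a product of compact intervals
  is compact.\<close>

lemma compactin_RnI:
  assumes "K \<subseteq> Rn n" "\<And>x i. x \<in> K \<Longrightarrow> i < n \<Longrightarrow> \<bar>x i\<bar> \<le> R"
    and "\<And>x. x \<in> Rn n \<Longrightarrow> x \<notin> K \<Longrightarrow> \<exists>d>0. cube n x d \<inter> K = {}"
  shows "compactin (Rn_top n) K"
proof (rule closed_compactin)
  show "compactin (Rn_top n) (Pi\<^sub>E {..<n} (\<lambda>_. {-R..R::real}))"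
    by (auto simp: compactin_PiE)
  show "K \<subseteq> Pi\<^sub>E {..<n} (\<lambda>_. {-R..R::real})"
  proof
    fix x assume "x \<in> K"
    then show "x \<in> Pi\<^sub>E {..<n} (\<lambda>_. {-R..R::real})"
      using assms(1) assms(2)[of x] by (auto simp: PiE_iff abs_le_iff) (smt (verit))
  qed
  have "openin (Rn_top n) (Rn n - K)"
    unfolding openin_Rn_iff
  proof (intro conjI ballI)
    fix x assume "x \<in> Rn n - K"
    then obtain d where "d > 0" "cube n x d \<inter> K = {}" using assms(3) by blast
    moreover have "cube n x d \<subseteq> Rn n" by (auto simp: cube_def)
    ultimately show "\<exists>d>0. cube n x d \<subseteq> Rn n - K" by blast
  qed auto
  then show "closedin (Rn_top n) K" using assms(1) by (simp add: closedin_def)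
qed

lemma borel_measurable_continuous_Rn:
  assumes U: "openin (Rn_top n) \<Omega>"
    and v: "continuous_map (subtopology (Rn_top n) \<Omega>) euclideanreal v"
  shows "(\<lambda>x. indicator \<Omega> x * v x) \<in> borel_measurable (lebn n)"
proof -
  have "{x \<in> space (restrict_space (lebn n) \<Omega>). v x \<in> V} \<in> sets (restrict_space (lebn n) \<Omega>)"
    if "open V" for V
  proof -
    have "\<Omega> \<subseteq> Rn n" using openin_subset[OF U] by simp
    then have "openin (Rn_top n) {x \<in> \<Omega>. v x \<in> V}"
      using v that U unfolding continuous_map
      by (auto simp: openin_open_subtopology Int_absorb1)
    from openin_imp_sets_lebn[OF this] show ?thesis
      using openin_imp_sets_lebn[OF U] \<open>\<Omega> \<subseteq> Rn n\<close>
      by (auto simp: sets_restrict_space_iff space_restrict_space Int_absorb2)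
  qed
  then have "v \<in> borel_measurable (restrict_space (lebn n) \<Omega>)"
    by (intro borel_measurableI) (auto simp: vimage_def Int_def conj_commute)
  then show ?thesis
    using openin_imp_sets_lebn[OF U]
    by (subst (asm) borel_measurable_restrict_space_iff) auto
qed

section \<open>Smooth functions\<close>

abbreviation cont_on_Rn :: "nat \<Rightarrow> (nat \<Rightarrow> real) set \<Rightarrow> ((nat \<Rightarrow> real) \<Rightarrow> real) \<Rightarrow> bool" where
  "cont_on_Rn n \<Omega> v \<equiv> continuous_map (subtopology (Rn_top n) \<Omega>) euclideanreal v"

text \<open>The relational form of \<open>partial\<close>: \<open>deriv\<close> has an unspecified
  value where no derivative exists, so the rules of calculus are proved for this predicate and then
  transferred by \<open>has_partial_imp_partial\<close>.\<close>

definition has_partial ::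
  "nat \<Rightarrow> ((nat \<Rightarrow> real) \<Rightarrow> real) \<Rightarrow> real \<Rightarrow> (nat \<Rightarrow> real) \<Rightarrow> bool" where
  "has_partial i v D x \<longleftrightarrow> ((\<lambda>t. v (x(i := t))) has_real_derivative D) (at (x i))"

lemma has_partial_imp_partial: "has_partial i v D x \<Longrightarrow> partial i v x = D"
  unfolding has_partial_def partial_def by (rule DERIV_imp_deriv)

lemma has_partial_partial:
  "(\<lambda>t. v (x(i := t))) differentiable (at (x i)) \<Longrightarrow> has_partial i v (partial i v x) x"
  unfolding has_partial_def partial_def by (simp add: DERIV_deriv_iff_real_differentiable)

lemma has_partial_imp_differentiable:
  "has_partial i v D x \<Longrightarrow> (\<lambda>t. v (x(i := t))) differentiable (at (x i))"
  unfolding has_partial_def real_differentiable_def by blast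

lemma has_partial_cong:
  assumes "openin (Rn_top n) \<Omega>" "x \<in> \<Omega>" "i < n" "\<And>y. y \<in> \<Omega> \<Longrightarrow> v y = w y"
  shows "has_partial i v D x \<longleftrightarrow> has_partial i w D x"
proof -
  obtain d where d: "d > 0" "cube n x d \<subseteq> \<Omega>" using assms(1,2) by (auto simp: openin_Rn_iff)
  have x: "x \<in> Rn n" using openin_subset[OF assms(1)] assms(2) by auto
  have "v (x(i := t)) = w (x(i := t))" if "t \<in> ball (x i) d" for t
    using cube_upd[OF x assms(3), of t d] that d assms(4)
    by (auto simp: dist_real_def abs_minus_commute)
  then have "eventually (\<lambda>t. v (x(i := t)) = w (x(i := t))) (nhds (x i))"
    using d(1) by (intro eventually_nhds[THEN iffD2] exI[of _ "ball (x i) d"]) auto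
  then show ?thesis unfolding has_partial_def by (intro DERIV_cong_ev) auto
qed

lemma partial_cong:
  assumes "openin (Rn_top n) \<Omega>" "x \<in> \<Omega>" "i < n" "\<And>y. y \<in> \<Omega> \<Longrightarrow> v y = w y"
  shows "partial i v x = partial i w x"
proof -
  obtain d where d: "d > 0" "cube n x d \<subseteq> \<Omega>" using assms(1,2) by (auto simp: openin_Rn_iff)
  have x: "x \<in> Rn n" using openin_subset[OF assms(1)] assms(2) by auto
  have "v (x(i := t)) = w (x(i := t))" if "t \<in> ball (x i) d" for t
    using cube_upd[OF x assms(3), of t d] that d assms(4)
    by (auto simp: dist_real_def abs_minus_commute)
  then have "eventually (\<lambda>t. v (x(i := t)) = w (x(i := t))) (nhds (x i))"
    using d(1) by (intro eventually_nhds[THEN iffD2] exI[of _ "ball (x i) d"]) auto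
  then show ?thesis unfolding partial_def by (intro deriv_cong_ev) auto
qed

text \<open>Smooth functions form the largest class of continuous functions stable under partial
  differentiation. Induction on the list of directions shows that each iterated partial derivative
  agrees on \<open>\<Omega>\<close> with a member of \<open>S\<close>; agreement on an open set is
  enough to differentiate once more.\<close>

lemma C_inf_coinduct:
  assumes \<Omega>: "openin (Rn_top n) \<Omega>" and v: "S v"
    and cont: "\<And>w. S w \<Longrightarrow> cont_on_Rn n \<Omega> w"
    and step: "\<And>w i. S w \<Longrightarrow> i < n \<Longrightarrow> \<exists>w'. S w' \<and> (\<forall>x\<in>\<Omega>. has_partial i w (w' x) x)"
  shows "v \<in> C_inf n \<Omega>"
proof -
  have *: "\<exists>w. S w \<and> (\<forall>x\<in>\<Omega>. foldr partial is v x = w x)" if "set is \<subseteq> {..<n}" for "is"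
    using that
  proof (induction "is")
    case Nil then show ?case using v by auto
  next
    case (Cons i js)
    then obtain w where w: "S w" "\<forall>x\<in>\<Omega>. foldr partial js v x = w x" by auto
    obtain w' where w': "S w'" "\<forall>x\<in>\<Omega>. has_partial i w (w' x) x"
      using step[OF w(1), of i] Cons.prems by auto
    have "foldr partial (i # js) v x = w' x" if x: "x \<in> \<Omega>" for x
    proof -
      have "foldr partial (i # js) v x = partial i w x"
        using partial_cong[OF \<Omega> x, of i "foldr partial js v" w] w(2) Cons.prems by auto
      then show ?thesis using w'(2) x has_partial_imp_partial by metis
    qed
    then show ?case using w'(1) by blast
  qed
  show ?thesis unfolding C_inf_def
  proof (intro CollectI allI impI conjI ballI)
    fix "is" assume "set is \<subseteq> {..<n}"
    then obtain w where w: "S w" "\<And>x. x \<in> \<Omega> \<Longrightarrow> foldr partial is v x = w x" using * by blast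
    show "cont_on_Rn n \<Omega> (foldr partial is v)"
      by (rule continuous_map_eq[OF cont[OF w(1)]]) (use w(2) in auto)
    fix i x assume i: "i < n" and x: "x \<in> \<Omega>"
    obtain w' where "has_partial i w (w' x) x" using step[OF w(1) i] x by blast
    then have "has_partial i (foldr partial is v) (w' x) x"
      using has_partial_cong[OF \<Omega> x i] w(2) by metis
    then show "(\<lambda>t. foldr partial is v (x(i := t))) differentiable at (x i)"
      by (rule has_partial_imp_differentiable)
  qed
qed

lemma C_inf_cont: "v \<in> C_inf n \<Omega> \<Longrightarrow> cont_on_Rn n \<Omega> v"
  unfolding C_inf_def by (auto dest: spec[of _ "[]"])

lemma C_inf_has_partial: "v \<in> C_inf n \<Omega> \<Longrightarrow> i < n \<Longrightarrow> x \<in> \<Omega> \<Longrightarrow> has_partial i v (partial i v x) x"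
  unfolding C_inf_def by (intro has_partial_partial) (auto dest: spec[of _ "[]"])

lemma C_inf_partial: "v \<in> C_inf n \<Omega> \<Longrightarrow> i < n \<Longrightarrow> partial i v \<in> C_inf n \<Omega>"
  unfolding C_inf_def
proof (intro CollectI allI impI)
  fix "is" assume v: "v \<in> {v. \<forall>is. set is \<subseteq> {..<n} \<longrightarrow> cont_on_Rn n \<Omega> (foldr partial is v) \<and>
          (\<forall>i<n. \<forall>x\<in>\<Omega>. (\<lambda>t. foldr partial is v (x(i := t))) differentiable at (x i))}"
    and "i < n" "set is \<subseteq> {..<n}"
  then have "set (is @ [i]) \<subseteq> {..<n}" by auto
  with v show "cont_on_Rn n \<Omega> (foldr partial is (partial i v)) \<and>
          (\<forall>ia<n. \<forall>x\<in>\<Omega>. (\<lambda>t. foldr partial is (partial i v) (x(ia := t))) differentiable at (x ia))"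
    by (auto dest!: spec[of _ "is @ [i]"])
qed

lemma C_inf_mono: "v \<in> C_inf n \<Omega> \<Longrightarrow> V \<subseteq> \<Omega> \<Longrightarrow> v \<in> C_inf n V"
  unfolding C_inf_def by (auto intro: continuous_map_from_subtopology_mono)

lemma C_inf_cong:
  assumes "openin (Rn_top n) \<Omega>" "v \<in> C_inf n \<Omega>" "\<And>x. x \<in> \<Omega> \<Longrightarrow> v x = w x"
  shows "w \<in> C_inf n \<Omega>"
proof (rule C_inf_coinduct[where S = "\<lambda>w. \<exists>v\<in>C_inf n \<Omega>. \<forall>x\<in>\<Omega>. v x = w x"])
  show "\<exists>v\<in>C_inf n \<Omega>. \<forall>x\<in>\<Omega>. v x = w x" using assms by blast
next
  fix w assume "\<exists>v\<in>C_inf n \<Omega>. \<forall>x\<in>\<Omega>. v x = w x"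
  then obtain v where v: "v \<in> C_inf n \<Omega>" "\<And>x. x \<in> \<Omega> \<Longrightarrow> v x = w x" by blast
  show "cont_on_Rn n \<Omega> w" by (rule continuous_map_eq[OF C_inf_cont[OF v(1)]]) (use v(2) in auto)
  fix i assume i: "i < n"
  have "has_partial i w (partial i v x) x" if "x \<in> \<Omega>" for x
    using C_inf_has_partial[OF v(1) i that] has_partial_cong[OF assms(1) that i, of v w] v(2) by auto
  then show "\<exists>w'. (\<exists>v\<in>C_inf n \<Omega>. \<forall>x\<in>\<Omega>. v x = w' x) \<and> (\<forall>x\<in>\<Omega>. has_partial i w (w' x) x)"
    using C_inf_partial[OF v(1) i] by blast
qed (rule assms(1))

lemma C_inf_local:
  assumes "openin (Rn_top n) \<Omega>" "\<And>x. x \<in> \<Omega> \<Longrightarrow> \<exists>V. openin (Rn_top n) V \<and> x \<in> V \<and> v \<in> C_inf n V"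
  shows "v \<in> C_inf n \<Omega>"
proof (rule C_inf_coinduct[where S = "\<lambda>v. \<forall>x\<in>\<Omega>. \<exists>V. openin (Rn_top n) V \<and> x \<in> V \<and> v \<in> C_inf n V"])
  show "\<forall>x\<in>\<Omega>. \<exists>V. openin (Rn_top n) V \<and> x \<in> V \<and> v \<in> C_inf n V" using assms by blast
next
  fix v assume v: "\<forall>x\<in>\<Omega>. \<exists>V. openin (Rn_top n) V \<and> x \<in> V \<and> v \<in> C_inf n V"
  show "cont_on_Rn n \<Omega> v"
    unfolding continuous_map_Rn_iff[OF assms(1)]
  proof (intro ballI allI impI)
    fix x and e :: real assume x: "x \<in> \<Omega>" and e: "e > 0"
    obtain V where V: "openin (Rn_top n) V" "x \<in> V" "v \<in> C_inf n V" using v x by blast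
    show "\<exists>d>0. \<forall>y\<in>cube n x d. \<bar>v y - v x\<bar> < e"
      using C_inf_cont[OF V(3)] V(2) e unfolding continuous_map_Rn_iff[OF V(1)] by blast
  qed
  fix i assume i: "i < n"
  have "\<forall>x\<in>\<Omega>. \<exists>V. openin (Rn_top n) V \<and> x \<in> V \<and> partial i v \<in> C_inf n V"
    using v C_inf_partial[OF _ i] by blast
  moreover have "\<forall>x\<in>\<Omega>. has_partial i v (partial i v x) x"
    using v C_inf_has_partial[OF _ i] by blast
  ultimately show "\<exists>w'. (\<forall>x\<in>\<Omega>. \<exists>V. openin (Rn_top n) V \<and> x \<in> V \<and> w' \<in> C_inf n V) \<and>
      (\<forall>x\<in>\<Omega>. has_partial i v (w' x) x)" by blast
qed (rule assms(1))

section \<open>Sums and products of smooth functions\<close>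

lemma has_partial_const: "has_partial i (\<lambda>_. c) 0 x"
  by (simp add: has_partial_def)

lemma has_partial_add:
  "has_partial i v D x \<Longrightarrow> has_partial i w E x \<Longrightarrow> has_partial i (\<lambda>x. v x + w x) (D + E) x"
  unfolding has_partial_def by (rule DERIV_add)

lemma has_partial_sum:
  "(\<And>j. j \<in> J \<Longrightarrow> has_partial i (v j) (D j) x) \<Longrightarrow> has_partial i (\<lambda>x. \<Sum>j\<in>J. v j x) (\<Sum>j\<in>J. D j) x"
  unfolding has_partial_def by (rule DERIV_sum)

lemma has_partial_mult:
  "has_partial i v D x \<Longrightarrow> has_partial i w E x \<Longrightarrow>
    has_partial i (\<lambda>x. v x * w x) (D * w x + v x * E) x"
  unfolding has_partial_def
  by (drule (1) DERIV_mult) (simp add: algebra_simps)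

text \<open>The product rule leads out of the set of products, so the coinduction needs a class that
  is closed under sums and products simultaneously.\<close>

inductive_set alg :: "((nat \<Rightarrow> real) \<Rightarrow> real) set \<Rightarrow> ((nat \<Rightarrow> real) \<Rightarrow> real) set" for C where
  base: "v \<in> C \<Longrightarrow> v \<in> alg C"
| add: "v \<in> alg C \<Longrightarrow> w \<in> alg C \<Longrightarrow> (\<lambda>x. v x + w x) \<in> alg C"
| mult: "v \<in> alg C \<Longrightarrow> w \<in> alg C \<Longrightarrow> (\<lambda>x. v x * w x) \<in> alg C"

lemma alg_C_inf:
  assumes \<Omega>: "openin (Rn_top n) \<Omega>" and "v \<in> alg (C_inf n \<Omega>)"
  shows "v \<in> C_inf n \<Omega>"
proof (rule C_inf_coinduct[where S = "\<lambda>v. v \<in> alg (C_inf n \<Omega>)"])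
  fix w assume w: "w \<in> alg (C_inf n \<Omega>)"
  then show "cont_on_Rn n \<Omega> w"
    by (induction rule: alg.induct) (auto intro: C_inf_cont continuous_map_add continuous_map_real_mult)
  fix i assume i: "i < n"
  show "\<exists>w'. w' \<in> alg (C_inf n \<Omega>) \<and> (\<forall>x\<in>\<Omega>. has_partial i w (w' x) x)"
    using w
  proof (induction rule: alg.induct)
    case (base v)
    then show ?case using C_inf_has_partial[OF _ i] C_inf_partial[OF _ i] alg.base by blast
  next
    case (add v w)
    then obtain v' w' where "v' \<in> alg (C_inf n \<Omega>)" "\<forall>x\<in>\<Omega>. has_partial i v (v' x) x"
      "w' \<in> alg (C_inf n \<Omega>)" "\<forall>x\<in>\<Omega>. has_partial i w (w' x) x" by blast
    then show ?case by (intro exI[of _ "\<lambda>x. v' x + w' x"]) (auto intro: alg.add has_partial_add)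
  next
    case (mult v w)
    then obtain v' w' where "v' \<in> alg (C_inf n \<Omega>)" "\<forall>x\<in>\<Omega>. has_partial i v (v' x) x"
      "w' \<in> alg (C_inf n \<Omega>)" "\<forall>x\<in>\<Omega>. has_partial i w (w' x) x" by blast
    then show ?case using mult.hyps
      by (intro exI[of _ "\<lambda>x. v' x * w x + v x * w' x"]) (auto intro!: alg.add alg.mult has_partial_mult)
  qed
qed (use assms in auto)

lemma C_inf_add: "openin (Rn_top n) \<Omega> \<Longrightarrow> v \<in> C_inf n \<Omega> \<Longrightarrow> w \<in> C_inf n \<Omega> \<Longrightarrow> (\<lambda>x. v x + w x) \<in> C_inf n \<Omega>"
  by (rule alg_C_inf[OF _ alg.add[OF alg.base alg.base]])

lemma C_inf_mult: "openin (Rn_top n) \<Omega> \<Longrightarrow> v \<in> C_inf n \<Omega> \<Longrightarrow> w \<in> C_inf n \<Omega> \<Longrightarrow> (\<lambda>x. v x * w x) \<in> C_inf n \<Omega>"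
  by (rule alg_C_inf[OF _ alg.mult[OF alg.base alg.base]])

lemma C_inf_const: "openin (Rn_top n) \<Omega> \<Longrightarrow> (\<lambda>_. c) \<in> C_inf n \<Omega>"
proof (rule C_inf_coinduct[where S = "\<lambda>v. \<exists>c. v = (\<lambda>_. c)"])
  fix w :: "(nat \<Rightarrow> real) \<Rightarrow> real" and i
  assume "\<exists>c. w = (\<lambda>_. c)"
  then show "\<exists>w'. (\<exists>c. w' = (\<lambda>_. c)) \<and> (\<forall>x\<in>\<Omega>. has_partial i w (w' x) x)"
    by (intro exI[of _ "\<lambda>_. 0"]) (auto simp: has_partial_const)
qed auto

lemma C_inf_sum:
  assumes "openin (Rn_top n) \<Omega>" "finite J" "\<And>j. j \<in> J \<Longrightarrow> v j \<in> C_inf n \<Omega>"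
  shows "(\<lambda>x. \<Sum>j\<in>J. v j x) \<in> C_inf n \<Omega>"
  using assms(2,3)
proof (induction J rule: finite_induct)
  case (insert j J)
  then show ?case by (subst sum.insert) (auto intro!: C_inf_add assms(1))
qed (simp add: C_inf_const assms(1))

lemma C_inf_prod:
  assumes "openin (Rn_top n) \<Omega>" "finite J" "\<And>j. j \<in> J \<Longrightarrow> v j \<in> C_inf n \<Omega>"
  shows "(\<lambda>x. \<Prod>j\<in>J. v j x) \<in> C_inf n \<Omega>"
  using assms(2,3)
proof (induction J rule: finite_induct)
  case (insert j J)
  then show ?case by (subst prod.insert) (auto intro!: C_inf_mult assms(1))
qed (simp add: C_inf_const assms(1))

section \<open>Translation and reflection of smooth functions\<close>

lemma Rn_arb: "x \<in> Rn n \<Longrightarrow> \<not> i < n \<Longrightarrow> x i = undefined"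
  by (rule PiE_arb[of x "{..<n}"]) auto

text \<open>Restricting the difference makes it a point of \<open>Rn n\<close> whatever the
  arguments are, so convolution integrands need no side conditions.\<close>

definition vsub :: "nat \<Rightarrow> (nat \<Rightarrow> real) \<Rightarrow> (nat \<Rightarrow> real) \<Rightarrow> nat \<Rightarrow> real" where
  "vsub n x y = (\<lambda>i\<in>{..<n}. x i - y i)"

lemma vsub_Rn [simp]: "vsub n x y \<in> Rn n"
  by (simp add: vsub_def)

lemma vsub_nth [simp]: "i < n \<Longrightarrow> vsub n x y i = x i - y i"
  by (simp add: vsub_def)

lemma vsub_upd_right: "i < n \<Longrightarrow> vsub n x (y(i := t)) = (vsub n x y)(i := x i - t)"
  by (intro ext) (simp add: vsub_def)

lemma vsub_upd_left: "i < n \<Longrightarrow> vsub n (x(i := t)) y = (vsub n x y)(i := t - y i)"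
  by (intro ext) (simp add: vsub_def)

lemma vsub_vsub: "y \<in> Rn n \<Longrightarrow> vsub n x (vsub n x y) = y"
  using Rn_arb[of y n] by (intro ext) (simp add: vsub_def)

lemma has_partial_vsub_right:
  assumes "i < n" "has_partial i \<psi> D (vsub n x y)"
  shows "has_partial i (\<lambda>y. \<psi> (vsub n x y)) (- D) y"
proof -
  have "((\<lambda>t. \<psi> ((vsub n x y)(i := x i - t))) has_real_derivative D * (0 - 1)) (at (y i))"
  proof (rule DERIV_chain2[where g = "\<lambda>t. x i - t" and f = "\<lambda>s. \<psi> ((vsub n x y)(i := s))"])
    show "((\<lambda>s. \<psi> ((vsub n x y)(i := s))) has_real_derivative D) (at (x i - y i))"
      using assms by (simp add: has_partial_def)
  qed (auto intro!: derivative_eq_intros)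
  then show ?thesis using assms(1) by (simp add: has_partial_def vsub_upd_right)
qed

lemma has_partial_vsub_left:
  assumes "i < n" "has_partial i \<psi> D (vsub n x y)"
  shows "has_partial i (\<lambda>x. \<psi> (vsub n x y)) D x"
proof -
  have "((\<lambda>t. \<psi> ((vsub n x y)(i := t - y i))) has_real_derivative D * (1 - 0)) (at (x i))"
  proof (rule DERIV_chain2[where g = "\<lambda>t. t - y i" and f = "\<lambda>s. \<psi> ((vsub n x y)(i := s))"])
    show "((\<lambda>s. \<psi> ((vsub n x y)(i := s))) has_real_derivative D) (at (x i - y i))"
      using assms by (simp add: has_partial_def)
  qed (auto intro!: derivative_eq_intros)
  then show ?thesis using assms(1) by (simp add: has_partial_def vsub_upd_left)
qed

lemma cont_vsub_right:
  assumes "cont_on_Rn n (Rn n) \<psi>"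
  shows "cont_on_Rn n (Rn n) (\<lambda>y. \<psi> (vsub n x y))"
  unfolding continuous_map_Rn_iff[OF openin_Rn_UNIV]
proof (intro ballI allI impI)
  fix y and e :: real assume "y \<in> Rn n" "e > 0"
  then obtain d where "d > 0" "\<forall>z\<in>cube n (vsub n x y) d. \<bar>\<psi> z - \<psi> (vsub n x y)\<bar> < e"
    using assms vsub_Rn[of n x y] unfolding continuous_map_Rn_iff[OF openin_Rn_UNIV] by blast
  moreover have "vsub n x z \<in> cube n (vsub n x y) d" if "z \<in> cube n y d" for z
    using that by (simp add: mem_cube abs_minus_commute)
  ultimately show "\<exists>d>0. \<forall>z\<in>cube n y d. \<bar>\<psi> (vsub n x z) - \<psi> (vsub n x y)\<bar> < e" by blast
qed

lemma C_inf_vsub_right: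
  assumes "\<psi> \<in> C_inf n (Rn n)"
  shows "(\<lambda>y. \<psi> (vsub n x y)) \<in> C_inf n (Rn n)"
\<comment> \<open>The factor \<open>c\<close> absorbs the sign that each derivative of a reflected
  function produces.\<close>
proof (rule C_inf_coinduct[where S = "\<lambda>v. \<exists>c. \<exists>\<psi>\<in>C_inf n (Rn n). v = (\<lambda>y. c * \<psi> (vsub n x y))"])
  show "\<exists>c. \<exists>\<psi>'\<in>C_inf n (Rn n). (\<lambda>y. \<psi> (vsub n x y)) = (\<lambda>y. c * \<psi>' (vsub n x y))"
    using assms by (intro exI[of _ 1] bexI[of _ \<psi>]) auto
next
  fix w assume "\<exists>c. \<exists>\<psi>\<in>C_inf n (Rn n). w = (\<lambda>y. c * \<psi> (vsub n x y))"
  then obtain c \<psi> where \<psi>: "\<psi> \<in> C_inf n (Rn n)" and w: "w = (\<lambda>y. c * \<psi> (vsub n x y))" by blast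
  show "cont_on_Rn n (Rn n) w" unfolding w
    by (intro continuous_map_real_mult cont_vsub_right[OF C_inf_cont[OF \<psi>]]) auto
  fix i assume i: "i < n"
  have "has_partial i w (- c * partial i \<psi> (vsub n x y)) y" for y
    unfolding w
    using has_partial_mult[OF has_partial_const[of i c y]
        has_partial_vsub_right[OF i C_inf_has_partial[OF \<psi> i vsub_Rn[of n x y]]]] by simp
  then show "\<exists>w'. (\<exists>c. \<exists>\<psi>\<in>C_inf n (Rn n). w' = (\<lambda>y. c * \<psi> (vsub n x y))) \<and>
     (\<forall>x\<in>Rn n. has_partial i w (w' x) x)"
    using C_inf_partial[OF \<psi> i] by blast
qed (rule openin_Rn_UNIV)

section \<open>Test functions: support, bounds, Lipschitz continuity\<close>

lemma test_fun_iff: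
  "\<psi> \<in> test_fun n \<Omega> \<longleftrightarrow> \<psi> \<in> C_inf n (Rn n) \<and>
     (\<exists>K. compactin (Rn_top n) K \<and> K \<subseteq> \<Omega> \<and> (\<forall>x \<in> Rn n - K. \<psi> x = 0))"
  by (simp add: test_fun_def)

lemma test_fun_mono: "\<psi> \<in> test_fun n V \<Longrightarrow> V \<subseteq> \<Omega> \<Longrightarrow> \<psi> \<in> test_fun n \<Omega>"
  unfolding test_fun_iff by (meson order_trans)

lemma test_fun_partial:
  assumes "\<psi> \<in> test_fun n \<Omega>" "i < n" shows "partial i \<psi> \<in> test_fun n \<Omega>"
proof -
  obtain K where K: "compactin (Rn_top n) K" "K \<subseteq> \<Omega>" "\<forall>x \<in> Rn n - K. \<psi> x = 0"
    using assms(1) unfolding test_fun_iff by blast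
  \<comment> \<open>A function that vanishes on an open set has vanishing derivatives there, so the
    same \<open>K\<close> serves for the partial derivative.\<close>
  have "openin (Rn_top n) (Rn n - K)" using compactin_Rn_closedin[OF K(1)] by (simp add: closedin_def)
  from partial_cong[OF this, of _ i \<psi> "\<lambda>_. 0"] have "partial i \<psi> x = 0" if "x \<in> Rn n - K" for x
    using that K(3) assms(2) has_partial_imp_partial[OF has_partial_const[of i 0 x]] by auto
  then show ?thesis using assms K C_inf_partial[of \<psi> n "Rn n" i] unfolding test_fun_iff by meson
qed

lemma test_fun_bounded:
  assumes "\<psi> \<in> test_fun n \<Omega>"
  obtains B where "B \<ge> 0" "\<And>x. x \<in> Rn n \<Longrightarrow> \<bar>\<psi> x\<bar> \<le> B"
proof -
  obtain K where K: "compactin (Rn_top n) K" "\<forall>x \<in> Rn n - K. \<psi> x = 0"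
    using assms unfolding test_fun_iff by blast
  have "continuous_map (Rn_top n) euclideanreal \<psi>"
    using assms C_inf_cont[of \<psi> n "Rn n"] unfolding test_fun_iff
    by (metis subtopology_topspace topspace_Rn)
  then have "compactin euclideanreal (\<psi> ` K)" using K(1) by (rule image_compactin[rotated])
  then have "bounded (\<psi> ` K)" by (simp add: compact_imp_bounded)
  then obtain B where "\<forall>x\<in>K. \<bar>\<psi> x\<bar> \<le> B" by (auto simp: bounded_iff)
  then have "\<bar>\<psi> x\<bar> \<le> \<bar>B\<bar>" if "x \<in> Rn n" for x using K(2) that by (cases "x \<in> K") force+
  then show ?thesis using that[of "\<bar>B\<bar>"] by auto
qed

lemma cont_bounded_on_compact:
  assumes "compactin (Rn_top n) K" "K \<subseteq> \<Omega>" "cont_on_Rn n \<Omega> v"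
  obtains B where "B \<ge> 0" "\<And>x. x \<in> K \<Longrightarrow> \<bar>v x\<bar> \<le> B"
proof -
  have "compactin (subtopology (Rn_top n) \<Omega>) K" using assms by (simp add: compactin_subtopology)
  then have "compactin euclideanreal (v ` K)" using assms(3) by (rule image_compactin)
  then have "bounded (v ` K)" by (simp add: compact_imp_bounded)
  then obtain B where "\<forall>x\<in>K. \<bar>v x\<bar> \<le> B" by (auto simp: bounded_iff)
  then show ?thesis using that[of "\<bar>B\<bar>"] by force
qed

text \<open>The mean value inequality is applied along a path from \<open>y\<close> to
  \<open>x\<close> that replaces one coordinate at a time; each partial derivative is again a test
  function and therefore bounded.\<close>

lemma test_fun_lipschitz:
  assumes "\<psi> \<in> test_fun n \<Omega>"
  obtains L where "L \<ge> 0" "\<And>x y. x \<in> Rn n \<Longrightarrow> y \<in> Rn n \<Longrightarrow> \<bar>\<psi> x - \<psi> y\<bar> \<le> L * (\<Sum>i<n. \<bar>x i - y i\<bar>)"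
proof -
  have "\<exists>B. B \<ge> 0 \<and> (\<forall>x\<in>Rn n. \<bar>partial i \<psi> x\<bar> \<le> B)" if "i < n" for i
    using test_fun_bounded[OF test_fun_partial[OF assms that]] by metis
  then obtain B where B: "\<And>i. i < n \<Longrightarrow> B i \<ge> 0" "\<And>i x. i < n \<Longrightarrow> x \<in> Rn n \<Longrightarrow> \<bar>partial i \<psi> x\<bar> \<le> B i"
    by metis
  define L where "L = (\<Sum>i<n. B i)"
  have L: "B i \<le> L" if "i < n" for i
    unfolding L_def using that B by (intro member_le_sum) auto
  have L0: "L \<ge> 0" unfolding L_def using B by (intro sum_nonneg) auto
  have one: "\<bar>\<psi> (x(i := s)) - \<psi> x\<bar> \<le> L * \<bar>s - x i\<bar>" if "i < n" "x \<in> Rn n" for i x s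
  proof -
    have "((\<lambda>t. \<psi> (x(i := t))) has_field_derivative partial i \<psi> (x(i := t))) (at t within UNIV)" for t
      using C_inf_has_partial[of \<psi> n "Rn n" i "x(i := t)"] assms that Rn_upd[OF that(2,1), of t]
      by (simp add: test_fun_iff has_partial_def)
    then have "norm (\<psi> (x(i := s)) - \<psi> (x(i := x i))) \<le> L * norm (s - x i)"
      using order_trans[OF B(2)[OF that(1) Rn_upd[OF that(2,1)]] L[OF that(1)]]
      by (intro field_differentiable_bound[of UNIV "\<lambda>t. \<psi> (x(i := t))"]) auto
    then show ?thesis by simp
  qed
  have "\<bar>\<psi> x - \<psi> y\<bar> \<le> L * (\<Sum>i<n. \<bar>x i - y i\<bar>)" if xy: "x \<in> Rn n" "y \<in> Rn n" for x y
  proof -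
    define z where "z m = (\<lambda>i. if i < m then x i else y i)" for m
    have z: "z m \<in> Rn n" if "m \<le> n" for m
      using xy that unfolding PiE_iff extensional_def z_def by simp
    have step: "m \<le> n \<Longrightarrow> \<bar>\<psi> (z m) - \<psi> (z 0)\<bar> \<le> L * (\<Sum>i<m. \<bar>x i - y i\<bar>)" for m
    proof (induction m)
      case (Suc m)
      have "z (Suc m) = (z m)(m := x m)" by (auto simp: z_def fun_eq_iff)
      then have "\<bar>\<psi> (z (Suc m)) - \<psi> (z m)\<bar> \<le> L * \<bar>x m - z m m\<bar>"
        using one[of m "z m" "x m"] z[of m] Suc.prems by simp
      then have "\<bar>\<psi> (z (Suc m)) - \<psi> (z m)\<bar> \<le> L * \<bar>x m - y m\<bar>" by (simp add: z_def)
      then show ?case using Suc by (simp add: distrib_left)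
    qed simp
    have "z n i = x i" for i using Rn_arb[OF xy(1)] Rn_arb[OF xy(2)] by (cases "i < n") (simp_all add: z_def)
    then have "z n = x" "z 0 = y" by (simp_all add: z_def fun_eq_iff)
    with step[of n] show ?thesis by simp
  qed
  then show ?thesis using that L0 by blast
qed

lemma C_inf_borel:
  "openin (Rn_top n) \<Omega> \<Longrightarrow> v \<in> C_inf n \<Omega> \<Longrightarrow> (\<lambda>x. indicator \<Omega> x * v x) \<in> borel_measurable (lebn n)"
  by (intro borel_measurable_continuous_Rn C_inf_cont)

lemma test_fun_borel: "\<psi> \<in> test_fun n \<Omega> \<Longrightarrow> \<psi> \<in> borel_measurable (lebn n)"
proof -
  assume "\<psi> \<in> test_fun n \<Omega>"
  then have "(\<lambda>x. indicator (Rn n) x * \<psi> x) \<in> borel_measurable (lebn n)"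
    by (intro C_inf_borel openin_Rn_UNIV) (simp add: test_fun_iff)
  then show ?thesis by (subst measurable_cong[where g = "\<lambda>x. indicator (Rn n) x * \<psi> x"]) auto
qed

section \<open>Translation invariance and continuity of translations\<close>

text \<open>A product measure is determined by its values on boxes, and the preimage of a box under
  a coordinatewise map is a box.\<close>

lemma distr_lebn_coordinatewise:
  assumes [measurable]: "\<And>i. i < n \<Longrightarrow> f i \<in> borel_measurable borel"
    and f: "\<And>i. i < n \<Longrightarrow> distr lborel borel (f i) = (lborel :: real measure)"
  shows "distr (lebn n) (lebn n) (\<lambda>x. \<lambda>i\<in>{..<n}. f i (x i)) = lebn n"
proof (rule lebn.PiM_eqI)
  have T: "(\<lambda>x. \<lambda>i\<in>{..<n}. f i (x i)) \<in> lebn n \<rightarrow>\<^sub>M lebn n"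
    by (intro measurable_restrict) measurable
  fix A :: "nat \<Rightarrow> real set" assume A: "\<And>i. i \<in> {..<n} \<Longrightarrow> A i \<in> sets lborel"
  have "emeasure (distr (lebn n) (lebn n) (\<lambda>x. \<lambda>i\<in>{..<n}. f i (x i))) (Pi\<^sub>E {..<n} A)
      = emeasure (lebn n) ((\<lambda>x. \<lambda>i\<in>{..<n}. f i (x i)) -` (Pi\<^sub>E {..<n} A) \<inter> space (lebn n))"
    using A T by (intro emeasure_distr sets_PiM_I_finite) auto
  also have "(\<lambda>x. \<lambda>i\<in>{..<n}. f i (x i)) -` (Pi\<^sub>E {..<n} A) \<inter> space (lebn n) = Pi\<^sub>E {..<n} (\<lambda>i. f i -` A i)"
    by (auto simp: PiE_iff)
  also have "emeasure (lebn n) \<dots> = (\<Prod>i<n. emeasure lborel (f i -` A i))"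
    using A measurable_sets[OF assms(1), of _ "A _"] by (subst lebn.emeasure_PiM) auto
  also have "\<dots> = (\<Prod>i<n. emeasure lborel (A i))"
  proof (rule prod.cong[OF refl])
    fix i assume "i \<in> {..<n}"
    then have "emeasure (distr lborel borel (f i)) (A i) = emeasure lborel (f i -` A i \<inter> space lborel)"
      using A assms(1)[of i] by (intro emeasure_distr) auto
    then show "emeasure lborel (f i -` A i) = emeasure lborel (A i)"
      using f[of i] \<open>i \<in> {..<n}\<close> by simp
  qed
  finally show "emeasure (distr (lebn n) (lebn n) (\<lambda>x. \<lambda>i\<in>{..<n}. f i (x i))) (Pi\<^sub>E {..<n} A)
      = (\<Prod>i<n. emeasure lborel (A i))" .
qed auto

lemma distr_lborel_reflect: "distr lborel borel (\<lambda>t. a - t) = (lborel :: real measure)"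
  using lborel_real_affine[of "-1" a] by (simp add: density_1 one_ennreal_def[symmetric])

lemma distr_lborel_shift: "distr lborel borel (\<lambda>t. t - a) = (lborel :: real measure)"
proof -
  have "(\<lambda>t. t - a) = (+) (-a)" by auto
  then show ?thesis using lborel_distr_plus[of "-a"] by simp
qed

lemma distr_vsub_right: "distr (lebn n) (lebn n) (vsub n x) = lebn n"
  using distr_lebn_coordinatewise[of n "\<lambda>i t. x i - t"] distr_lborel_reflect
  unfolding vsub_def by simp

lemma distr_vsub_left: "distr (lebn n) (lebn n) (\<lambda>x. vsub n x z) = lebn n"
  using distr_lebn_coordinatewise[of n "\<lambda>i t. t - z i"] distr_lborel_shift
  unfolding vsub_def by simp

lemma measurable_vsub_right [measurable]: "vsub n x \<in> lebn n \<rightarrow>\<^sub>M lebn n"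
  unfolding vsub_def by (intro measurable_restrict) measurable

lemma measurable_vsub_left [measurable]: "(\<lambda>x. vsub n x z) \<in> lebn n \<rightarrow>\<^sub>M lebn n"
  unfolding vsub_def by (intro measurable_restrict) measurable

lemma measurable_vsub_pair [measurable]: "(\<lambda>p. vsub n (fst p) (snd p)) \<in> lebn n \<Otimes>\<^sub>M lebn n \<rightarrow>\<^sub>M lebn n"
  unfolding vsub_def by (intro measurable_restrict) measurable

lemma nn_integral_vsub_left:
  "g \<in> borel_measurable (lebn n) \<Longrightarrow> (\<integral>\<^sup>+x. g (vsub n x z) \<partial>lebn n) = (\<integral>\<^sup>+y. g y \<partial>lebn n)"
  using nn_integral_distr[OF measurable_vsub_left[of n z], of g] by (simp add: distr_vsub_left)

lemma integral_vsub_right: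
  "(g :: _ \<Rightarrow> real) \<in> borel_measurable (lebn n) \<Longrightarrow> (\<integral>y. g (vsub n x y) \<partial>lebn n) = (\<integral>y. g y \<partial>lebn n)"
  using integral_distr[OF measurable_vsub_right[of n x], of g] by (simp add: distr_vsub_right)

lemma integrable_vsub_right:
  "integrable (lebn n) (g :: _ \<Rightarrow> real) \<Longrightarrow> integrable (lebn n) (\<lambda>y. g (vsub n x y))"
  using integrable_distr[OF measurable_vsub_right[of n x], of g] by (simp add: distr_vsub_right)

text \<open>Continuity of translations in \<open>L^1\<close> at the zero shift. With an
  \<open>ennreal\<close> integral only measurability is required, so the closure properties below
  carry no integrability side conditions.\<close>

definition translation_cont :: "nat \<Rightarrow> ((nat \<Rightarrow> real) \<Rightarrow> real) \<Rightarrow> bool" where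
  "translation_cont n W \<longleftrightarrow> W \<in> borel_measurable (lebn n) \<and>
     (\<forall>e>0. \<exists>d>0. \<forall>z. (\<forall>i<n. \<bar>z i\<bar> < d) \<longrightarrow> (\<integral>\<^sup>+x. ennreal \<bar>W (vsub n x z) - W x\<bar> \<partial>lebn n) \<le> ennreal e)"

lemma translation_cont_borel: "translation_cont n W \<Longrightarrow> W \<in> borel_measurable (lebn n)"
  by (simp add: translation_cont_def)

lemma translation_cont_add:
  assumes "translation_cont n V" "translation_cont n W"
  shows "translation_cont n (\<lambda>x. V x + W x)"
proof -
  note [measurable] = assms[THEN translation_cont_borel]
  have "\<exists>d>0. \<forall>z. (\<forall>i<n. \<bar>z i\<bar> < d) \<longrightarrow>
      (\<integral>\<^sup>+x. ennreal \<bar>(V (vsub n x z) + W (vsub n x z)) - (V x + W x)\<bar> \<partial>lebn n) \<le> ennreal e" if e: "e > 0" for e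
  proof -
    obtain d1 where d1: "d1 > 0" "\<And>z. (\<forall>i<n. \<bar>z i\<bar> < d1) \<Longrightarrow> (\<integral>\<^sup>+x. ennreal \<bar>V (vsub n x z) - V x\<bar> \<partial>lebn n) \<le> ennreal (e/2)"
      using assms(1) e unfolding translation_cont_def by (meson half_gt_zero)
    obtain d2 where d2: "d2 > 0" "\<And>z. (\<forall>i<n. \<bar>z i\<bar> < d2) \<Longrightarrow> (\<integral>\<^sup>+x. ennreal \<bar>W (vsub n x z) - W x\<bar> \<partial>lebn n) \<le> ennreal (e/2)"
      using assms(2) e unfolding translation_cont_def by (meson half_gt_zero)
    have "(\<integral>\<^sup>+x. ennreal \<bar>(V (vsub n x z) + W (vsub n x z)) - (V x + W x)\<bar> \<partial>lebn n) \<le> ennreal e"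
      if z: "\<forall>i<n. \<bar>z i\<bar> < min d1 d2" for z
    proof -
      have "(\<integral>\<^sup>+x. ennreal \<bar>(V (vsub n x z) + W (vsub n x z)) - (V x + W x)\<bar> \<partial>lebn n)
        \<le> (\<integral>\<^sup>+x. ennreal \<bar>V (vsub n x z) - V x\<bar> + ennreal \<bar>W (vsub n x z) - W x\<bar> \<partial>lebn n)"
        by (intro nn_integral_mono) (simp flip: ennreal_plus)
      also have "\<dots> = (\<integral>\<^sup>+x. ennreal \<bar>V (vsub n x z) - V x\<bar> \<partial>lebn n) + (\<integral>\<^sup>+x. ennreal \<bar>W (vsub n x z) - W x\<bar> \<partial>lebn n)"
        by (intro nn_integral_add) auto
      also have "\<dots> \<le> ennreal (e/2) + ennreal (e/2)"
        using z by (intro add_mono d1 d2) auto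
      finally show ?thesis using e by (simp flip: ennreal_plus)
    qed
    then show ?thesis using d1(1) d2(1) by (intro exI[of _ "min d1 d2"]) auto
  qed
  then show ?thesis unfolding translation_cont_def by simp
qed

lemma translation_cont_cmult:
  assumes "translation_cont n V"
  shows "translation_cont n (\<lambda>x. c * V x)"
proof -
  note [measurable] = assms[THEN translation_cont_borel]
  have "\<exists>d>0. \<forall>z. (\<forall>i<n. \<bar>z i\<bar> < d) \<longrightarrow>
      (\<integral>\<^sup>+x. ennreal \<bar>c * V (vsub n x z) - c * V x\<bar> \<partial>lebn n) \<le> ennreal e" if e: "e > 0" for e
  proof -
    have "e / (\<bar>c\<bar> + 1) > 0" using e by (simp add: add_nonneg_pos)
    then obtain d where d: "d > 0"
      "\<And>z. (\<forall>i<n. \<bar>z i\<bar> < d) \<Longrightarrow> (\<integral>\<^sup>+x. ennreal \<bar>V (vsub n x z) - V x\<bar> \<partial>lebn n) \<le> ennreal (e / (\<bar>c\<bar> + 1))"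
      using assms unfolding translation_cont_def by meson
    have "(\<integral>\<^sup>+x. ennreal \<bar>c * V (vsub n x z) - c * V x\<bar> \<partial>lebn n) \<le> ennreal e"
      if z: "\<forall>i<n. \<bar>z i\<bar> < d" for z
    proof -
      have "(\<integral>\<^sup>+x. ennreal \<bar>c * V (vsub n x z) - c * V x\<bar> \<partial>lebn n)
         = (\<integral>\<^sup>+x. ennreal \<bar>c\<bar> * ennreal \<bar>V (vsub n x z) - V x\<bar> \<partial>lebn n)"
        by (intro nn_integral_cong) (simp add: ennreal_mult[symmetric] abs_mult[symmetric] right_diff_distrib)
      also have "\<dots> = ennreal \<bar>c\<bar> * (\<integral>\<^sup>+x. ennreal \<bar>V (vsub n x z) - V x\<bar> \<partial>lebn n)"
        by (intro nn_integral_cmult) auto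
      also have "\<dots> \<le> ennreal \<bar>c\<bar> * ennreal (e / (\<bar>c\<bar> + 1))"
        using d(2)[OF z] by (intro mult_left_mono) auto
      also have "\<dots> \<le> ennreal e"
        using e by (simp add: ennreal_mult[symmetric] field_simps add_nonneg_pos)
      finally show ?thesis .
    qed
    then show ?thesis using d(1) by blast
  qed
  then show ?thesis unfolding translation_cont_def by simp
qed

lemma translation_cont_cong:
  assumes "translation_cont n V" "\<And>x. x \<in> Rn n \<Longrightarrow> V x = W x"
  shows "translation_cont n W"
proof -
  have "W \<in> borel_measurable (lebn n)"
    using translation_cont_borel[OF assms(1)] measurable_cong[of "lebn n" V W borel] assms(2) by simp
  moreover have "(\<integral>\<^sup>+x. ennreal \<bar>V (vsub n x z) - V x\<bar> \<partial>lebn n) = (\<integral>\<^sup>+x. ennreal \<bar>W (vsub n x z) - W x\<bar> \<partial>lebn n)" for z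
    using assms(2) by (intro nn_integral_cong) simp
  ultimately show ?thesis using assms(1) unfolding translation_cont_def by simp
qed

text \<open>Split the difference into three terms through \<open>V\<close>; the translated error
  equals the untranslated one by invariance of the measure.\<close>

lemma translation_cont_approx:
  assumes [measurable]: "W \<in> borel_measurable (lebn n)"
    and V: "\<And>e. e > 0 \<Longrightarrow> \<exists>V. translation_cont n V \<and> (\<integral>\<^sup>+x. ennreal \<bar>W x - V x\<bar> \<partial>lebn n) \<le> ennreal e"
  shows "translation_cont n W"
proof -
  have "\<exists>d>0. \<forall>z. (\<forall>i<n. \<bar>z i\<bar> < d) \<longrightarrow>
      (\<integral>\<^sup>+x. ennreal \<bar>W (vsub n x z) - W x\<bar> \<partial>lebn n) \<le> ennreal e" if e: "e > 0" for e
  proof -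
    obtain V where tV: "translation_cont n V" and V: "(\<integral>\<^sup>+x. ennreal \<bar>W x - V x\<bar> \<partial>lebn n) \<le> ennreal (e/3)"
      using V[of "e/3"] e by auto
    note [measurable] = translation_cont_borel[OF tV]
    have "e / 3 > 0" using e by simp
    then obtain d where d: "d > 0"
      "\<And>z. (\<forall>i<n. \<bar>z i\<bar> < d) \<Longrightarrow> (\<integral>\<^sup>+x. ennreal \<bar>V (vsub n x z) - V x\<bar> \<partial>lebn n) \<le> ennreal (e / 3)"
      using tV unfolding translation_cont_def by meson
    have "(\<integral>\<^sup>+x. ennreal \<bar>W (vsub n x z) - W x\<bar> \<partial>lebn n) \<le> ennreal e"
      if z: "\<forall>i<n. \<bar>z i\<bar> < d" for z
    proof -
      have "(\<integral>\<^sup>+x. ennreal \<bar>W (vsub n x z) - W x\<bar> \<partial>lebn n)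
        \<le> (\<integral>\<^sup>+x. ennreal \<bar>W (vsub n x z) - V (vsub n x z)\<bar> +
             (ennreal \<bar>V (vsub n x z) - V x\<bar> + ennreal \<bar>W x - V x\<bar>) \<partial>lebn n)"
        by (intro nn_integral_mono) (simp flip: ennreal_plus)
      also have "\<dots> = (\<integral>\<^sup>+x. ennreal \<bar>W (vsub n x z) - V (vsub n x z)\<bar> \<partial>lebn n) +
          ((\<integral>\<^sup>+x. ennreal \<bar>V (vsub n x z) - V x\<bar> \<partial>lebn n) + (\<integral>\<^sup>+x. ennreal \<bar>W x - V x\<bar> \<partial>lebn n))"
        by (subst nn_integral_add, simp, simp, subst nn_integral_add) auto
      also have "(\<integral>\<^sup>+x. ennreal \<bar>W (vsub n x z) - V (vsub n x z)\<bar> \<partial>lebn n) = (\<integral>\<^sup>+x. ennreal \<bar>W x - V x\<bar> \<partial>lebn n)"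
        by (rule nn_integral_vsub_left[where g = "\<lambda>x. ennreal \<bar>W x - V x\<bar>"]) simp
      also have "(\<integral>\<^sup>+x. ennreal \<bar>W x - V x\<bar> \<partial>lebn n) +
          ((\<integral>\<^sup>+x. ennreal \<bar>V (vsub n x z) - V x\<bar> \<partial>lebn n) + (\<integral>\<^sup>+x. ennreal \<bar>W x - V x\<bar> \<partial>lebn n))
          \<le> ennreal (e/3) + (ennreal (e/3) + ennreal (e/3))"
        using z by (intro add_mono d V) auto
      also have "\<dots> = ennreal e" using e by (simp flip: ennreal_plus)
      finally show ?thesis .
    qed
    then show ?thesis using d(1) by blast
  qed
  then show ?thesis unfolding translation_cont_def by simp
qed

lemma translation_cont_lim:
  assumes s: "\<And>k. translation_cont n (s k)" and f: "f \<in> borel_measurable (lebn n)" and w: "integrable (lebn n) w"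
    and lim: "\<And>x. x \<in> Rn n \<Longrightarrow> (\<lambda>k. s k x) \<longlonglongrightarrow> f x"
    and bound: "\<And>k x. x \<in> Rn n \<Longrightarrow> \<bar>s k x - f x\<bar> \<le> w x"
  shows "translation_cont n f"
proof (rule translation_cont_approx[OF f])
  note [measurable] = s[THEN translation_cont_borel] f
  fix e :: real assume e: "e > 0"
  have "(\<lambda>k. \<integral>\<^sup>+x. ennreal \<bar>f x - s k x\<bar> \<partial>lebn n) \<longlonglongrightarrow> (\<integral>\<^sup>+x. 0 \<partial>lebn n)"
  proof (rule nn_integral_dominated_convergence[where w = "\<lambda>x. ennreal (w x)"])
    show "(\<integral>\<^sup>+x. ennreal (w x) \<partial>lebn n) < \<infinity>"
      using w integrableD(2)[OF w] by (auto simp: less_top real_integrable_def)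
    show "AE x in lebn n. ennreal \<bar>f x - s j x\<bar> \<le> ennreal (w x)" for j
      using bound by (intro AE_I2) (auto intro!: ennreal_leI simp: abs_minus_commute)
    show "AE x in lebn n. (\<lambda>k. ennreal \<bar>f x - s k x\<bar>) \<longlonglongrightarrow> 0"
    proof (rule AE_I2)
      fix x assume "x \<in> space (lebn n)"
      then have "(\<lambda>k. \<bar>f x - s k x\<bar>) \<longlonglongrightarrow> \<bar>f x - f x\<bar>"
        using lim by (intro tendsto_intros) simp
      then show "(\<lambda>k. ennreal \<bar>f x - s k x\<bar>) \<longlonglongrightarrow> 0"
        by (metis tendsto_ennrealI diff_self abs_zero ennreal_0)
    qed
  qed (use w in auto)
  then have "eventually (\<lambda>k. (\<integral>\<^sup>+x. ennreal \<bar>f x - s k x\<bar> \<partial>lebn n) < ennreal e) sequentially"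
    using e by (auto simp: order_tendsto_iff)
  then show "\<exists>V. translation_cont n V \<and> (\<integral>\<^sup>+x. ennreal \<bar>f x - V x\<bar> \<partial>lebn n) \<le> ennreal e"
    using s by (meson eventually_sequentially less_imp_le order_refl)
qed

text \<open>Lower orthants are closed under intersection, so a Dynkin-system induction over all
  measurable sets can start from them, and intersected with a cube they become boxes.\<close>

lemma sets_lebn_atMost:
  "sets (lebn n) = sigma_sets (Rn n) (range (\<lambda>a. {x \<in> Rn n. \<forall>i<n. x i \<le> a i}))"
proof -
  have "sets (lebn n) = sets (\<Pi>\<^sub>M i\<in>{..<n}. sigma UNIV (range (\<lambda>a::real. {..a})))"
    by (intro sets_PiM_cong refl) (simp add: borel_eq_atMost[symmetric])
  also have "\<dots> = sets (sigma (Pi\<^sub>E {..<n} (\<lambda>_. UNIV))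
    {{f\<in>(\<Pi>\<^sub>E i\<in>{..<n}. UNIV). \<forall>i\<in>j. f i \<in> A i} | A j. j \<in> {{..<n}} \<and> A \<in> Pi j (\<lambda>_. range (\<lambda>a::real. {..a}))})"
  proof (rule sets_PiM_sigma)
    fix i assume "i \<in> {..<n}"
    have "UNIV = \<Union>(range (\<lambda>k::nat. {..real k}))"
      by (auto intro: real_arch_simple)
    then show "\<exists>S\<subseteq>range (\<lambda>a::real. {..a}). countable S \<and> UNIV = \<Union>S"
      by (intro exI[of _ "range (\<lambda>k::nat. {..real k})"]) auto
  qed auto
  also have "{{f\<in>(\<Pi>\<^sub>E i\<in>{..<n}. UNIV). \<forall>i\<in>j. f i \<in> A i} | A j. j \<in> {{..<n}} \<and> A \<in> Pi j (\<lambda>_. range (\<lambda>a::real. {..a}))}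
    = range (\<lambda>a. {x \<in> Rn n. \<forall>i<n. x i \<le> a i})"
  proof (intro equalityI subsetI)
    fix B assume "B \<in> {{f\<in>(\<Pi>\<^sub>E i\<in>{..<n}. UNIV). \<forall>i\<in>j. f i \<in> A i} | A j. j \<in> {{..<n}} \<and> A \<in> Pi j (\<lambda>_. range (\<lambda>a::real. {..a}))}"
    then obtain A where A: "B = {f \<in> Rn n. \<forall>i<n. f i \<in> A i}" "\<And>i. i < n \<Longrightarrow> \<exists>a. A i = {..a}"
      by (auto simp: Pi_iff image_iff)
    then obtain a where "\<And>i. i < n \<Longrightarrow> A i = {..a i}" by metis
    with A(1) have "B = {x \<in> Rn n. \<forall>i<n. x i \<le> a i}" by simp
    then show "B \<in> range (\<lambda>a. {x \<in> Rn n. \<forall>i<n. x i \<le> a i})" by blast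
  next
    fix B assume "B \<in> range (\<lambda>a. {x \<in> Rn n. \<forall>i<n. x i \<le> (a i :: real)})"
    then obtain a where "B = {x \<in> Rn n. \<forall>i<n. x i \<le> a i}" by blast
    then show "B \<in> {{f\<in>(\<Pi>\<^sub>E i\<in>{..<n}. UNIV). \<forall>i\<in>j. f i \<in> A i} | A j. j \<in> {{..<n}} \<and> A \<in> Pi j (\<lambda>_. range (\<lambda>a::real. {..a}))}"
      by (intro CollectI exI[of _ "\<lambda>i. {..a i}"] exI[of _ "{..<n}"]) auto
  qed
  also have "sets (sigma (Rn n) (range (\<lambda>a. {x \<in> Rn n. \<forall>i<n. x i \<le> a i}))) =
    sigma_sets (Rn n) (range (\<lambda>a. {x \<in> Rn n. \<forall>i<n. x i \<le> a i}))"
    by (intro sets_measure_of) auto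
  finally show ?thesis .
qed

lemma prod_mono_ennreal:
  "(\<And>i. i \<in> A \<Longrightarrow> f i \<le> g i) \<Longrightarrow> prod f A \<le> (prod g A :: ennreal)"
proof (induction A rule: infinite_finite_induct)
  case (insert a A)
  then show ?case by (simp add: mult_mono)
qed auto

definition halfopen_box :: "nat \<Rightarrow> real \<Rightarrow> (nat \<Rightarrow> real) \<Rightarrow> (nat \<Rightarrow> real) set" where
  "halfopen_box n R b = {x \<in> Rn n. \<forall>i<n. - R < x i \<and> x i \<le> b i}"

lemma halfopen_box_sets [measurable]: "halfopen_box n R b \<in> sets (lebn n)"
proof -
  have "halfopen_box n R b = Pi\<^sub>E {..<n} (\<lambda>i. {-R<..b i})"
  proof (intro equalityI subsetI)
    fix x assume "x \<in> halfopen_box n R b"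
    then show "x \<in> Pi\<^sub>E {..<n} (\<lambda>i. {-R<..b i})" by (simp add: halfopen_box_def PiE_iff)
  next
    fix x assume "x \<in> Pi\<^sub>E {..<n} (\<lambda>i. {-R<..b i})"
    then show "x \<in> halfopen_box n R b" by (simp add: halfopen_box_def PiE_iff)
  qed
  then show ?thesis by (simp add: sets_PiM_I_finite)
qed

text \<open>A box and its translate differ only close to the faces, on slabs whose measure is
  proportional to the size of the shift.\<close>

lemma translation_cont_box:
  assumes R: "R > 0" and b: "\<And>i. i < n \<Longrightarrow> b i \<le> R"
  shows "translation_cont n (indicator (halfopen_box n R b))"
proof -
  \<comment> \<open>Both faces orthogonal to direction \<open>i\<close>, thickened by
    \<open>d\<close> to either side (total width at most \<open>4 * d\<close>); for shifts below 1
    the remaining coordinates stay within \<open>R + 1\<close>.\<close>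
  define S where "S d i = Pi\<^sub>E {..<n} (\<lambda>k. if k = i then {-R-d..-R+d} \<union> {b i-d..b i+d} else {-R-1..R+1})" for d i
  have S [measurable]: "S d i \<in> sets (lebn n)" for d i
    unfolding S_def by (intro sets_PiM_I_finite) auto
  have mS: "emeasure (lebn n) (S d i) \<le> ennreal (4 * d * (2 * R + 2) ^ (n - 1))" if d: "d > 0" and i: "i < n" for d i
  proof -
    have "emeasure lborel ({-R-d..-R+d} \<union> {b i-d..b i+d}) \<le> ennreal (2 * d) + ennreal (2 * d)"
      using emeasure_subadditive[of "{-R-d..-R+d}" lborel "{b i-d..b i+d}"] d by simp
    then have four: "emeasure lborel ({-R-d..-R+d} \<union> {b i-d..b i+d}) \<le> ennreal (4 * d)"
      using d by (simp flip: ennreal_plus)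
    have "emeasure (lebn n) (S d i)
      = (\<Prod>k<n. emeasure lborel (if k = i then {-R-d..-R+d} \<union> {b i-d..b i+d} else {-R-1..R+1}))"
      unfolding S_def by (intro lebn.emeasure_PiM) auto
    also have "\<dots> \<le> (\<Prod>k<n. ennreal (if k = i then 4 * d else 2 * R + 2))"
      using four R by (intro prod_mono_ennreal) auto
    also have "\<dots> = ennreal (\<Prod>k<n. if k = i then 4 * d else 2 * R + 2)"
      using d R by (intro prod_ennreal) auto
    also have "(\<Prod>k<n. if k = i then 4 * d else 2 * R + 2) = 4 * d * (\<Prod>k\<in>{..<n} - {i}. 2 * R + 2)"
      using i by (subst prod.remove[of _ i]) auto
    also have "(\<Prod>k\<in>{..<n} - {i}. 2 * R + 2) = (2 * R + 2) ^ (n - 1)"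
      using i by simp
    finally show ?thesis .
  qed
  have pt: "\<bar>indicat_real (halfopen_box n R b) (vsub n x z) - indicat_real (halfopen_box n R b) x\<bar>
      \<le> (\<Sum>i<n. indicator (S d i) x)"
    if x: "x \<in> Rn n" and z: "\<forall>i<n. \<bar>z i\<bar> < d" and d: "d \<le> 1" for x z d
  proof (cases "vsub n x z \<in> halfopen_box n R b \<longleftrightarrow> x \<in> halfopen_box n R b")
    case True
    then show ?thesis by (simp add: indicator_def sum_nonneg)
  next
    case False
    have *: "\<exists>i<n. (\<bar>x i + R\<bar> \<le> d \<or> \<bar>x i - b i\<bar> \<le> d) \<and> (\<forall>k<n. \<bar>x k\<bar> \<le> R + 1)"
    proof (cases "x \<in> halfopen_box n R b")
      case True
      then obtain i where i: "i < n" "\<not> (- R < x i - z i \<and> x i - z i \<le> b i)"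
        using False by (auto simp: halfopen_box_def)
      have "\<bar>x k\<bar> \<le> R + 1" if "k < n" for k
        using True that R b[OF that] by (simp add: halfopen_box_def abs_le_iff) (smt (verit))
      moreover have "\<bar>x i + R\<bar> \<le> d \<or> \<bar>x i - b i\<bar> \<le> d"
        using i True z[rule_format, OF i(1)] by (simp add: halfopen_box_def) (smt (verit))
      ultimately show ?thesis using i(1) by blast
    next
      case nin: False
      then obtain i where i: "i < n" "\<not> (- R < x i \<and> x i \<le> b i)"
        using x by (auto simp: halfopen_box_def)
      have vs: "- R < x k - z k \<and> x k - z k \<le> b k" if "k < n" for k
        using False nin that by (simp add: halfopen_box_def)
      have "\<bar>x k\<bar> \<le> R + 1" if "k < n" for k
        using vs[OF that] z[rule_format, OF that] R b[OF that] d by (simp add: abs_le_iff) (smt (verit))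
      moreover have "\<bar>x i + R\<bar> \<le> d \<or> \<bar>x i - b i\<bar> \<le> d"
        using i vs[OF i(1)] z[rule_format, OF i(1)] by (smt (verit))
      ultimately show ?thesis using i(1) by blast
    qed
    then obtain i where i: "i < n" "\<bar>x i + R\<bar> \<le> d \<or> \<bar>x i - b i\<bar> \<le> d" "\<And>k. k < n \<Longrightarrow> \<bar>x k\<bar> \<le> R + 1" by blast
    have "x \<in> S d i"
      unfolding S_def PiE_iff
    proof (intro conjI ballI)
      fix k assume k: "k \<in> {..<n}"
      then show "x k \<in> (if k = i then {-R-d..-R+d} \<union> {b i-d..b i+d} else {-R-1..R+1})"
        using i(2) i(3)[of k] by (auto simp: abs_le_iff)
    qed (use x in \<open>simp add: PiE_iff\<close>)
    then have "1 \<le> (indicator (S d i) x :: real)" by simp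
    also have "\<dots> \<le> (\<Sum>i<n. indicator (S d i) x)"
      using i(1) by (intro member_le_sum) auto
    finally show ?thesis by (auto simp: indicator_def)
  qed
  have "\<exists>d>0. \<forall>z. (\<forall>i<n. \<bar>z i\<bar> < d) \<longrightarrow> (\<integral>\<^sup>+x. ennreal \<bar>indicat_real (halfopen_box n R b) (vsub n x z) - indicat_real (halfopen_box n R b) x\<bar> \<partial>lebn n) \<le> ennreal e" if e: "e > 0" for e
  proof -
    \<comment> \<open>The slabs have total measure at most \<open>d * (C - 1)\<close>; the added 1
      keeps \<open>C\<close> positive in dimension 0.\<close>
    define C where "C = real n * (4 * (2 * R + 2) ^ (n - 1)) + 1"
    have C: "C > 0" unfolding C_def using R by (intro add_nonneg_pos mult_nonneg_nonneg) auto
    define d where "d = min 1 (e / C)"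
    have d: "d > 0" "d \<le> 1" "d \<le> e / C" using e C by (auto simp: d_def)
    have "(\<integral>\<^sup>+x. ennreal \<bar>indicat_real (halfopen_box n R b) (vsub n x z) - indicat_real (halfopen_box n R b) x\<bar> \<partial>lebn n) \<le> ennreal e"
      if z: "\<forall>i<n. \<bar>z i\<bar> < d" for z
    proof -
      have "(\<integral>\<^sup>+x. ennreal \<bar>indicat_real (halfopen_box n R b) (vsub n x z) - indicat_real (halfopen_box n R b) x\<bar> \<partial>lebn n)
        \<le> (\<integral>\<^sup>+x. ennreal (\<Sum>i<n. indicator (S d i) x) \<partial>lebn n)"
        using pt[OF _ z d(2)] by (intro nn_integral_mono ennreal_leI) simp
      also have "\<dots> = (\<integral>\<^sup>+x. (\<Sum>i<n. indicator (S d i) x) \<partial>lebn n)"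
        by (intro nn_integral_cong) (simp add: ennreal_indicator flip: sum_ennreal)
      also have "\<dots> = (\<Sum>i<n. emeasure (lebn n) (S d i))"
        by (subst nn_integral_sum) auto
      also have "\<dots> \<le> (\<Sum>i<n. ennreal (4 * d * (2 * R + 2) ^ (n - 1)))"
        using mS[OF d(1)] by (intro sum_mono) auto
      also have "\<dots> = ennreal (\<Sum>i<n. 4 * d * (2 * R + 2) ^ (n - 1))"
        using d R by (intro sum_ennreal) auto
      also have "\<dots> \<le> ennreal e"
      proof (rule ennreal_leI)
        have "(\<Sum>i<n. 4 * d * (2 * R + 2) ^ (n - 1)) = d * (C - 1)" by (simp add: C_def)
        also have "\<dots> \<le> d * C" using d(1) by (intro mult_left_mono) auto
        also have "\<dots> \<le> e" using d(3) C by (simp add: field_simps)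
        finally show "(\<Sum>i<n. 4 * d * (2 * R + 2) ^ (n - 1)) \<le> e" .
      qed
      finally show ?thesis .
    qed
    then show ?thesis using d(1) by blast
  qed
  then show ?thesis unfolding translation_cont_def by simp
qed

lemma halfopen_box_finite: "emeasure (lebn n) (halfopen_box n R (\<lambda>_. R)) < \<infinity>"
proof (rule emeasure_bounded_finite)
  fix x i assume "x \<in> halfopen_box n R (\<lambda>_. R)" "i < n"
  then show "\<bar>x i\<bar> \<le> R" by (simp add: halfopen_box_def abs_le_iff) (smt (verit))
qed (simp add: halfopen_box_def subset_iff)

text \<open>Dynkin-system induction. The intersection with a fixed cube turns complements into
  differences of two indicators of finite measure and supplies the dominating function for disjoint
  unions.\<close>

lemma translation_cont_indicator_bounded:
  assumes R: "R > 0" and A: "A \<in> sets (lebn n)"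
  shows "translation_cont n (indicator (A \<inter> halfopen_box n R (\<lambda>_. R)))"
proof -
  let ?B = "halfopen_box n R (\<lambda>_. R)"
  let ?G = "range (\<lambda>a. {x \<in> Rn n. \<forall>i<n. x i \<le> (a i::real)})"
  have intB: "integrable (lebn n) (indicat_real ?B)"
    using halfopen_box_finite[of n R] by (intro integrable_real_indicator) auto
  have sub: "?B \<subseteq> Rn n" by (auto simp: halfopen_box_def)
  have 1: "A \<in> sigma_sets (Rn n) ?G" using A by (simp add: sets_lebn_atMost)
  have 2: "Int_stable ?G"
  proof (rule Int_stableI)
    fix C D assume "C \<in> ?G" "D \<in> ?G"
    then obtain c d where "C = {x \<in> Rn n. \<forall>i<n. x i \<le> c i}" "D = {x \<in> Rn n. \<forall>i<n. x i \<le> d i}" by blast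
    then have "C \<inter> D = {x \<in> Rn n. \<forall>i<n. x i \<le> min (c i) (d i)}" by auto
    then show "C \<inter> D \<in> ?G" by (intro range_eqI[of _ _ "\<lambda>i. min (c i) (d i)"]) simp
  qed
  have 3: "?G \<subseteq> Pow (Rn n)" by auto
  show ?thesis
    using 2 3 1
  proof (induction A rule: sigma_sets_induct_disjoint)
    case (basic C)
    then obtain a where "C = {x \<in> Rn n. \<forall>i<n. x i \<le> a i}" by blast
    then have "C \<inter> ?B = halfopen_box n R (\<lambda>i. min (a i) R)"
      unfolding halfopen_box_def by auto
    then show ?case using translation_cont_box[OF R, of n "\<lambda>i. min (a i) R"] by simp
  next
    case empty
    show ?case by (rule translation_cont_cong[where V = "\<lambda>_. 0"]) (auto simp: translation_cont_def intro: exI[of _ 1])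
  next
    case (compl C)
    have "translation_cont n (\<lambda>x. indicator ?B x + (-1) * indicator (C \<inter> ?B) x)"
      by (intro translation_cont_add translation_cont_cmult compl translation_cont_box[OF R]) auto
    then show ?case
      by (rule translation_cont_cong) (simp add: indicator_def)
  next
    case (union C)
    have C: "C i \<in> sets (lebn n)" for i using union.hyps(2) by (auto simp: sets_lebn_atMost)
    have part: "translation_cont n (\<lambda>x. \<Sum>i<k. indicator (C i \<inter> ?B) x)" for k
    proof (induction k)
      case 0
      show ?case by (auto simp: translation_cont_def intro: exI[of _ 1])
    next
      case (Suc k)
      then show ?case using union.IH by (simp add: translation_cont_add)
    qed
    have sums: "(\<lambda>i. indicat_real (C i \<inter> ?B) x) sums indicat_real (\<Union>i. C i \<inter> ?B) x" for x
      using union.hyps(1) by (intro indicator_sums) (auto simp: disjoint_family_on_def)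
    have eq: "(\<Union>i. C i \<inter> ?B) = (\<Union>i. C i) \<inter> ?B" by auto
    show ?case
    proof (rule translation_cont_lim[OF part _ intB])
      show "(indicator ((\<Union>i. C i) \<inter> ?B) :: _ \<Rightarrow> real) \<in> borel_measurable (lebn n)"
        using C by measurable
      fix x
      show "(\<lambda>k. \<Sum>i<k. indicator (C i \<inter> ?B) x) \<longlonglongrightarrow> indicat_real ((\<Union>i. C i) \<inter> ?B) x"
        using sums[of x] by (simp add: sums_def eq)
      fix k
      have "(\<Sum>i<k. indicat_real (C i \<inter> ?B) x) \<le> indicat_real ((\<Union>i. C i) \<inter> ?B) x"
        using sums[of x] sum_le_suminf[of "\<lambda>i. indicat_real (C i \<inter> ?B) x" "{..<k}"] unfolding eq sums_iff by auto
      moreover have "(\<Sum>i<k. indicat_real (C i \<inter> ?B) x) \<ge> 0" by (intro sum_nonneg) auto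
      moreover have "indicat_real ((\<Union>i. C i) \<inter> ?B) x \<le> indicat_real ?B x" by (auto simp: indicator_def)
      ultimately show "\<bar>(\<Sum>i<k. indicat_real (C i \<inter> ?B) x) - indicat_real ((\<Union>i. C i) \<inter> ?B) x\<bar> \<le> indicat_real ?B x"
        by simp
    qed
  qed
qed

theorem integrable_translation_cont:
  assumes "integrable (lebn n) W"
  shows "translation_cont n W"
  using assms
proof (induction rule: integrable_induct)
  case (base A c)
  have intA: "integrable (lebn n) (indicat_real A)"
    using base by (intro integrable_real_indicator) auto
  have "translation_cont n (indicat_real A)"
  \<comment> \<open>A set of finite measure is the limit of its truncations to growing cubes,
    dominated by its own indicator.\<close>
  proof (rule translation_cont_lim[OF translation_cont_indicator_bounded _ intA])
    show "0 < real (Suc k)" for k by simp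
    show "A \<in> sets (lebn n)" by fact
    fix x k
    show "\<bar>indicat_real (A \<inter> halfopen_box n (real (Suc k)) (\<lambda>_. real (Suc k))) x - indicat_real A x\<bar> \<le> indicat_real A x"
      by (auto simp: indicator_def)
    assume x: "x \<in> Rn n"
    obtain N where N: "real N > (\<Sum>i<n. \<bar>x i\<bar>)" using reals_Archimedean2 by blast
    have "indicat_real (A \<inter> halfopen_box n (real (Suc k)) (\<lambda>_. real (Suc k))) x = indicat_real A x" if "k \<ge> N" for k
    proof -
      have "\<bar>x i\<bar> < real (Suc k)" if "i < n" for i
      proof -
        have "\<bar>x i\<bar> \<le> (\<Sum>i<n. \<bar>x i\<bar>)" using that by (intro member_le_sum) auto
        then show ?thesis using N \<open>k \<ge> N\<close> by simp
      qed
      then have "x \<in> halfopen_box n (real (Suc k)) (\<lambda>_. real (Suc k))"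
        using x unfolding halfopen_box_def by (simp add: abs_less_iff) (smt (verit))
      then show ?thesis by (auto simp: indicator_def)
    qed
    then show "(\<lambda>k. indicat_real (A \<inter> halfopen_box n (real (Suc k)) (\<lambda>_. real (Suc k))) x) \<longlonglongrightarrow> indicat_real A x"
      by (intro tendsto_eventually) (auto simp: eventually_sequentially)
  qed (use base in auto)
  from translation_cont_cmult[OF this, of c] show ?case by (simp add: mult.commute)
next
  case (add f g)
  then show ?case by (simp add: translation_cont_add)
next
  case (lim f s)
  show ?case
  proof (rule translation_cont_lim[OF lim.IH])
    \<comment> \<open>The approximating simple functions are bounded by
      \<open>2 * \<bar>f x\<bar>\<close>, hence the factor 3 for the difference.\<close>
    show "integrable (lebn n) (\<lambda>x. 3 * \<bar>f x\<bar>)" using lim.hyps(4) by simp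
    show "\<bar>s k x - f x\<bar> \<le> 3 * \<bar>f x\<bar>" if "x \<in> Rn n" for k x
      using lim.hyps(3)[of x k] that by simp
  qed (use lim.hyps in auto)
qed

text \<open>Dominated convergence for difference quotients, which the mean value inequality bounds
  by \<open>B\<close>.\<close>

lemma DERIV_integral:
  fixes f :: "real \<Rightarrow> 'a \<Rightarrow> real"
  assumes t0: "t0 \<in> {a<..<b}"
    and int: "\<And>t. t \<in> {a<..<b} \<Longrightarrow> integrable M (f t)"
    and der: "\<And>t y. t \<in> {a<..<b} \<Longrightarrow> y \<in> space M \<Longrightarrow> ((\<lambda>t. f t y) has_real_derivative f' t y) (at t)"
    and bd: "\<And>t y. t \<in> {a<..<b} \<Longrightarrow> y \<in> space M \<Longrightarrow> \<bar>f' t y\<bar> \<le> B y"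
    and B: "integrable M B" and f': "f' t0 \<in> borel_measurable M"
  shows "((\<lambda>t. \<integral>y. f t y \<partial>M) has_real_derivative (\<integral>y. f' t0 y \<partial>M)) (at t0)"
proof -
  have "((\<lambda>t. ((\<integral>y. f t y \<partial>M) - (\<integral>y. f t0 y \<partial>M)) / (t - t0)) \<longlongrightarrow> (\<integral>y. f' t0 y \<partial>M)) (at t0 within {a<..<b})"
    unfolding tendsto_at_iff_sequentially
  proof (intro allI impI)
    fix X assume X: "\<forall>k. X k \<in> {a<..<b} - {t0}" "X \<longlonglongrightarrow> t0"
    have "(\<lambda>k. \<integral>y. (f (X k) y - f t0 y) / (X k - t0) \<partial>M) \<longlonglongrightarrow> (\<integral>y. f' t0 y \<partial>M)"
    proof (rule integral_dominated_convergence[OF f' _ B])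
      show "(\<lambda>y. (f (X k) y - f t0 y) / (X k - t0)) \<in> borel_measurable M" for k
      proof -
        have "f (X k) \<in> borel_measurable M" "f t0 \<in> borel_measurable M"
          using X(1) int int[OF t0] by (auto dest: borel_measurable_integrable)
        then show ?thesis by measurable
      qed
      show "AE y in M. (\<lambda>k. (f (X k) y - f t0 y) / (X k - t0)) \<longlonglongrightarrow> f' t0 y"
      proof (rule AE_I2)
        fix y assume y: "y \<in> space M"
        have "((\<lambda>t. (f t y - f t0 y) / (t - t0)) \<longlongrightarrow> f' t0 y) (at t0)"
          using der[OF t0 y] by (simp add: has_field_derivative_iff)
        then show "(\<lambda>k. (f (X k) y - f t0 y) / (X k - t0)) \<longlonglongrightarrow> f' t0 y"
          using X unfolding tendsto_at_iff_sequentially by (auto simp: o_def)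
      qed
      show "AE y in M. norm ((f (X k) y - f t0 y) / (X k - t0)) \<le> B y" for k
      proof (rule AE_I2)
        fix y assume y: "y \<in> space M"
        have "norm (f (X k) y - f t0 y) \<le> B y * norm (X k - t0)"
        proof (rule field_differentiable_bound[of "{a<..<b}" "\<lambda>t. f t y" "\<lambda>t. f' t y"])
          show "((\<lambda>t. f t y) has_field_derivative f' z y) (at z within {a<..<b})" if "z \<in> {a<..<b}" for z
            using der[OF that y] by (rule has_field_derivative_at_within)
          show "norm (f' z y) \<le> B y" if "z \<in> {a<..<b}" for z using bd[OF that y] by simp
        qed (use X(1) t0 in auto)
        moreover have "X k \<noteq> t0" using X(1) by auto
        ultimately show "norm ((f (X k) y - f t0 y) / (X k - t0)) \<le> B y"
          by (simp add: field_simps)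
      qed
    qed
    moreover have "(\<integral>y. (f (X k) y - f t0 y) / (X k - t0) \<partial>M) = ((\<integral>y. f (X k) y \<partial>M) - (\<integral>y. f t0 y \<partial>M)) / (X k - t0)" for k
      using Bochner_Integration.integral_diff[OF int[of "X k"] int[OF t0]] X(1) by simp
    ultimately show "((\<lambda>t. ((\<integral>y. f t y \<partial>M) - (\<integral>y. f t0 y \<partial>M)) / (t - t0)) \<circ> X) \<longlonglongrightarrow> (\<integral>y. f' t0 y \<partial>M)"
      unfolding o_def by (simp only:)
  qed
  moreover have "at t0 within {a<..<b} = at t0" using t0 by (intro at_within_open) auto
  ultimately show ?thesis by (simp add: has_field_derivative_iff)
qed

section \<open>Convolution\<close>

definition conv :: "nat \<Rightarrow> ((nat \<Rightarrow> real) \<Rightarrow> real) \<Rightarrow> ((nat \<Rightarrow> real) \<Rightarrow> real) \<Rightarrow> (nat \<Rightarrow> real) \<Rightarrow> real" where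
  "conv n k W x = (\<integral>y. k (vsub n x y) * W y \<partial>lebn n)"

lemma integrable_mult_bounded:
  fixes W :: "'a \<Rightarrow> real"
  assumes W: "integrable M W" and f: "f \<in> borel_measurable M" and B: "\<And>y. y \<in> space M \<Longrightarrow> \<bar>f y\<bar> \<le> B"
  shows "integrable M (\<lambda>y. f y * W y)"
proof (rule Bochner_Integration.integrable_bound)
  show "integrable M (\<lambda>y. B * W y)" using W by simp
  show "AE x in M. norm (f x * W x) \<le> norm (B * W x)"
  proof (rule AE_I2)
    fix x assume "x \<in> space M"
    then have "\<bar>f x\<bar> \<le> \<bar>B\<bar>" using B by force
    then show "norm (f x * W x) \<le> norm (B * W x)" by (simp add: abs_mult mult_right_mono)
  qed
qed (use f W in measurable)

lemma conv_integrable: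
  assumes k: "k \<in> test_fun n (Rn n)" and W: "integrable (lebn n) W"
  shows "integrable (lebn n) (\<lambda>y. k (vsub n x y) * W y)"
proof -
  obtain B where "\<And>x. x \<in> Rn n \<Longrightarrow> \<bar>k x\<bar> \<le> B" using test_fun_bounded[OF k] by blast
  moreover have "(\<lambda>y. k (vsub n x y)) \<in> borel_measurable (lebn n)"
    using measurable_compose[OF measurable_vsub_right test_fun_borel[OF k]] .
  ultimately show ?thesis using W by (intro integrable_mult_bounded[where B = B]) auto
qed

lemma conv_has_partial:
  assumes k: "k \<in> test_fun n (Rn n)" and W: "integrable (lebn n) W" and i: "i < n" and x: "x \<in> Rn n"
  shows "has_partial i (conv n k W) (conv n (partial i k) W x) x"
proof -
  have pk: "partial i k \<in> test_fun n (Rn n)" using k i by (rule test_fun_partial)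
  obtain B where B: "\<And>x. x \<in> Rn n \<Longrightarrow> \<bar>partial i k x\<bar> \<le> B" using test_fun_bounded[OF pk] by blast
  have "((\<lambda>t. \<integral>y. k (vsub n (x(i := t)) y) * W y \<partial>lebn n) has_real_derivative
      (\<integral>y. partial i k (vsub n (x(i := x i)) y) * W y \<partial>lebn n)) (at (x i))"
  proof (rule DERIV_integral[where a = "x i - 1" and b = "x i + 1" and B = "\<lambda>y. B * \<bar>W y\<bar>"
        and f' = "\<lambda>t y. partial i k (vsub n (x(i := t)) y) * W y"])
    show "integrable (lebn n) (\<lambda>y. k (vsub n (x(i := t)) y) * W y)" for t
      by (rule conv_integrable[OF k W])
    show "((\<lambda>t. k (vsub n (x(i := t)) y) * W y) has_real_derivative partial i k (vsub n (x(i := t)) y) * W y) (at t)" for t y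
    proof -
      have "has_partial i (\<lambda>x. k (vsub n x y)) (partial i k (vsub n (x(i := t)) y)) (x(i := t))"
        using k i by (intro has_partial_vsub_left C_inf_has_partial[of k n "Rn n"]) (auto simp: test_fun_iff)
      then have "((\<lambda>t. k (vsub n (x(i := t)) y)) has_real_derivative partial i k (vsub n (x(i := t)) y)) (at t)"
        by (simp add: has_partial_def)
      then show ?thesis by (rule DERIV_cmult_right)
    qed
    show "\<bar>partial i k (vsub n (x(i := t)) y) * W y\<bar> \<le> B * \<bar>W y\<bar>" for t y
      using B by (simp add: abs_mult mult_right_mono)
    show "integrable (lebn n) (\<lambda>y. B * \<bar>W y\<bar>)" using W by simp
    show "(\<lambda>y. partial i k (vsub n (x(i := x i)) y) * W y) \<in> borel_measurable (lebn n)"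
      using conv_integrable[OF pk W] by (auto dest: borel_measurable_integrable)
  qed auto
  then show ?thesis by (simp add: has_partial_def conv_def)
qed

text \<open>The Lipschitz estimate of the kernel passes to the convolution, with the
  \<open>L^1\<close> norm of \<open>W\<close> as a factor.\<close>

lemma conv_cont:
  assumes k: "k \<in> test_fun n (Rn n)" and W: "integrable (lebn n) W"
  shows "cont_on_Rn n (Rn n) (conv n k W)"
  unfolding continuous_map_Rn_iff[OF openin_Rn_UNIV]
proof (intro ballI allI impI)
  fix x and e :: real assume x: "x \<in> Rn n" and e: "e > 0"
  obtain L where L: "L \<ge> 0"
    "\<And>x y. x \<in> Rn n \<Longrightarrow> y \<in> Rn n \<Longrightarrow> \<bar>k x - k y\<bar> \<le> L * (\<Sum>i<n. \<bar>x i - y i\<bar>)"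
    using test_fun_lipschitz[OF k] by blast
  define I where "I = (\<integral>y. \<bar>W y\<bar> \<partial>lebn n)"
  have I: "I \<ge> 0" unfolding I_def by (intro integral_nonneg_AE) auto
  \<comment> \<open>The added 1 covers the case that the Lipschitz constant or the norm of
    \<open>W\<close> is zero.\<close>
  define d where "d = e / (L * real n * I + 1)"
  have pos: "L * real n * I + 1 > 0" using L I by (intro add_nonneg_pos mult_nonneg_nonneg) auto
  have d: "d > 0" using e pos by (simp add: d_def)
  have "\<bar>conv n k W y - conv n k W x\<bar> < e" if y: "y \<in> cube n x d" for y
  proof -
    have "(\<Sum>i<n. \<bar>y i - x i\<bar>) \<le> (\<Sum>i<n. d)" using y by (intro sum_mono) (auto simp: mem_cube intro: less_imp_le)
    then have sm: "(\<Sum>i<n. \<bar>y i - x i\<bar>) \<le> real n * d" by simp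
    have "conv n k W y - conv n k W x = (\<integral>z. k (vsub n y z) * W z - k (vsub n x z) * W z \<partial>lebn n)"
      unfolding conv_def by (rule Bochner_Integration.integral_diff[symmetric]) (rule conv_integrable[OF k W])+
    also have "\<bar>\<dots>\<bar> \<le> (\<integral>z. \<bar>k (vsub n y z) * W z - k (vsub n x z) * W z\<bar> \<partial>lebn n)"
      by (rule integral_abs_bound)
    also have "\<dots> \<le> (\<integral>z. L * (real n * d) * \<bar>W z\<bar> \<partial>lebn n)"
    proof (rule integral_mono)
      show "integrable (lebn n) (\<lambda>z. \<bar>k (vsub n y z) * W z - k (vsub n x z) * W z\<bar>)"
        by (intro integrable_abs Bochner_Integration.integrable_diff conv_integrable[OF k W])
      show "\<bar>k (vsub n y z) * W z - k (vsub n x z) * W z\<bar> \<le> L * (real n * d) * \<bar>W z\<bar>" for z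
      proof -
        have "\<bar>k (vsub n y z) - k (vsub n x z)\<bar> \<le> L * (\<Sum>i<n. \<bar>y i - x i\<bar>)"
          using L(2)[of "vsub n y z" "vsub n x z"] by simp
        also have "\<dots> \<le> L * (real n * d)" using sm L(1) by (rule mult_left_mono)
        finally show ?thesis by (simp add: left_diff_distrib[symmetric] abs_mult mult_right_mono)
      qed
    qed (use W in auto)
    also have "\<dots> = d * (L * real n * I)" by (simp add: I_def mult_ac)
    also have "\<dots> < d * (L * real n * I + 1)" using d by simp
    also have "\<dots> = e" using pos by (simp add: d_def)
    finally show ?thesis .
  qed
  then show "\<exists>d>0. \<forall>y\<in>cube n x d. \<bar>conv n k W y - conv n k W x\<bar> < e" using d by blast
qed

lemma conv_C_inf:
  assumes k: "k \<in> test_fun n (Rn n)" and W: "integrable (lebn n) W"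
  shows "conv n k W \<in> C_inf n (Rn n)"
proof (rule C_inf_coinduct[where S = "\<lambda>v. \<exists>k\<in>test_fun n (Rn n). v = conv n k W"])
  show "\<exists>k'\<in>test_fun n (Rn n). conv n k W = conv n k' W" using k by blast
next
  fix w assume "\<exists>k\<in>test_fun n (Rn n). w = conv n k W"
  then obtain k where k: "k \<in> test_fun n (Rn n)" "w = conv n k W" by blast
  show "cont_on_Rn n (Rn n) w" using conv_cont k W by blast
  fix i assume "i < n"
  then show "\<exists>w'. (\<exists>k\<in>test_fun n (Rn n). w' = conv n k W) \<and> (\<forall>x\<in>Rn n. has_partial i w (w' x) x)"
    using conv_has_partial[OF k(1) W] test_fun_partial[OF k(1)] k(2) by blast
qed (rule openin_Rn_UNIV)

lemma conv_borel:
  assumes "k \<in> test_fun n (Rn n)" "integrable (lebn n) W"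
  shows "conv n k W \<in> borel_measurable (lebn n)"
proof -
  have "(\<lambda>x. indicator (Rn n) x * conv n k W x) \<in> borel_measurable (lebn n)"
    by (intro C_inf_borel openin_Rn_UNIV conv_C_inf assms)
  then show ?thesis by (subst measurable_cong[where g = "\<lambda>x. indicator (Rn n) x * conv n k W x"]) auto
qed

section \<open>Compactly supported kernels and mollifiers\<close>

definition ccube :: "nat \<Rightarrow> (nat \<Rightarrow> real) \<Rightarrow> real \<Rightarrow> (nat \<Rightarrow> real) set" where
  "ccube n x d = {y \<in> Rn n. \<forall>i<n. \<bar>y i - x i\<bar> \<le> d}"

lemma mem_ccube: "y \<in> ccube n x d \<longleftrightarrow> y \<in> Rn n \<and> (\<forall>i<n. \<bar>y i - x i\<bar> \<le> d)"
  by (simp add: ccube_def)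

lemma compactin_ccube: "compactin (Rn_top n) (ccube n x d)"
proof -
  have "ccube n x d = Pi\<^sub>E {..<n} (\<lambda>i. {x i - d..x i + d})"
  proof (intro equalityI subsetI)
    fix y assume "y \<in> ccube n x d"
    then show "y \<in> Pi\<^sub>E {..<n} (\<lambda>i. {x i - d..x i + d})" by (auto simp: mem_ccube PiE_iff abs_le_iff algebra_simps)
  next
    fix y assume "y \<in> Pi\<^sub>E {..<n} (\<lambda>i. {x i - d..x i + d})"
    then show "y \<in> ccube n x d" by (auto simp: mem_ccube PiE_iff abs_le_iff algebra_simps)
  qed
  then show ?thesis by (auto simp: compactin_PiE)
qed

text \<open>Only smoothness and support, without sign or mass: derivatives of mollifiers and the
  weighted kernels \<open>psi\<close> must be covered as well.\<close>

definition kernel :: "nat \<Rightarrow> real \<Rightarrow> ((nat \<Rightarrow> real) \<Rightarrow> real) \<Rightarrow> bool" where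
  "kernel n s k \<longleftrightarrow> k \<in> C_inf n (Rn n) \<and> (\<forall>x\<in>Rn n. (\<exists>i<n. s < \<bar>x i\<bar>) \<longrightarrow> k x = 0)"

lemma kernel_test_fun: "kernel n s k \<Longrightarrow> k \<in> test_fun n (Rn n)"
  unfolding kernel_def test_fun_iff
proof (elim conjE, intro conjI exI)
  assume *: "\<forall>x\<in>Rn n. (\<exists>i<n. s < \<bar>x i\<bar>) \<longrightarrow> k x = 0"
  show "compactin (Rn_top n) (ccube n (\<lambda>_. 0) s)" by (rule compactin_ccube)
  show "ccube n (\<lambda>_. 0) s \<subseteq> Rn n" by (simp add: ccube_def)
  show "\<forall>x\<in>Rn n - ccube n (\<lambda>_. 0) s. k x = 0" using * by (auto simp: mem_ccube not_le)
qed

lemma kernel_outside: "kernel n s k \<Longrightarrow> y \<in> Rn n \<Longrightarrow> y \<notin> ccube n x s \<Longrightarrow> k (vsub n x y) = 0"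
proof -
  assume k: "kernel n s k" and y: "y \<in> Rn n" "y \<notin> ccube n x s"
  then obtain i where i: "i < n" "s < \<bar>y i - x i\<bar>" by (auto simp: mem_ccube not_le)
  then have "s < \<bar>vsub n x y i\<bar>" by (simp add: abs_minus_commute)
  then show ?thesis using k i(1) vsub_Rn[of n x y] unfolding kernel_def by blast
qed

text \<open>Being outside the closed cube is an open condition, so \<open>k\<close> vanishes on a
  neighbourhood of such a point. The support radius does not grow.\<close>

lemma kernel_partial:
  assumes k: "kernel n s k" and i: "i < n" shows "kernel n s (partial i k)"
proof -
  have "partial i k x = 0" if x: "x \<in> Rn n" "j < n" "s < \<bar>x j\<bar>" for x j
  proof -
    have op: "openin (Rn_top n) (cube n x (\<bar>x j\<bar> - s))" using x(1) by (rule openin_cube)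
    have "k y = 0" if y: "y \<in> cube n x (\<bar>x j\<bar> - s)" for y
    proof -
      have "\<bar>y j - x j\<bar> < \<bar>x j\<bar> - s" "y \<in> Rn n" using y x(2) by (auto simp: mem_cube)
      then have "s < \<bar>y j\<bar>" by linarith
      then show ?thesis using k x(2) \<open>y \<in> Rn n\<close> unfolding kernel_def by blast
    qed
    then have "partial i k x = partial i (\<lambda>_. 0) x"
      using partial_cong[OF op _ i, of x k "\<lambda>_. 0"] x cube_self by auto
    then show ?thesis using has_partial_imp_partial[OF has_partial_const[of i 0 x]] by simp
  qed
  then show ?thesis using k C_inf_partial[OF _ i] unfolding kernel_def by blast
qed

lemma conv_cong:
  assumes k: "kernel n s k" and eq: "\<And>y. y \<in> ccube n x s \<Longrightarrow> V y = W y"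
  shows "conv n k V x = conv n k W x"
  unfolding conv_def
proof (rule Bochner_Integration.integral_cong[OF refl])
  fix y assume "y \<in> space (lebn n)"
  then show "k (vsub n x y) * V y = k (vsub n x y) * W y"
    using kernel_outside[OF k, of y x] eq[of y] by (cases "y \<in> ccube n x s") auto
qed

definition mollifier :: "nat \<Rightarrow> real \<Rightarrow> ((nat \<Rightarrow> real) \<Rightarrow> real) \<Rightarrow> bool" where
  "mollifier n s k \<longleftrightarrow> kernel n s k \<and> (\<forall>x\<in>Rn n. 0 \<le> k x) \<and> integrable (lebn n) k \<and> (\<integral>x. k x \<partial>lebn n) = 1"

lemma mollifier_kernel: "mollifier n s k \<Longrightarrow> kernel n s k"
  by (simp add: mollifier_def)

lemma mollifier_test_fun: "mollifier n s k \<Longrightarrow> k \<in> test_fun n (Rn n)"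
  using mollifier_kernel kernel_test_fun by blast

lemma mollifier_nonneg: "mollifier n s k \<Longrightarrow> 0 \<le> k (vsub n x y)"
  by (simp add: mollifier_def)

lemma mollifier_integrable: "mollifier n s k \<Longrightarrow> integrable (lebn n) (\<lambda>y. k (vsub n x y))"
  by (simp add: mollifier_def integrable_vsub_right)

lemma mollifier_integral: "mollifier n s k \<Longrightarrow> (\<integral>y. k (vsub n x y) \<partial>lebn n) = 1"
  by (simp add: mollifier_def integral_vsub_right borel_measurable_integrable)

lemma conv_mono:
  assumes "mollifier n s k" "integrable (lebn n) V" "integrable (lebn n) W" "\<And>y. y \<in> Rn n \<Longrightarrow> V y \<le> W y"
  shows "conv n k V x \<le> conv n k W x"
  unfolding conv_def
  using assms mollifier_nonneg[OF assms(1)]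
  by (intro integral_mono conv_integrable mollifier_test_fun[OF assms(1)]) (auto intro: mult_left_mono)

lemma conv_nonneg:
  assumes "mollifier n s k" "\<And>y. y \<in> Rn n \<Longrightarrow> 0 \<le> W y"
  shows "0 \<le> conv n k W x"
  unfolding conv_def using assms mollifier_nonneg[OF assms(1)]
  by (intro integral_nonneg_AE AE_I2) auto

lemma conv_mollifier_eq:
  assumes k: "mollifier n s k" and c: "\<And>y. y \<in> ccube n x s \<Longrightarrow> W y = c"
  shows "conv n k W x = c"
proof -
  have "conv n k W x = conv n k (\<lambda>_. c) x" using c by (intro conv_cong[OF mollifier_kernel[OF k]])
  then show ?thesis using mollifier_integral[OF k, of x] by (simp add: conv_def)
qed

lemma conv_reflect:
  assumes k: "k \<in> test_fun n (Rn n)" and W: "W \<in> borel_measurable (lebn n)"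
  shows "conv n k W x = (\<integral>z. k z * W (vsub n x z) \<partial>lebn n)"
proof -
  have "(\<lambda>y. k (vsub n x y)) \<in> borel_measurable (lebn n)"
    using measurable_compose[OF measurable_vsub_right test_fun_borel[OF k]] .
  then have "(\<lambda>y. k (vsub n x y) * W y) \<in> borel_measurable (lebn n)" using W by measurable
  from integral_vsub_right[OF this, of x]
  have "conv n k W x = (\<integral>z. k (vsub n x (vsub n x z)) * W (vsub n x z) \<partial>lebn n)" by (simp add: conv_def)
  also have "\<dots> = (\<integral>z. k z * W (vsub n x z) \<partial>lebn n)"
    by (intro Bochner_Integration.integral_cong) (auto simp: vsub_vsub)
  finally show ?thesis .
qed

text \<open>The convolution is an average of translates. By Tonelli's theorem its distance from
  \<open>W\<close> is at most the average of the distances of the translates, and only shifts in the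
  support of the kernel count.\<close>

lemma conv_L1:
  assumes k: "mollifier n s k" and W: "integrable (lebn n) W" and e: "e \<ge> 0"
    and osc: "\<And>z. (\<forall>i<n. \<bar>z i\<bar> \<le> s) \<Longrightarrow> (\<integral>\<^sup>+x. ennreal \<bar>W (vsub n x z) - W x\<bar> \<partial>lebn n) \<le> ennreal e"
  shows "(\<integral>\<^sup>+x. ennreal \<bar>conv n k W x - W x\<bar> \<partial>lebn n) \<le> ennreal e"
proof -
  have tk: "k \<in> test_fun n (Rn n)" using mollifier_test_fun[OF k] .
  note [measurable] = test_fun_borel[OF tk] borel_measurable_integrable[OF W]
  have kint: "integrable (lebn n) k" using k by (simp add: mollifier_def)
  have pt: "ennreal \<bar>conv n k W x - W x\<bar> \<le> (\<integral>\<^sup>+z. ennreal (k z) * ennreal \<bar>W (vsub n x z) - W x\<bar> \<partial>lebn n)"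
    if x: "x \<in> Rn n" for x
  proof -
    have i1: "integrable (lebn n) (\<lambda>z. k z * W (vsub n x z))"
    proof -
      obtain B where "\<And>x. x \<in> Rn n \<Longrightarrow> \<bar>k x\<bar> \<le> B" using test_fun_bounded[OF tk] by blast
      then show ?thesis
        by (intro integrable_mult_bounded[where B = B] integrable_vsub_right[OF W]) auto
    qed
    have "conv n k W x - W x = (\<integral>z. k z * W (vsub n x z) \<partial>lebn n) - (\<integral>z. k z * W x \<partial>lebn n)"
      using k by (simp add: conv_reflect[OF tk] mollifier_def)
    also have "\<dots> = (\<integral>z. k z * W (vsub n x z) - k z * W x \<partial>lebn n)"
      using i1 kint by (intro Bochner_Integration.integral_diff[symmetric]) auto
    also have "\<dots> = (\<integral>z. k z * (W (vsub n x z) - W x) \<partial>lebn n)" by (simp add: right_diff_distrib)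
    finally have eq: "conv n k W x - W x = (\<integral>z. k z * (W (vsub n x z) - W x) \<partial>lebn n)" .
    have i2: "integrable (lebn n) (\<lambda>z. k z * (W (vsub n x z) - W x))"
      using i1 kint by (simp add: right_diff_distrib)
    have "ennreal \<bar>conv n k W x - W x\<bar> \<le> (\<integral>\<^sup>+z. ennreal \<bar>k z * (W (vsub n x z) - W x)\<bar> \<partial>lebn n)"
      unfolding eq using integral_norm_bound_ennreal[OF i2] by simp
    also have "\<dots> = (\<integral>\<^sup>+z. ennreal (k z) * ennreal \<bar>W (vsub n x z) - W x\<bar> \<partial>lebn n)"
      using k by (intro nn_integral_cong) (simp add: mollifier_def abs_mult ennreal_mult)
    finally show ?thesis .
  qed
  have "(\<integral>\<^sup>+x. ennreal \<bar>conv n k W x - W x\<bar> \<partial>lebn n)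
     \<le> (\<integral>\<^sup>+x. \<integral>\<^sup>+z. ennreal (k z) * ennreal \<bar>W (vsub n x z) - W x\<bar> \<partial>lebn n \<partial>lebn n)"
    using pt by (intro nn_integral_mono) simp
  also have "\<dots> = (\<integral>\<^sup>+z. \<integral>\<^sup>+x. ennreal (k z) * ennreal \<bar>W (vsub n x z) - W x\<bar> \<partial>lebn n \<partial>lebn n)"
  proof (rule lebn2.Fubini'[symmetric])
    have [measurable]: "(\<lambda>p. W (vsub n (fst p) (snd p))) \<in> borel_measurable (lebn n \<Otimes>\<^sub>M lebn n)"
      by (rule measurable_compose[OF measurable_vsub_pair borel_measurable_integrable[OF W]])
    show "(\<lambda>(x, z). ennreal (k z) * ennreal \<bar>W (vsub n x z) - W x\<bar>) \<in> borel_measurable (lebn n \<Otimes>\<^sub>M lebn n)"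
      unfolding split_beta by measurable
  qed
  also have "\<dots> \<le> (\<integral>\<^sup>+z. ennreal (k z) * ennreal e \<partial>lebn n)"
  proof (rule nn_integral_mono)
    fix z assume z: "z \<in> space (lebn n)"
    have "(\<integral>\<^sup>+x. ennreal (k z) * ennreal \<bar>W (vsub n x z) - W x\<bar> \<partial>lebn n)
       = ennreal (k z) * (\<integral>\<^sup>+x. ennreal \<bar>W (vsub n x z) - W x\<bar> \<partial>lebn n)"
      by (intro nn_integral_cmult) measurable
    also have "\<dots> \<le> ennreal (k z) * ennreal e"
    proof (cases "\<forall>i<n. \<bar>z i\<bar> \<le> s")
      case True
      then show ?thesis by (intro mult_left_mono osc) auto
    next
      case False
      then have "k z = 0" using k z unfolding mollifier_def kernel_def by (auto simp: not_le)
      then show ?thesis by simp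
    qed
    finally show "(\<integral>\<^sup>+x. ennreal (k z) * ennreal \<bar>W (vsub n x z) - W x\<bar> \<partial>lebn n) \<le> ennreal (k z) * ennreal e" .
  qed
  also have "\<dots> = (\<integral>\<^sup>+z. ennreal (k z) \<partial>lebn n) * ennreal e" by (intro nn_integral_multc) auto
  also have "(\<integral>\<^sup>+z. ennreal (k z) \<partial>lebn n) = ennreal (\<integral>z. k z \<partial>lebn n)"
    using k by (intro nn_integral_eq_integral AE_I2) (auto simp: mollifier_def)
  also have "\<dots> = 1" using k by (simp add: mollifier_def)
  finally show ?thesis by simp
qed

lemma mollify_L1:
  assumes W: "integrable (lebn n) W" and e: "e > 0"
  obtains d where "d > 0"
    "\<And>s k. mollifier n s k \<Longrightarrow> s < d \<Longrightarrow> (\<integral>\<^sup>+x. ennreal \<bar>conv n k W x - W x\<bar> \<partial>lebn n) \<le> ennreal e"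
proof -
  obtain d where d: "d > 0" "\<And>z. (\<forall>i<n. \<bar>z i\<bar> < d) \<Longrightarrow> (\<integral>\<^sup>+x. ennreal \<bar>W (vsub n x z) - W x\<bar> \<partial>lebn n) \<le> ennreal e"
    using integrable_translation_cont[OF W] e unfolding translation_cont_def by meson
  show ?thesis
  proof (rule that[OF d(1)])
    fix s k assume "mollifier n s k" "s < d"
    then show "(\<integral>\<^sup>+x. ennreal \<bar>conv n k W x - W x\<bar> \<partial>lebn n) \<le> ennreal e"
      using W e by (intro conv_L1[of n s k W e] d(2)) (auto intro: le_less_trans)
  qed
qed

section \<open>A mollifier\<close>

text \<open>The classical flat function \<open>exp (- 1 / t)\<close>, with a polynomial factor so
  that the family is stable under differentiation: for \<open>y = 1 / t\<close> the chain rule gives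
  the factor \<open>- y^2\<close>, which sends \<open>p\<close> to
  \<open>y^2 (p - p')\<close>.\<close>

definition flat :: "real poly \<Rightarrow> real \<Rightarrow> real" where
  "flat p t = (if t > 0 then poly p (1 / t) * exp (- (1 / t)) else 0)"

lemma poly_times_exp_minus_tendsto_0:
  fixes q :: "real poly"
  shows "((\<lambda>x. poly q x * exp (- x)) \<longlongrightarrow> 0) at_top"
proof -
  have "((\<lambda>x. \<Sum>i\<le>degree q. coeff q i * (x ^ i / exp x)) \<longlongrightarrow> (\<Sum>i\<le>degree q. coeff q i * 0)) at_top"
    by (intro tendsto_intros tendsto_power_div_exp_0)
  moreover have "(\<Sum>i\<le>degree q. coeff q i * (x ^ i / exp x)) = poly q x * exp (- x)" for x
    by (simp add: poly_altdef sum_distrib_right exp_minus divide_inverse mult.assoc)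
  ultimately show ?thesis by simp
qed

lemma flat_DERIV: "(flat p has_real_derivative flat ([:0, 0, 1:] * (p - pderiv p)) t) (at t)"
proof -
  consider "t > 0" | "t < 0" | "t = 0" by linarith
  then show ?thesis
  proof cases
    case 1
    have "((\<lambda>t. poly p (1 / t) * exp (- (1 / t))) has_real_derivative
        flat ([:0, 0, 1:] * (p - pderiv p)) t) (at t)"
      using 1 by (auto intro!: derivative_eq_intros DERIV_chain2[OF poly_DERIV]
          simp: flat_def power2_eq_square field_simps)
    moreover have "eventually (\<lambda>t. flat p t = poly p (1 / t) * exp (- (1 / t))) (nhds t)"
      using eventually_gt_at_top 1 by (auto simp: flat_def eventually_nhds intro!: exI[of _ "{0<..}"])
    ultimately show ?thesis by (subst DERIV_cong_ev[OF refl]) auto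
  next
    case 2
    have "eventually (\<lambda>t. flat p t = 0) (nhds t)"
      using 2 by (auto simp: flat_def eventually_nhds intro!: exI[of _ "{..<0}"])
    then show ?thesis using 2 by (subst DERIV_cong_ev[OF refl]) (auto simp: flat_def)
  next
    case 3
    have "((\<lambda>h. (flat p h - flat p 0) / (h - 0)) \<longlongrightarrow> 0) (at 0)"
    proof (rule filterlim_split_at)
      show "((\<lambda>h. (flat p h - flat p 0) / (h - 0)) \<longlongrightarrow> 0) (at_left 0)"
        by (intro tendsto_eventually eventually_at_leftI[of "-1"]) (auto simp: flat_def)
      \<comment> \<open>For \<open>y = 1 / h\<close> the difference quotient at 0 is
        \<open>y p(y) exp (- y)\<close>, and \<open>pCons 0 p\<close> is the polynomial
        \<open>y p(y)\<close>.\<close>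
      have "((\<lambda>h. poly (pCons 0 p) (inverse h) * exp (- inverse h)) \<longlongrightarrow> 0) (at_right (0::real))"
        by (rule filterlim_compose[OF poly_times_exp_minus_tendsto_0 filterlim_inverse_at_top_right])
      moreover have "eventually (\<lambda>h. poly (pCons 0 p) (inverse h) * exp (- inverse h) = (flat p h - flat p 0) / (h - 0)) (at_right 0)"
        by (intro eventually_at_rightI[of _ 1]) (auto simp: flat_def field_simps)
      ultimately show "((\<lambda>h. (flat p h - flat p 0) / (h - 0)) \<longlongrightarrow> 0) (at_right 0)"
        by (rule Lim_transform_eventually)
    qed
    then show ?thesis using 3 by (simp add: has_field_derivative_iff flat_def)
  qed
qed

lemma flat_continuous: "continuous_on UNIV (flat p)"
  by (rule DERIV_continuous_on[OF has_field_derivative_at_within[OF flat_DERIV]])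

lemma has_partial_coord:
  "(g has_real_derivative D) (at (x i)) \<Longrightarrow> has_partial i (\<lambda>x. g (x i)) D x"
  by (simp add: has_partial_def)

lemma has_partial_other: "j \<noteq> i \<Longrightarrow> has_partial j (\<lambda>x. g (x i)) 0 x"
  by (simp add: has_partial_def)

lemma cont_coord:
  assumes "continuous_on UNIV g" "i < n"
  shows "cont_on_Rn n (Rn n) (\<lambda>x. g (x i))"
proof -
  have "cont_on_Rn n (Rn n) (\<lambda>x. x i)"
    using assms(2) by (intro continuous_map_from_subtopology continuous_map_product_projection) auto
  then show ?thesis
    using continuous_map_compose[of _ euclideanreal "\<lambda>x. x i" euclideanreal g] assms(1)
    by (simp add: o_def)
qed

lemma C_inf_flat:
  assumes i: "i < n"
  shows "(\<lambda>x. c * flat p (a * x i + b)) \<in> C_inf n (Rn n)"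
\<comment> \<open>Differentiation changes the polynomial and multiplies \<open>c\<close> by the
  inner slope \<open>a\<close>; derivatives in the other directions are the member with
  \<open>c = 0\<close>.\<close>
proof (rule C_inf_coinduct[where S = "\<lambda>v. \<exists>c p. v = (\<lambda>x. c * flat p (a * x i + b))"])
  fix w assume "\<exists>c p. w = (\<lambda>x. c * flat p (a * x i + b))"
  then obtain c p where w: "w = (\<lambda>x. c * flat p (a * x i + b))" by blast
  have "continuous_on UNIV (\<lambda>t. c * flat p (a * t + b))"
    by (intro continuous_intros continuous_on_compose2[OF flat_continuous]) auto
  then show "cont_on_Rn n (Rn n) w" using cont_coord[OF _ i] w by simp
  fix j assume "j < n"
  let ?q = "[:0, 0, 1:] * (p - pderiv p)"
  have D: "((\<lambda>t. c * flat p (a * t + b)) has_real_derivative (c * a) * flat ?q (a * t + b)) (at t)" for t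
  proof -
    have "((\<lambda>t. a * t + b) has_real_derivative a) (at t)" by (auto intro!: derivative_eq_intros)
    from DERIV_cmult[OF DERIV_chain2[OF flat_DERIV this]] show ?thesis
      by (rule DERIV_cong) (simp add: mult_ac)
  qed
  show "\<exists>w'. (\<exists>c p. w' = (\<lambda>x. c * flat p (a * x i + b))) \<and> (\<forall>x\<in>Rn n. has_partial j w (w' x) x)"
  proof (cases "j = i")
    case True
    then show ?thesis unfolding w
      using has_partial_coord[OF D]
      by (intro exI[of _ "\<lambda>x. (c * a) * flat ?q (a * x i + b)"] conjI exI[of _ "c * a"] exI[of _ ?q] ballI) (rule refl, simp only: True)
  next
    case False
    then show ?thesis unfolding w
      using has_partial_other[OF False]
      by (intro exI[of _ "\<lambda>x. 0 * flat p (a * x i + b)"] conjI exI[of _ 0] exI[of _ p] ballI) (rule refl, simp)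
  qed
qed (use openin_Rn_UNIV in auto)

lemma C_inf_coord:
  assumes i: "i < n"
  shows "(\<lambda>x. c * x i) \<in> C_inf n (Rn n)"
proof (rule C_inf_coinduct[where S = "\<lambda>v. \<exists>c d. v = (\<lambda>x. c * x i + d)"])
  show "\<exists>c' d. (\<lambda>x. c * x i) = (\<lambda>x. c' * x i + d)" by (intro exI[of _ c] exI[of _ 0]) auto
  fix w assume "\<exists>c d. w = (\<lambda>x::nat\<Rightarrow>real. c * x i + d)"
  then obtain c d where w: "w = (\<lambda>x. c * x i + d)" by blast
  have "continuous_on UNIV (\<lambda>t. c * t + d)" by (intro continuous_intros)
  then show "cont_on_Rn n (Rn n) w" using cont_coord[OF _ i] w by simp
  fix j assume "j < n"
  have D: "((\<lambda>t. c * t + d) has_real_derivative 0 * t + c) (at t)" for t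
    by (auto intro!: derivative_eq_intros)
  show "\<exists>w'. (\<exists>c d. w' = (\<lambda>x. c * x i + d)) \<and> (\<forall>x\<in>Rn n. has_partial j w (w' x) x)"
  proof (cases "j = i")
    case True
    then show ?thesis unfolding w
      by (intro exI[of _ "\<lambda>x. 0 * x i + c"] conjI exI[of _ 0] exI[of _ c]) (auto intro!: has_partial_coord D[simplified])
  next
    case False
    then show ?thesis unfolding w
      by (intro exI[of _ "\<lambda>x. 0 * x i + 0"] conjI exI[of _ 0]) (auto intro!: has_partial_other)
  qed
qed (use openin_Rn_UNIV in auto)

section \<open>The product bump, its rescaling and its derivative in the scale\<close>

definition bump0 :: "real \<Rightarrow> real" where
  "bump0 t = flat 1 (1 + t) * flat 1 (1 - t)"

lemma bump0_nonneg: "0 \<le> bump0 t" and bump0_le_1: "bump0 t \<le> 1"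
proof -
  have f: "0 \<le> flat 1 t" "flat 1 t \<le> 1" for t by (auto simp: flat_def)
  show "0 \<le> bump0 t" unfolding bump0_def using f by simp
  show "bump0 t \<le> 1" unfolding bump0_def using f by (simp add: mult_le_one)
qed

lemma bump0_pos: "\<bar>t\<bar> < 1 \<Longrightarrow> 0 < bump0 t" and bump0_zero: "1 \<le> \<bar>t\<bar> \<Longrightarrow> bump0 t = 0"
  by (auto simp: bump0_def flat_def)

definition bump0' :: "real \<Rightarrow> real" where
  "bump0' t = flat ([:0, 0, 1:] * (1 - pderiv 1)) (1 + t) * flat 1 (1 - t)
     - flat 1 (1 + t) * flat ([:0, 0, 1:] * (1 - pderiv 1)) (1 - t)"

lemma bump0_DERIV: "(bump0 has_real_derivative bump0' t) (at t)"
proof -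
  let ?f = "flat ([:0, 0, 1:] * (1 - pderiv 1))"
  have 1: "((\<lambda>t. flat 1 (1 + t)) has_real_derivative ?f (1 + t) * 1) (at t)"
    by (rule DERIV_chain2[OF flat_DERIV]) (auto intro!: derivative_eq_intros)
  have 2: "((\<lambda>t. flat 1 (1 - t)) has_real_derivative ?f (1 - t) * (-1)) (at t)"
    by (rule DERIV_chain2[OF flat_DERIV]) (auto intro!: derivative_eq_intros)
  have "((\<lambda>t. flat 1 (1 + t) * flat 1 (1 - t)) has_real_derivative bump0' t) (at t)"
    by (rule DERIV_cong[OF DERIV_mult[OF 1 2]]) (simp add: bump0'_def)
  moreover have "bump0 = (\<lambda>t. flat 1 (1 + t) * flat 1 (1 - t))" by (simp add: fun_eq_iff bump0_def)
  ultimately show ?thesis by simp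
qed

text \<open>This is the derivative of \<open>t * bump0 t\<close>, the profile of the derivative of
  the rescaled bump with respect to its scale.\<close>

lemma bump0'_bounded: "\<exists>H. \<forall>t. \<bar>bump0 t + t * bump0' t\<bar> \<le> H"
proof -
  have c: "continuous_on {-1..1} (\<lambda>t. bump0 t + t * bump0' t)"
    unfolding bump0_def bump0'_def
    by (intro continuous_intros continuous_on_compose2[OF flat_continuous]) auto
  have "bounded ((\<lambda>t. bump0 t + t * bump0' t) ` {-1..1})"
    by (intro compact_imp_bounded compact_continuous_image c) auto
  then obtain H where H: "\<forall>t\<in>{-1..1}. \<bar>bump0 t + t * bump0' t\<bar> \<le> H" by (auto simp: bounded_iff)
  have "\<bar>bump0 t + t * bump0' t\<bar> \<le> \<bar>H\<bar>" for t
  proof (cases "t \<in> {-1..1}")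
    case True then show ?thesis using order_trans[OF bspec[OF H] abs_ge_self] by blast
  next
    case False
    then have "\<not> 0 < 1 + t \<or> \<not> 0 < 1 - t" by auto
    then have "bump0 t + t * bump0' t = 0" by (auto simp: bump0_def bump0'_def flat_def)
    then show ?thesis by simp
  qed
  then show ?thesis by blast
qed

lemma bump0_borel [measurable]: "bump0 \<in> borel_measurable borel"
  by (rule borel_measurable_continuous_onI[OF DERIV_continuous_on[OF has_field_derivative_at_within[OF bump0_DERIV]]])

lemma bump0_integrable: "integrable lborel bump0"
proof (rule Bochner_Integration.integrable_bound[of _ "indicat_real {-1..1}"])
  show "AE t in lborel. norm (bump0 t) \<le> norm (indicat_real {-1..1} t)"
  proof (rule AE_I2)
    fix t
    show "norm (bump0 t) \<le> norm (indicat_real {-1..1} t)"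
      using bump0_nonneg[of t] bump0_le_1[of t] bump0_zero[of t]
      by (cases "\<bar>t\<bar> \<le> 1") (auto simp: indicator_def abs_le_iff)
  qed
qed auto

definition bump_mass :: real where "bump_mass = (\<integral>t. bump0 t \<partial>lborel)"

lemma bump_mass_pos: "bump_mass > 0"
proof -
  have "bump_mass \<noteq> 0"
  proof
    assume "bump_mass = 0"
    then have "AE t in lborel. bump0 t = 0"
      using integral_nonneg_eq_0_iff_AE[OF bump0_integrable] bump0_nonneg by (auto simp: bump_mass_def)
    then have "AE t in lborel. t \<notin> {-1<..<1::real}"
    proof eventually_elim
      case (elim t)
      then show ?case using bump0_pos[of t] by (cases "\<bar>t\<bar> < 1") (auto simp: abs_less_iff)
    qed
    then have "emeasure lborel {-1<..<1::real} = 0"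
      by (subst (asm) AE_iff_measurable[where N = "{-1<..<1}"]) auto
    then show False by simp
  qed
  moreover have "bump_mass \<ge> 0" unfolding bump_mass_def using bump0_nonneg by simp
  ultimately show ?thesis by simp
qed

definition bump :: "real \<Rightarrow> real \<Rightarrow> real" where
  "bump s t = bump0 (t / s) / (bump_mass * s)"

text \<open>Minus the derivative of \<open>bump s t\<close> in the scale \<open>s\<close> and at the
  same time the derivative of \<open>t / s * bump s t\<close> in \<open>t\<close>. The coincidence
  of the two, which comes from the mass-preserving scaling, is what drives Morrey's
  estimate.\<close>

definition bump_dil :: "real \<Rightarrow> real \<Rightarrow> real" where
  "bump_dil s t = (bump0 (t / s) + t / s * bump0' (t / s)) / (bump_mass * s\<^sup>2)"

lemma bump_integrable: "s > 0 \<Longrightarrow> integrable lborel (bump s)"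
  and bump_integral: "s > 0 \<Longrightarrow> (\<integral>t. bump s t \<partial>lborel) = 1"
proof -
  assume s: "s > 0"
  have 1: "integrable lborel (\<lambda>t. bump0 (0 + (1 / s) * t))"
    using s bump0_integrable by (intro lborel_integrable_real_affine) auto
  then show "integrable lborel (bump s)" unfolding bump_def by simp
  have "bump_mass = \<bar>1 / s\<bar> *\<^sub>R (\<integral>t. bump0 (0 + (1 / s) * t) \<partial>lborel)"
    unfolding bump_mass_def using s by (intro lborel_integral_real_affine) auto
  then have "(\<integral>t. bump0 (t / s) \<partial>lborel) = s * bump_mass" using s by (simp add: field_simps)
  then show "(\<integral>t. bump s t \<partial>lborel) = 1" using s bump_mass_pos by (simp add: bump_def)
qed

lemma bump_nonneg: "s > 0 \<Longrightarrow> 0 \<le> bump s t"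
  using bump0_nonneg bump_mass_pos by (simp add: bump_def)

lemma bump_zero: "s > 0 \<Longrightarrow> s \<le> \<bar>t\<bar> \<Longrightarrow> bump s t = 0"
  by (simp add: bump_def bump0_zero)

lemma bump_le: "s > 0 \<Longrightarrow> bump s t \<le> (1 / bump_mass) / s"
  using bump0_le_1[of "t / s"] bump_mass_pos by (simp add: bump_def divide_simps)

lemma bump_DERIV_scale:
  assumes s: "s > 0" shows "((\<lambda>s. bump s t) has_real_derivative - bump_dil s t) (at s)"
proof -
  have "((\<lambda>s. bump0 (t / s)) has_real_derivative bump0' (t / s) * (- t / s\<^sup>2)) (at s)"
    by (rule DERIV_chain2[OF bump0_DERIV])
      (use s in \<open>auto intro!: derivative_eq_intros simp: power2_eq_square\<close>)
  then have "((\<lambda>s. bump0 (t / s) / (bump_mass * s)) has_real_derivative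
     (bump0' (t / s) * (- t / s\<^sup>2) * (bump_mass * s) - bump0 (t / s) * bump_mass) / (bump_mass * s * (bump_mass * s))) (at s)"
    using s bump_mass_pos by (auto intro!: derivative_eq_intros)
  moreover have "(bump0' (t / s) * (- t / s\<^sup>2) * (bump_mass * s) - bump0 (t / s) * bump_mass) / (bump_mass * s * (bump_mass * s)) = - bump_dil s t"
    using s bump_mass_pos by (simp add: bump_dil_def power2_eq_square divide_simps) (simp add: algebra_simps)
  ultimately show ?thesis by (simp add: bump_def)
qed

lemma bump_DERIV_coord:
  assumes s: "s > 0" shows "((\<lambda>t. t / s * bump s t) has_real_derivative bump_dil s t) (at t)"
proof -
  have "((\<lambda>t. bump0 (t / s)) has_real_derivative bump0' (t / s) * (1 / s)) (at t)"
    by (rule DERIV_chain2[OF bump0_DERIV]) (use s in \<open>auto intro!: derivative_eq_intros\<close>)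
  then have "((\<lambda>t. t / s * (bump0 (t / s) / (bump_mass * s))) has_real_derivative
     1 / s * (bump0 (t / s) / (bump_mass * s)) + bump0' (t / s) * (1 / s) / (bump_mass * s) * (t / s)) (at t)"
    by (intro DERIV_mult DERIV_cdivide DERIV_ident)
  moreover have "1 / s * (bump0 (t / s) / (bump_mass * s)) + bump0' (t / s) * (1 / s) / (bump_mass * s) * (t / s) = bump_dil s t"
    using s bump_mass_pos by (simp add: bump_dil_def power2_eq_square divide_simps)
  ultimately show ?thesis by (simp add: bump_def)
qed

lemma bump_dil_bounded: "\<exists>H\<ge>0. \<forall>s>0. \<forall>t. \<bar>bump_dil s t\<bar> \<le> H / s\<^sup>2"
proof -
  obtain H where H: "\<And>t. \<bar>bump0 t + t * bump0' t\<bar> \<le> H" using bump0'_bounded by blast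
  have H0: "H \<ge> 0" using H[of 0] by linarith
  have "\<bar>bump_dil s t\<bar> \<le> (H / bump_mass) / s\<^sup>2" if "s > 0" for s t
    using that bump_mass_pos H[of "t / s"]
    by (simp add: bump_dil_def abs_mult divide_right_mono)
  then show ?thesis using H0 bump_mass_pos by (intro exI[of _ "H / bump_mass"]) auto
qed

definition eta :: "nat \<Rightarrow> real \<Rightarrow> (nat \<Rightarrow> real) \<Rightarrow> real" where
  "eta n s x = (\<Prod>i<n. bump s (x i))"

text \<open>The components of the vector field \<open>x / s * eta\<close>, whose divergence is minus
  the scale derivative of \<open>eta\<close>.\<close>

definition psi :: "nat \<Rightarrow> real \<Rightarrow> nat \<Rightarrow> (nat \<Rightarrow> real) \<Rightarrow> real" where
  "psi n s i x = x i / s * eta n s x"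

lemma eta_C_inf: "eta n s \<in> C_inf n (Rn n)"
proof -
  have "(\<lambda>x. bump s (x i)) \<in> C_inf n (Rn n)" if i: "i < n" for i
  proof -
    have "(\<lambda>x. 1 / (bump_mass * s) * flat 1 ((1 / s) * x i + 1) * (1 * flat 1 ((- (1 / s)) * x i + 1))) \<in> C_inf n (Rn n)"
      using i by (intro C_inf_mult C_inf_flat openin_Rn_UNIV)
    then show ?thesis by (simp add: bump_def bump0_def add.commute)
  qed
  then have "(\<lambda>x. \<Prod>i<n. bump s (x i)) \<in> C_inf n (Rn n)"
    by (intro C_inf_prod openin_Rn_UNIV) auto
  then show ?thesis by (simp add: eta_def[abs_def])
qed

lemma psi_C_inf: "i < n \<Longrightarrow> psi n s i \<in> C_inf n (Rn n)"
  using C_inf_mult[OF openin_Rn_UNIV C_inf_coord[of i n "1 / s"] eta_C_inf[of n s]]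
  by (simp add: psi_def[abs_def])

lemma eta_zero: "s > 0 \<Longrightarrow> i < n \<Longrightarrow> s \<le> \<bar>x i\<bar> \<Longrightarrow> eta n s x = 0"
  unfolding eta_def by (rule prod_zero) (auto intro!: bexI[of _ i] simp: bump_zero)

lemma eta_nonneg: "s > 0 \<Longrightarrow> 0 \<le> eta n s x"
  unfolding eta_def by (intro prod_nonneg) (auto simp: bump_nonneg)

lemma mollifier_eta:
  assumes s: "s > 0" shows "mollifier n s (eta n s)"
  unfolding mollifier_def kernel_def
proof (intro conjI ballI impI)
  show "integrable (lebn n) (eta n s)" unfolding eta_def
    using s bump_integrable by (intro lebn.product_integrable_prod) auto
  show "(\<integral>x. eta n s x \<partial>lebn n) = 1" unfolding eta_def
    using s bump_integrable bump_integral by (subst lebn.product_integral_prod) auto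
  fix x assume "\<exists>i<n. s < \<bar>x i\<bar>"
  then obtain j where "j < n" "s \<le> \<bar>x j\<bar>" by (auto intro: less_imp_le)
  then show "eta n s x = 0" by (rule eta_zero[OF s])
qed (rule eta_C_inf eta_nonneg[OF s])+

lemma kernel_psi:
  assumes s: "s > 0" and i: "i < n" shows "kernel n s (psi n s i)"
  unfolding kernel_def
proof (intro conjI ballI impI)
  fix x assume "\<exists>i<n. s < \<bar>x i\<bar>"
  then obtain j where "j < n" "s \<le> \<bar>x j\<bar>" by (auto intro: less_imp_le)
  then show "psi n s i x = 0" by (simp add: psi_def eta_zero[OF s])
qed (rule psi_C_inf[OF i])

text \<open>On the support of \<open>eta\<close> each coordinate is at most \<open>s\<close> in
  absolute value, so the weight costs nothing.\<close>

lemma psi_abs_le: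
  assumes s: "s > 0" and i: "i < n" shows "\<bar>psi n s i x\<bar> \<le> eta n s x"
proof (cases "\<bar>x i\<bar> < s")
  case True
  then have "\<bar>x i / s\<bar> * eta n s x \<le> 1 * eta n s x"
    using s eta_nonneg[OF s] by (intro mult_right_mono) auto
  then show ?thesis using eta_nonneg[OF s] by (simp add: psi_def abs_mult)
next
  case False
  then show ?thesis using eta_zero[OF s i] by (simp add: psi_def)
qed

lemma eta_le: "s > 0 \<Longrightarrow> eta n s x \<le> ((1 / bump_mass) / s) ^ n"
proof -
  assume s: "s > 0"
  have "eta n s x \<le> (\<Prod>i<n. (1 / bump_mass) / s)"
    unfolding eta_def using bump_nonneg[OF s] bump_le[OF s] by (intro prod_mono) auto
  then show ?thesis by simp
qed

lemma partial_psi: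
  assumes s: "s > 0" and i: "i < n"
  shows "partial i (psi n s i) x = bump_dil s (x i) * (\<Prod>j\<in>{..<n} - {i}. bump s (x j))"
proof (rule has_partial_imp_partial)
  have "has_partial i (\<lambda>x. (x i / s * bump s (x i)) * (\<Prod>j\<in>{..<n} - {i}. bump s (x j)))
     (bump_dil s (x i) * (\<Prod>j\<in>{..<n} - {i}. bump s (x j)) + x i / s * bump s (x i) * 0) x"
  proof (rule has_partial_mult)
    show "has_partial i (\<lambda>x. x i / s * bump s (x i)) (bump_dil s (x i)) x"
      by (rule has_partial_coord[OF bump_DERIV_coord[OF s]])
    show "has_partial i (\<lambda>x. \<Prod>j\<in>{..<n} - {i}. bump s (x j)) 0 x"
      unfolding has_partial_def
      by (subst prod.cong[OF refl, where h = "\<lambda>j. bump s (x j)"]) auto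
  qed
  moreover have "psi n s i = (\<lambda>x. (x i / s * bump s (x i)) * (\<Prod>j\<in>{..<n} - {i}. bump s (x j)))"
    using i by (intro ext) (simp add: psi_def eta_def prod.remove[of "{..<n}" i])
  ultimately show "has_partial i (psi n s i) (bump_dil s (x i) * (\<Prod>j\<in>{..<n} - {i}. bump s (x j))) x"
    by simp
qed

text \<open>The product rule in \<open>s\<close> differentiates one factor at a time, and each such
  term is the derivative of \<open>psi n s i\<close> in its own direction.\<close>

lemma eta_DERIV_scale:
  assumes s: "s > 0"
  shows "((\<lambda>s. eta n s x) has_real_derivative - (\<Sum>i<n. partial i (psi n s i) x)) (at s)"
proof -
  have "((\<lambda>s. \<Prod>i<n. bump s (x i)) has_real_derivative
      (\<Sum>i<n. (- bump_dil s (x i)) * (\<Prod>j\<in>{..<n} - {i}. bump s (x j)))) (at s)"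
    by (rule has_field_derivative_prod) (rule bump_DERIV_scale[OF s])
  moreover have "(\<Sum>i<n. (- bump_dil s (x i)) * (\<Prod>j\<in>{..<n} - {i}. bump s (x j))) = - (\<Sum>i<n. partial i (psi n s i) x)"
    by (simp add: partial_psi[OF s] sum_negf)
  ultimately show ?thesis by (simp add: eta_def)
qed

text \<open>Uniformity over all scales above \<open>a\<close> provides the dominating function when
  a convolution is differentiated in its scale.\<close>

lemma partial_psi_bounded:
  assumes a: "a > 0"
  shows "\<exists>C. \<forall>s>a. \<forall>i<n. \<forall>x. \<bar>partial i (psi n s i) x\<bar> \<le> C"
proof -
  obtain H where H: "H \<ge> 0" "\<And>s t. s > 0 \<Longrightarrow> \<bar>bump_dil s t\<bar> \<le> H / s\<^sup>2" using bump_dil_bounded by blast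
  have "\<bar>partial i (psi n s i) x\<bar> \<le> H / a\<^sup>2 * ((1 / bump_mass) / a) ^ (n - 1)" if s: "s > a" and i: "i < n" for s i x
  proof -
    have s0: "s > 0" using s a by simp
    have "\<bar>bump_dil s (x i)\<bar> \<le> H / s\<^sup>2" by (rule H(2)[OF s0])
    also have "\<dots> \<le> H / a\<^sup>2" using H(1) s a by (intro divide_left_mono power_mono) auto
    finally have 1: "\<bar>bump_dil s (x i)\<bar> \<le> H / a\<^sup>2" .
    have "(\<Prod>j\<in>{..<n} - {i}. bump s (x j)) \<le> (\<Prod>j\<in>{..<n} - {i}. (1 / bump_mass) / a)"
    proof (rule prod_mono, intro conjI)
      fix j
      show "0 \<le> bump s (x j)" by (rule bump_nonneg[OF s0])
      have "bump s (x j) \<le> (1 / bump_mass) / s" by (rule bump_le[OF s0])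
      also have "\<dots> \<le> (1 / bump_mass) / a" using bump_mass_pos s a by (intro divide_left_mono) auto
      finally show "bump s (x j) \<le> (1 / bump_mass) / a" .
    qed
    then have 2: "(\<Prod>j\<in>{..<n} - {i}. bump s (x j)) \<le> ((1 / bump_mass) / a) ^ (n - 1)" using i by simp
    have 3: "0 \<le> (\<Prod>j\<in>{..<n} - {i}. bump s (x j))" using bump_nonneg[OF s0] by (intro prod_nonneg) auto
    have "\<bar>partial i (psi n s i) x\<bar> = \<bar>bump_dil s (x i)\<bar> * (\<Prod>j\<in>{..<n} - {i}. bump s (x j))"
      using partial_psi[OF s0 i, of x] 3 by (simp add: abs_mult)
    then show ?thesis using mult_mono[OF 1 2 _ 3] H(1) by simp
  qed
  then show ?thesis by blast
qed

section \<open>Weak derivatives and Morrey's estimate\<close>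

definition core :: "nat \<Rightarrow> (nat \<Rightarrow> real) set \<Rightarrow> real \<Rightarrow> real \<Rightarrow> (nat \<Rightarrow> real) set" where
  "core n \<Omega> r R = {x \<in> Rn n. (\<forall>i<n. \<bar>x i\<bar> \<le> R) \<and> cube n x r \<subseteq> \<Omega>}"

lemma core_subset: "r > 0 \<Longrightarrow> core n \<Omega> r R \<subseteq> \<Omega>"
  using cube_self unfolding core_def by blast

lemma core_mono: "r' \<le> r \<Longrightarrow> R \<le> R' \<Longrightarrow> core n \<Omega> r R \<subseteq> core n \<Omega> r' R'"
proof
  fix x assume r: "r' \<le> r" and R: "R \<le> R'" and x: "x \<in> core n \<Omega> r R"
  have "\<bar>x i\<bar> \<le> R'" if "i < n" for i using x that R unfolding core_def by force
  then show "x \<in> core n \<Omega> r' R'" using x cube_mono[OF r, of n x] unfolding core_def by blast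
qed

lemma ccube_mono: "s \<le> t \<Longrightarrow> ccube n x s \<subseteq> ccube n x t"
proof
  fix y assume "s \<le> t" "y \<in> ccube n x s"
  then show "y \<in> ccube n x t" unfolding mem_ccube by force
qed

text \<open>Both conditions are closed because the cube is open: a point \<open>z\<close> of the
  cube outside \<open>\<Omega>\<close> stays in the cube when the centre moves by less than the
  slack of \<open>z\<close>.\<close>

lemma compactin_core: "compactin (Rn_top n) (core n \<Omega> r R)"
proof (rule compactin_RnI[where R = R])
  fix x assume x: "x \<in> Rn n" "x \<notin> core n \<Omega> r R"
  consider i where "i < n" "R < \<bar>x i\<bar>" | z where "z \<in> cube n x r" "z \<notin> \<Omega>"
    using x unfolding core_def by (auto simp: not_le)
  then show "\<exists>d>0. cube n x d \<inter> core n \<Omega> r R = {}"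
  proof cases
    case 1
    have "y \<notin> core n \<Omega> r R" if y: "y \<in> cube n x (\<bar>x i\<bar> - R)" for y
    proof -
      have "\<bar>y i - x i\<bar> < \<bar>x i\<bar> - R" using y 1(1) by (simp add: mem_cube)
      then have "\<not> \<bar>y i\<bar> \<le> R" by linarith
      then show ?thesis using 1(1) unfolding core_def by blast
    qed
    then show ?thesis using 1(2) by (intro exI[of _ "\<bar>x i\<bar> - R"]) auto
  next
    case 2
    define d where "d = Min (insert 1 ((\<lambda>i. r - \<bar>z i - x i\<bar>) ` {..<n}))"
    have d: "d > 0" "\<And>i. i < n \<Longrightarrow> d \<le> r - \<bar>z i - x i\<bar>"
      using 2(1) by (auto simp: d_def mem_cube)
    have "y \<notin> core n \<Omega> r R" if y: "y \<in> cube n x d" for y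
    proof -
      have "\<bar>z i - y i\<bar> < r" if "i < n" for i
      proof -
        have "\<bar>y i - x i\<bar> < d" using y that by (simp add: mem_cube)
        then show ?thesis using d(2)[OF that] by linarith
      qed
      then have "z \<in> cube n y r" using 2(1) by (simp add: mem_cube)
      then show ?thesis using 2(2) unfolding core_def by blast
    qed
    then show ?thesis using d(1) by blast
  qed
qed (auto simp: core_def)

text \<open>A displacement by \<open>s\<close> costs \<open>s\<close> in each parameter; all support
  margins below are counted with this rule.\<close>

lemma ccube_core:
  assumes x: "x \<in> core n \<Omega> r R" and y: "y \<in> ccube n x s" shows "y \<in> core n \<Omega> (r - s) (R + s)"
proof -
  have "\<bar>y i\<bar> \<le> R + s" if "i < n" for i
  proof -
    have "\<bar>x i\<bar> \<le> R" "\<bar>y i - x i\<bar> \<le> s" using x y that by (auto simp: core_def mem_ccube)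
    then show ?thesis by linarith
  qed
  moreover have "cube n y (r - s) \<subseteq> cube n x r"
  proof
    fix z assume z: "z \<in> cube n y (r - s)"
    have "\<bar>z i - x i\<bar> < r" if "i < n" for i
    proof -
      have "\<bar>z i - y i\<bar> < r - s" "\<bar>y i - x i\<bar> \<le> s" using z y that by (auto simp: mem_cube mem_ccube)
      then show ?thesis by linarith
    qed
    then show "z \<in> cube n x r" using z by (simp add: mem_cube)
  qed
  ultimately show ?thesis using x y unfolding core_def mem_ccube by blast
qed

lemma core_exhaust:
  assumes "openin (Rn_top n) \<Omega>" "x \<in> \<Omega>"
  obtains r R where "r > 0" "cube n x r \<subseteq> core n \<Omega> r R"
proof -
  obtain d where d: "d > 0" "cube n x d \<subseteq> \<Omega>" using assms by (auto simp: openin_Rn_iff)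
  define R where "R = (\<Sum>i<n. \<bar>x i\<bar>) + d"
  have "cube n x (d/2) \<subseteq> core n \<Omega> (d/2) R"
  proof
    fix y assume y: "y \<in> cube n x (d/2)"
    have "\<bar>y i\<bar> \<le> R" if "i < n" for i
    proof -
      have "\<bar>x i\<bar> \<le> (\<Sum>i<n. \<bar>x i\<bar>)" using that by (intro member_le_sum) auto
      moreover have "\<bar>y i - x i\<bar> < d / 2" using y that by (simp add: mem_cube)
      ultimately show ?thesis using d(1) unfolding R_def by linarith
    qed
    moreover have "cube n y (d/2) \<subseteq> \<Omega>" using cube_trans[OF y, of _ "d/2"] d(2) by auto
    ultimately show "y \<in> core n \<Omega> (d/2) R" using y unfolding core_def mem_cube by blast
  qed
  then show ?thesis using that[of "d/2" R] d(1) by auto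
qed

section \<open>Weak derivatives tested against kernels\<close>

abbreviation cut :: "(nat \<Rightarrow> real) set \<Rightarrow> ((nat \<Rightarrow> real) \<Rightarrow> real) \<Rightarrow> (nat \<Rightarrow> real) \<Rightarrow> real" where
  "cut K U \<equiv> (\<lambda>x. indicator K x * U x)"

text \<open>The integral identity of \<open>has_weak_deriv\<close> for Borel representatives: the
  domain appears in the integrand and not in the measure, so that all integrals are over
  \<open>lebn n\<close>, where convolution and Tonelli's theorem are available.
  \<open>loc_int\<close> is the matching form of \<open>L1_loc\<close>.\<close>

definition weak_partial ::
  "nat \<Rightarrow> (nat \<Rightarrow> real) set \<Rightarrow> nat \<Rightarrow> ((nat \<Rightarrow> real) \<Rightarrow> real) \<Rightarrow> ((nat \<Rightarrow> real) \<Rightarrow> real) \<Rightarrow> bool" where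
  "weak_partial n \<Omega> i U G \<longleftrightarrow> (\<forall>\<psi>\<in>test_fun n \<Omega>.
     (\<integral>x. indicator \<Omega> x * (U x * partial i \<psi> x) \<partial>lebn n) = - (\<integral>x. indicator \<Omega> x * (G x * \<psi> x) \<partial>lebn n))"

definition loc_int :: "nat \<Rightarrow> (nat \<Rightarrow> real) set \<Rightarrow> ((nat \<Rightarrow> real) \<Rightarrow> real) \<Rightarrow> bool" where
  "loc_int n \<Omega> U \<longleftrightarrow> U \<in> borel_measurable (lebn n) \<and>
     (\<forall>K. compactin (Rn_top n) K \<and> K \<subseteq> \<Omega> \<longrightarrow> integrable (lebn n) (cut K U))"

lemma loc_intD: "loc_int n \<Omega> U \<Longrightarrow> compactin (Rn_top n) K \<Longrightarrow> K \<subseteq> \<Omega> \<Longrightarrow> integrable (lebn n) (cut K U)"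
  by (simp add: loc_int_def)

lemma kernel_vsub_test_fun:
  assumes k: "kernel n s k" and "ccube n x s \<subseteq> \<Omega>"
  shows "(\<lambda>y. k (vsub n x y)) \<in> test_fun n \<Omega>"
  unfolding test_fun_iff
proof (intro conjI exI)
  show "(\<lambda>y. k (vsub n x y)) \<in> C_inf n (Rn n)" using k by (intro C_inf_vsub_right) (simp add: kernel_def)
  show "compactin (Rn_top n) (ccube n x s)" by (rule compactin_ccube)
  show "\<forall>y\<in>Rn n - ccube n x s. k (vsub n x y) = 0" using kernel_outside[OF k] by blast
qed fact

text \<open>If the kernel centred at \<open>x\<close> is supported in \<open>\<Omega>\<close>, then
  \<open>y \<mapsto> k (x - y)\<close> is a test function; the sign from the reflection cancels the
  sign from the integration by parts.\<close>

lemma conv_weak_partial: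
  assumes w: "weak_partial n \<Omega> i U G" and K: "K \<subseteq> \<Omega>" and k: "kernel n s k"
    and x: "ccube n x s \<subseteq> K" and i: "i < n"
  shows "conv n (partial i k) (cut K U) x = conv n k (cut K G) x"
proof -
  let ?\<psi> = "\<lambda>y. k (vsub n x y)"
  have \<psi>: "?\<psi> \<in> test_fun n \<Omega>" using kernel_vsub_test_fun[OF k] x K by blast
  have pp: "partial i ?\<psi> y = - partial i k (vsub n x y)" for y
    using k i by (intro has_partial_imp_partial has_partial_vsub_right C_inf_has_partial[of k n "Rn n"]) (auto simp: kernel_def)
  have "conv n (partial i k) (cut K U) x = - (\<integral>y. indicator \<Omega> y * (U y * partial i ?\<psi> y) \<partial>lebn n)"
    unfolding conv_def Bochner_Integration.integral_minus[symmetric]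
  proof (rule Bochner_Integration.integral_cong[OF refl])
    fix y assume "y \<in> space (lebn n)"
    then show "partial i k (vsub n x y) * (cut K U) y = - (indicator \<Omega> y * (U y * partial i ?\<psi> y))"
      using kernel_outside[OF kernel_partial[OF k i], of y x] x K
      by (cases "y \<in> ccube n x s") (auto simp: pp subset_iff)
  qed
  also have "\<dots> = (\<integral>y. indicator \<Omega> y * (G y * ?\<psi> y) \<partial>lebn n)"
    using w \<psi> unfolding weak_partial_def by simp
  also have "\<dots> = conv n k (cut K G) x"
    unfolding conv_def
  proof (rule Bochner_Integration.integral_cong[OF refl])
    fix y assume "y \<in> space (lebn n)"
    then show "indicator \<Omega> y * (G y * ?\<psi> y) = k (vsub n x y) * (cut K G) y"
      using kernel_outside[OF k, of y x] x K by (cases "y \<in> ccube n x s") (auto simp: subset_iff)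
  qed
  finally show ?thesis .
qed

text \<open>Mollifications are needed to converge almost everywhere only along some sequence of
  scales, which \<open>L^1\<close> convergence provides. This takes the place of the Lebesgue
  differentiation theorem.\<close>

definition mollify_seq :: "nat \<Rightarrow> ((nat \<Rightarrow> real) \<Rightarrow> real) \<Rightarrow> (nat \<Rightarrow> real) \<Rightarrow> bool" where
  "mollify_seq n W d \<longleftrightarrow> (\<forall>k. d k > 0) \<and> d \<longlonglongrightarrow> 0 \<and>
     (AE x in lebn n. (\<lambda>k. conv n (eta n (d k)) W x) \<longlonglongrightarrow> W x)"

lemma mollify_seqD:
  assumes "mollify_seq n W d"
  shows "d k > 0" "d \<longlonglongrightarrow> 0" "AE x in lebn n. (\<lambda>k. conv n (eta n (d k)) W x) \<longlonglongrightarrow> W x"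
  using assms unfolding mollify_seq_def by blast+

lemma mollify_seq_exists:
  assumes W: "integrable (lebn n) W"
  obtains d where "mollify_seq n W d"
proof -
  have "\<exists>s. 0 < s \<and> s < 1 / real (Suc k) \<and>
     (\<integral>\<^sup>+x. ennreal \<bar>conv n (eta n s) W x - W x\<bar> \<partial>lebn n) \<le> ennreal (1 / real (Suc k))" for k
  proof -
    obtain d where d: "d > 0" "\<And>s k'. mollifier n s k' \<Longrightarrow> s < d \<Longrightarrow> (\<integral>\<^sup>+x. ennreal \<bar>conv n k' W x - W x\<bar> \<partial>lebn n) \<le> ennreal (1 / real (Suc k))"
      by (rule mollify_L1[OF W, of "1 / real (Suc k)"]) (simp, blast)
    define s where "s = min d (1 / real (Suc k)) / 2"
    have "0 < s" "s < d" "s < 1 / real (Suc k)" using d(1) by (auto simp: s_def min_def field_simps)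
    then show ?thesis using d(2)[OF mollifier_eta[of s n]] by blast
  qed
  then obtain s where s: "\<And>k. 0 < s k" "\<And>k. s k < 1 / real (Suc k)"
     "\<And>k. (\<integral>\<^sup>+x. ennreal \<bar>conv n (eta n (s k)) W x - W x\<bar> \<partial>lebn n) \<le> ennreal (1 / real (Suc k))" by metis
  have lim1: "(\<lambda>k. 1 / real (Suc k)) \<longlonglongrightarrow> 0" using LIMSEQ_inverse_real_of_nat by (simp add: inverse_eq_divide)
  have s0: "s \<longlonglongrightarrow> 0"
    by (rule real_tendsto_sandwich[OF _ _ tendsto_const lim1]) (use s in \<open>auto intro!: always_eventually less_imp_le\<close>)
  let ?u = "\<lambda>k x. conv n (eta n (s k)) W x - W x"
  have bm: "?u k \<in> borel_measurable (lebn n)" for k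
    using conv_borel[OF mollifier_test_fun[OF mollifier_eta[OF s(1)]] W, of k] borel_measurable_integrable[OF W]
    by (rule borel_measurable_diff)
  have int: "integrable (lebn n) (?u k)" for k
    using bm s(3)[of k] by (auto simp: integrable_iff_bounded intro: le_less_trans)
  have "(\<integral>x. norm (?u k x) \<partial>lebn n) \<le> 1 / real (Suc k)" for k
  proof -
    have "ennreal (\<integral>x. norm (?u k x) \<partial>lebn n) = (\<integral>\<^sup>+x. ennreal \<bar>?u k x\<bar> \<partial>lebn n)"
      using int[of k] by (subst nn_integral_eq_integral) auto
    also have "\<dots> \<le> ennreal (1 / real (Suc k))" by (rule s(3))
    finally show ?thesis by (subst (asm) ennreal_le_iff) auto
  qed
  then have "(\<lambda>k. \<integral>x. norm (?u k x) \<partial>lebn n) \<longlonglongrightarrow> 0"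
    by (intro real_tendsto_sandwich[OF _ _ tendsto_const lim1]) (auto intro!: always_eventually)
  from tendsto_L1_AE_subseq[OF int this] obtain r where r: "strict_mono r" "AE x in lebn n. (\<lambda>k. ?u (r k) x) \<longlonglongrightarrow> 0" by blast
  show ?thesis
  proof (rule that[of "s \<circ> r"], unfold mollify_seq_def, intro conjI allI)
    show "0 < (s \<circ> r) k" for k using s(1) by simp
    show "(s \<circ> r) \<longlonglongrightarrow> 0" by (rule LIMSEQ_subseq_LIMSEQ[OF s0 r(1)])
    show "AE x in lebn n. (\<lambda>k. conv n (eta n ((s \<circ> r) k)) W x) \<longlonglongrightarrow> W x"
      using r(2) by eventually_elim (simp add: LIM_zero_iff)
  qed
qed

text \<open>The fundamental lemma of the calculus of variations: small mollifications of the
  difference vanish, since their kernels are test functions, and they converge to the difference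
  almost everywhere.\<close>

lemma test_fun_unique:
  assumes \<Omega>: "openin (Rn_top n) \<Omega>" and G: "loc_int n \<Omega> G" and H: "loc_int n \<Omega> H"
    and eq: "\<And>\<psi>. \<psi> \<in> test_fun n \<Omega> \<Longrightarrow>
      (\<integral>x. indicator \<Omega> x * (G x * \<psi> x) \<partial>lebn n) = (\<integral>x. indicator \<Omega> x * (H x * \<psi> x) \<partial>lebn n)"
  shows "AE x in lebn n. x \<in> \<Omega> \<longrightarrow> G x = H x"
proof -
  have loc: "AE x in lebn n. x \<in> core n \<Omega> r R \<longrightarrow> G x = H x" if r: "r > 0" for r R
  proof -
    \<comment> \<open>The margin \<open>r/2\<close> around the smaller core is room for kernels of
      scale below \<open>r/2\<close>.\<close>
    let ?K = "core n \<Omega> (r/2) (R + r/2)"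
    have K: "compactin (Rn_top n) ?K" "?K \<subseteq> \<Omega>" using compactin_core core_subset r by auto
    have iG: "integrable (lebn n) (cut ?K G)" and iH: "integrable (lebn n) (cut ?K H)"
      using loc_intD[OF G K] loc_intD[OF H K] by auto
    then have i: "integrable (lebn n) (\<lambda>x. cut ?K G x - cut ?K H x)" by simp
    obtain d where "mollify_seq n (\<lambda>x. cut ?K G x - cut ?K H x) d" by (rule mollify_seq_exists[OF i])
    note d = mollify_seqD[OF this]
    have ev: "eventually (\<lambda>k. d k < r/2) sequentially" using order_tendstoD(2)[OF d(2), of "r/2"] r by simp
    have z: "conv n (eta n (d k)) (\<lambda>x. cut ?K G x - cut ?K H x) x = 0"
      if x: "x \<in> core n \<Omega> r R" and k: "d k < r / 2" for x k
    proof -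
      have "ccube n x (d k) \<subseteq> ccube n x (r/2)" using k by (intro ccube_mono) auto
      then have sub: "ccube n x (d k) \<subseteq> ?K" using ccube_core[OF x, of _ "r/2"] by (simp add: subset_iff)
      let ?\<psi> = "\<lambda>y. eta n (d k) (vsub n x y)"
      have mk: "mollifier n (d k) (eta n (d k))" by (rule mollifier_eta[OF d(1)])
      have \<psi>: "?\<psi> \<in> test_fun n \<Omega>"
        using sub K(2) by (intro kernel_vsub_test_fun[OF mollifier_kernel[OF mk]]) auto
      have e: "conv n (eta n (d k)) (cut ?K V) x = (\<integral>x. indicator \<Omega> x * (V x * ?\<psi> x) \<partial>lebn n)" for V
        unfolding conv_def
      proof (rule Bochner_Integration.integral_cong[OF refl])
        fix y assume "y \<in> space (lebn n)"
        then show "?\<psi> y * cut ?K V y = indicator \<Omega> y * (V y * ?\<psi> y)"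
          using kernel_outside[OF mollifier_kernel[OF mk], of y x] subsetD[OF sub, of y] subsetD[OF K(2), of y]
          by (cases "y \<in> ccube n x (d k)") auto
      qed
      have "conv n (eta n (d k)) (\<lambda>x. cut ?K G x - cut ?K H x) x
         = conv n (eta n (d k)) (cut ?K G) x - conv n (eta n (d k)) (cut ?K H) x"
        unfolding conv_def right_diff_distrib
        by (rule Bochner_Integration.integral_diff) (rule conv_integrable[OF mollifier_test_fun[OF mk]], fact)+
      then show ?thesis using eq[OF \<psi>] by (simp add: e)
    qed
    show ?thesis using d(3)
    proof eventually_elim
      case (elim x)
      show ?case
      proof
        assume x: "x \<in> core n \<Omega> r R"
        have "(\<lambda>k. conv n (eta n (d k)) (\<lambda>x. cut ?K G x - cut ?K H x) x) \<longlonglongrightarrow> 0"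
          by (rule tendsto_eventually) (rule eventually_mono[OF ev z[OF x]])
        from LIMSEQ_unique[OF elim this] have "cut ?K G x = cut ?K H x" by simp
        moreover have "x \<in> ?K" using core_mono[of "r/2" r R "R + r/2" n \<Omega>] r x by auto
        ultimately show "G x = H x" by simp
      qed
    qed
  qed
  \<comment> \<open>Countably many cores exhaust \<open>\<Omega>\<close>, so the exceptional null
    sets can be united.\<close>
  have "AE x in lebn n. \<forall>j::nat. x \<in> core n \<Omega> (1 / real (Suc j)) (real j) \<longrightarrow> G x = H x"
    unfolding AE_all_countable by (intro allI loc) simp
  then show ?thesis
  proof eventually_elim
    case (elim x)
    show ?case
    proof
      assume x: "x \<in> \<Omega>"
      obtain r R where r: "r > 0" "cube n x r \<subseteq> core n \<Omega> r R" using core_exhaust[OF \<Omega> x] by blast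
      obtain j1 where j1: "real j1 > 1 / r" using reals_Archimedean2 by blast
      obtain j2 where j2: "real j2 > R" using reals_Archimedean2 by blast
      have "x \<in> Rn n" using openin_subset[OF \<Omega>] x by auto
      then have "x \<in> core n \<Omega> r R" using r cube_self by blast
      moreover have "1 / real (Suc (j1 + j2)) \<le> r"
      proof -
        have "1 / r \<le> real (Suc (j1 + j2))" using j1 by simp
        then show ?thesis using r(1) by (simp add: field_simps)
      qed
      ultimately have "x \<in> core n \<Omega> (1 / real (Suc (j1 + j2))) (real (j1 + j2))"
        using core_mono[of "1 / real (Suc (j1 + j2))" r R "real (j1 + j2)" n \<Omega>] j2 by auto
      then show "G x = H x" using elim by blast
    qed
  qed
qed

text \<open>Either \<open>\<bar>g\<bar> \<le> 1 / b\<close>, or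
  \<open>\<bar>g\<bar> * b \<ge> 1\<close> and further powers of it only help. Integrated against a
  kernel, this does the work of Hoelder's inequality.\<close>

lemma abs_le_power_bound:
  fixes g b :: real
  assumes "b > 0" "m \<ge> 1"
  shows "\<bar>g\<bar> \<le> 1 / b + \<bar>g\<bar> ^ m * b ^ (m - 1)"
proof (cases "\<bar>g\<bar> \<le> 1 / b")
  case True
  then show ?thesis using assms by (simp add: add_increasing2)
next
  case False
  then have "1 \<le> \<bar>g\<bar> * b" using assms(1) by (simp add: field_simps)
  then have "1 \<le> (\<bar>g\<bar> * b) ^ (m - 1)" by (rule one_le_power)
  then have "\<bar>g\<bar> * 1 \<le> \<bar>g\<bar> * (\<bar>g\<bar> * b) ^ (m - 1)" by (rule mult_left_mono) simp
  also have "\<dots> = \<bar>g\<bar> ^ m * b ^ (m - 1)"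
    using assms(2) by (cases m) (auto simp: power_mult_distrib)
  finally show ?thesis using assms(1) by (simp add: add_increasing)
qed

text \<open>The term \<open>1 / b\<close> is averaged with total mass 1, and for the power term the
  kernel is bounded by its maximum of order \<open>s^(-n)\<close>. With \<open>b = sqrt s\<close>
  both contributions are of order \<open>s^(-1/2)\<close>.\<close>

lemma conv_eta_power_bound:
  assumes n: "n \<ge> 1" and s: "s > 0" and G: "integrable (lebn n) G"
    and Gp: "integrable (lebn n) (\<lambda>x. \<bar>G x\<bar> ^ (2 * n))"
  shows "conv n (eta n s) (\<lambda>y. \<bar>G y\<bar>) x
     \<le> (1 + (\<integral>y. \<bar>G y\<bar> ^ (2 * n) \<partial>lebn n) / bump_mass ^ n) / sqrt s"
proof -
  define b where "b = sqrt s"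
  have b: "b > 0" "b * b = s" using s by (auto simp: b_def)
  note mk = mollifier_eta[OF s, of n] note tk = mollifier_test_fun[OF mk]
  have m: "(1 / bump_mass / s) \<ge> 0" using s bump_mass_pos by simp
  have "conv n (eta n s) (\<lambda>y. \<bar>G y\<bar>) x
     \<le> (\<integral>y. eta n s (vsub n x y) * (1 / b) + (b ^ (2 * n - 1) * (1 / bump_mass / s) ^ n) * \<bar>G y\<bar> ^ (2 * n) \<partial>lebn n)"
    unfolding conv_def
  proof (rule integral_mono)
    show "integrable (lebn n) (\<lambda>y. eta n s (vsub n x y) * \<bar>G y\<bar>)"
      using G by (intro conv_integrable[OF tk]) auto
    show "integrable (lebn n) (\<lambda>y. eta n s (vsub n x y) * (1 / b) + (b ^ (2 * n - 1) * (1 / bump_mass / s) ^ n) * \<bar>G y\<bar> ^ (2 * n))"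
      using Gp mollifier_integrable[OF mk, of x] by (intro Bochner_Integration.integrable_add integrable_mult_left integrable_mult_right) auto
    fix y
    have e0: "0 \<le> eta n s (vsub n x y)" by (rule mollifier_nonneg[OF mk])
    have "eta n s (vsub n x y) * \<bar>G y\<bar> \<le> eta n s (vsub n x y) * (1 / b + \<bar>G y\<bar> ^ (2 * n) * b ^ (2 * n - 1))"
      using abs_le_power_bound[OF b(1), of "2 * n" "G y"] n e0 by (intro mult_left_mono) auto
    also have "\<dots> = eta n s (vsub n x y) * (1 / b) + eta n s (vsub n x y) * (\<bar>G y\<bar> ^ (2 * n) * b ^ (2 * n - 1))"
      by (simp add: distrib_left)
    also have "eta n s (vsub n x y) * (\<bar>G y\<bar> ^ (2 * n) * b ^ (2 * n - 1)) \<le> (1 / bump_mass / s) ^ n * (\<bar>G y\<bar> ^ (2 * n) * b ^ (2 * n - 1))"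
      using eta_le[OF s] b(1) by (intro mult_right_mono) auto
    finally show "eta n s (vsub n x y) * \<bar>G y\<bar> \<le> eta n s (vsub n x y) * (1 / b) + (b ^ (2 * n - 1) * (1 / bump_mass / s) ^ n) * \<bar>G y\<bar> ^ (2 * n)"
      by (simp add: mult_ac)
  qed
  also have "\<dots> = 1 / b + (b ^ (2 * n - 1) * (1 / bump_mass / s) ^ n) * (\<integral>y. \<bar>G y\<bar> ^ (2 * n) \<partial>lebn n)"
    using Gp mollifier_integrable[OF mk, of x] mollifier_integral[OF mk, of x]
    by (subst Bochner_Integration.integral_add) auto
  \<comment> \<open>Here the exponent \<open>2 n\<close> pays off: \<open>b^(2 n) = s^n\<close>
    cancels the height of the kernel, and the one missing factor \<open>b\<close> is the
    rate.\<close>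
  also have "b ^ (2 * n - 1) * (1 / bump_mass / s) ^ n = 1 / bump_mass ^ n / b"
  proof -
    have "b ^ (2 * n - 1) * b = b ^ (2 * n)" using n by (metis Suc_diff_1 mult_pos_pos power_Suc2 zero_less_numeral less_le_trans zero_less_one)
    also have "b ^ (2 * n) = s ^ n" using b(2) by (metis power2_eq_square power_mult)
    finally have "b ^ (2 * n - 1) = s ^ n / b" using b(1) by (simp add: field_simps)
    then show ?thesis using s bump_mass_pos by (simp add: power_divide power_mult_distrib)
  qed
  finally show ?thesis using b by (simp add: b_def[symmetric] add_divide_distrib)
qed

text \<open>The derivative in the scale falls on the kernel and becomes minus a divergence, a form
  in which it can be moved onto \<open>U\<close> as a weak gradient.\<close>

lemma conv_eta_DERIV:
  assumes s: "s > 0" and U: "integrable (lebn n) U"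
  shows "((\<lambda>s. conv n (eta n s) U x) has_real_derivative - (\<Sum>i<n. conv n (partial i (psi n s i)) U x)) (at s)"
proof -
  \<comment> \<open>Domination near \<open>s\<close> needs a bound that is uniform for the scales
    above \<open>s/2\<close>.\<close>
  obtain C where C: "\<And>t i x. t > s/2 \<Longrightarrow> i < n \<Longrightarrow> \<bar>partial i (psi n t i) x\<bar> \<le> C"
    using partial_psi_bounded[of "s/2" n] s by (metis half_gt_zero)
  have tp: "partial i (psi n t i) \<in> test_fun n (Rn n)" if "t > 0" "i < n" for t i
    by (rule kernel_test_fun[OF kernel_partial[OF kernel_psi[OF that] that(2)]])
  have meas: "(\<lambda>y. partial i (psi n s i) (vsub n x y) * U y) \<in> borel_measurable (lebn n)" if "i < n" for i
    using conv_integrable[OF tp[OF s that] U, of x] by (rule borel_measurable_integrable)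
  have "((\<lambda>s. \<integral>y. eta n s (vsub n x y) * U y \<partial>lebn n) has_real_derivative
     (\<integral>y. - (\<Sum>i<n. partial i (psi n s i) (vsub n x y) * U y) \<partial>lebn n)) (at s)"
  proof (rule DERIV_integral[where a = "s/2" and b = "s + 1" and B = "\<lambda>y. (real n * C) * \<bar>U y\<bar>"
        and f' = "\<lambda>s y. - (\<Sum>i<n. partial i (psi n s i) (vsub n x y) * U y)"])
    fix t y assume t: "t \<in> {s/2<..<s+1}"
    then have t0: "t > 0" using s by auto
    show "integrable (lebn n) (\<lambda>y. eta n t (vsub n x y) * U y)"
      by (rule conv_integrable[OF mollifier_test_fun[OF mollifier_eta[OF t0]] U])
    show "((\<lambda>t. eta n t (vsub n x y) * U y) has_real_derivative - (\<Sum>i<n. partial i (psi n t i) (vsub n x y) * U y)) (at t)"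
      using DERIV_cmult_right[OF eta_DERIV_scale[OF t0, of n "vsub n x y"], of "U y"]
      by (simp add: sum_distrib_right)
    have "\<bar>\<Sum>i<n. partial i (psi n t i) (vsub n x y) * U y\<bar> \<le> (\<Sum>i<n. C * \<bar>U y\<bar>)"
      using t C by (intro order_trans[OF sum_abs] sum_mono) (auto simp: abs_mult intro!: mult_right_mono)
    then show "\<bar>- (\<Sum>i<n. partial i (psi n t i) (vsub n x y) * U y)\<bar> \<le> (real n * C) * \<bar>U y\<bar>" by simp
  next
    show "(\<lambda>y. - (\<Sum>i<n. partial i (psi n s i) (vsub n x y) * U y)) \<in> borel_measurable (lebn n)"
      by (intro borel_measurable_uminus borel_measurable_sum meas) simp
  qed (use s U in auto)
  moreover have "(\<integral>y. - (\<Sum>i<n. partial i (psi n s i) (vsub n x y) * U y) \<partial>lebn n) = - (\<Sum>i<n. conv n (partial i (psi n s i)) U x)"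
    unfolding conv_def
    by (subst Bochner_Integration.integral_minus, subst Bochner_Integration.integral_sum)
      (auto intro: conv_integrable[OF tp[OF s] U])
  ultimately show ?thesis by (simp add: conv_def)
qed

text \<open>Morrey's estimate: the scale derivative of a mollification is a mollification of the gradient,
  which is of order \<open>s powr (-1/2)\<close> for a gradient in \<open>L\<^bsup>2n\<^esup>\<close>, hence integrable down to \<open>s = 0\<close>.\<close>

lemma morrey_scales:
  assumes n: "n \<ge> 1" and w: "\<And>i. i < n \<Longrightarrow> weak_partial n \<Omega> i U (G i)"
    and K: "K \<subseteq> \<Omega>" and U: "integrable (lebn n) (cut K U)"
    and G: "\<And>i. i < n \<Longrightarrow> integrable (lebn n) (cut K (G i))"
    and Gp: "\<And>i. i < n \<Longrightarrow> integrable (lebn n) (\<lambda>x. \<bar>cut K (G i) x\<bar> ^ (2 * n))"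
  shows "\<exists>C\<ge>0. \<forall>x \<delta> \<epsilon>. ccube n x s0 \<subseteq> K \<longrightarrow> 0 < \<delta> \<longrightarrow> \<delta> \<le> \<epsilon> \<longrightarrow> \<epsilon> < s0 \<longrightarrow>
    \<bar>conv n (eta n \<epsilon>) (cut K U) x - conv n (eta n \<delta>) (cut K U) x\<bar> \<le> C * sqrt \<epsilon>"
proof -
  define D where "D = (\<Sum>i<n. 1 + (\<integral>y. \<bar>cut K (G i) y\<bar> ^ (2 * n) \<partial>lebn n) / bump_mass ^ n)"
  have D0: "D \<ge> 0" unfolding D_def using bump_mass_pos by (intro sum_nonneg add_nonneg_nonneg divide_nonneg_nonneg integral_nonneg_AE) auto
  have "\<bar>conv n (eta n \<epsilon>) (cut K U) x - conv n (eta n \<delta>) (cut K U) x\<bar> \<le> 2 * D * sqrt \<epsilon>"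
    if x: "ccube n x s0 \<subseteq> K" and \<delta>: "0 < \<delta>" and \<delta>\<epsilon>: "\<delta> \<le> \<epsilon>" and \<epsilon>: "\<epsilon> < s0" for x \<delta> \<epsilon>
  proof -
    define F where "F s = conv n (eta n s) (cut K U) x" for s
    have der: "\<exists>F'. (F has_real_derivative F') (at s) \<and> \<bar>F'\<bar> \<le> D / sqrt s" if s: "0 < s" "s < s0" for s
    proof (intro exI conjI)
      show "(F has_real_derivative - (\<Sum>i<n. conv n (partial i (psi n s i)) (cut K U) x)) (at s)"
        unfolding F_def by (rule conv_eta_DERIV[OF s(1) U])
      have sub: "ccube n x s \<subseteq> K" using x ccube_mono[of s s0 n x] s(2) by auto
      have "\<bar>conv n (partial i (psi n s i)) (cut K U) x\<bar> \<le> (1 + (\<integral>y. \<bar>cut K (G i) y\<bar> ^ (2 * n) \<partial>lebn n) / bump_mass ^ n) / sqrt s"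
        if i: "i < n" for i
      proof -
        have "conv n (partial i (psi n s i)) (cut K U) x = conv n (psi n s i) (cut K (G i)) x"
          by (rule conv_weak_partial[OF w[OF i] K kernel_psi[OF s(1) i] sub i])
        also have "\<bar>\<dots>\<bar> \<le> (\<integral>y. \<bar>psi n s i (vsub n x y) * cut K (G i) y\<bar> \<partial>lebn n)"
          unfolding conv_def by (rule integral_abs_bound)
        also have "\<dots> \<le> (\<integral>y. eta n s (vsub n x y) * \<bar>cut K (G i) y\<bar> \<partial>lebn n)"
        proof (rule integral_mono)
          show "integrable (lebn n) (\<lambda>y. \<bar>psi n s i (vsub n x y) * cut K (G i) y\<bar>)"
            by (intro integrable_abs conv_integrable[OF kernel_test_fun[OF kernel_psi[OF s(1) i]] G[OF i]])
          show "integrable (lebn n) (\<lambda>y. eta n s (vsub n x y) * \<bar>cut K (G i) y\<bar>)"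
            by (intro conv_integrable[OF mollifier_test_fun[OF mollifier_eta[OF s(1)]]] integrable_abs G[OF i])
          show "\<bar>psi n s i (vsub n x y) * cut K (G i) y\<bar> \<le> eta n s (vsub n x y) * \<bar>cut K (G i) y\<bar>" for y
            unfolding abs_mult[of "psi n s i (vsub n x y)"] by (intro mult_right_mono psi_abs_le[OF s(1) i]) auto
        qed
        also have "\<dots> = conv n (eta n s) (\<lambda>y. \<bar>cut K (G i) y\<bar>) x" by (simp add: conv_def)
        also have "\<dots> \<le> (1 + (\<integral>y. \<bar>cut K (G i) y\<bar> ^ (2 * n) \<partial>lebn n) / bump_mass ^ n) / sqrt s"
          by (rule conv_eta_power_bound[OF n s(1) G[OF i] Gp[OF i]])
        finally show ?thesis .
      qed
      then have "\<bar>\<Sum>i<n. conv n (partial i (psi n s i)) (cut K U) x\<bar> \<le> (\<Sum>i<n. (1 + (\<integral>y. \<bar>cut K (G i) y\<bar> ^ (2 * n) \<partial>lebn n) / bump_mass ^ n) / sqrt s)"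
        by (intro order_trans[OF sum_abs] sum_mono) auto
      then show "\<bar>- (\<Sum>i<n. conv n (partial i (psi n s i)) (cut K U) x)\<bar> \<le> D / sqrt s"
        by (simp add: D_def sum_divide_distrib)
    qed
    \<comment> \<open>A primitive of the bound on the derivative of \<open>F\<close>. That its sum
      and its difference with \<open>F\<close> are both nondecreasing replaces an integration over
      the scales.\<close>
    have sq: "((\<lambda>s. 2 * D * sqrt s) has_real_derivative D / sqrt s) (at s)" if "s > 0" for s
      by (rule DERIV_cong[OF DERIV_cmult[OF DERIV_real_sqrt[OF that], of "2 * D"]]) (simp add: inverse_eq_divide)
    have "2 * D * sqrt \<delta> - F \<delta> \<le> 2 * D * sqrt \<epsilon> - F \<epsilon>"
    proof (rule DERIV_nonneg_imp_nondecreasing[OF \<delta>\<epsilon>])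
      fix s assume "\<delta> \<le> s" "s \<le> \<epsilon>"
      then have s: "0 < s" "s < s0" using \<delta> \<epsilon> by auto
      obtain F' where F': "(F has_real_derivative F') (at s)" "\<bar>F'\<bar> \<le> D / sqrt s" using der[OF s] by blast
      then show "\<exists>y. ((\<lambda>s. 2 * D * sqrt s - F s) has_real_derivative y) (at s) \<and> 0 \<le> y"
        by (intro exI[of _ "D / sqrt s - F'"] conjI DERIV_diff[OF sq[OF s(1)] F'(1)]) auto
    qed
    moreover have "2 * D * sqrt \<delta> + F \<delta> \<le> 2 * D * sqrt \<epsilon> + F \<epsilon>"
    proof (rule DERIV_nonneg_imp_nondecreasing[OF \<delta>\<epsilon>])
      fix s assume "\<delta> \<le> s" "s \<le> \<epsilon>"
      then have s: "0 < s" "s < s0" using \<delta> \<epsilon> by auto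
      obtain F' where F': "(F has_real_derivative F') (at s)" "\<bar>F'\<bar> \<le> D / sqrt s" using der[OF s] by blast
      then show "\<exists>y. ((\<lambda>s. 2 * D * sqrt s + F s) has_real_derivative y) (at s) \<and> 0 \<le> y"
        by (intro exI[of _ "D / sqrt s + F'"] conjI DERIV_add[OF sq[OF s(1)] F'(1)]) auto
    qed
    moreover have "0 \<le> 2 * D * sqrt \<delta>" using D0 \<delta> by simp
    ultimately show ?thesis unfolding F_def by linarith
  qed
  then show ?thesis using D0 by (intro exI[of _ "2 * D"]) auto
qed

text \<open>Let the smaller scale in \<open>morrey_scales\<close> tend to 0 along a sequence of
  almost everywhere convergence; the estimate survives with the same constant.\<close>

lemma morrey:
  assumes "n \<ge> 1" "\<And>i. i < n \<Longrightarrow> weak_partial n \<Omega> i U (G i)" "K \<subseteq> \<Omega>" and U: "integrable (lebn n) (cut K U)"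
    and "\<And>i. i < n \<Longrightarrow> integrable (lebn n) (cut K (G i))"
    and "\<And>i. i < n \<Longrightarrow> integrable (lebn n) (\<lambda>x. \<bar>cut K (G i) x\<bar> ^ (2 * n))"
  shows "\<exists>C\<ge>0. \<forall>\<epsilon>. 0 < \<epsilon> \<longrightarrow> \<epsilon> < s0 \<longrightarrow>
    (AE x in lebn n. ccube n x s0 \<subseteq> K \<longrightarrow> \<bar>conv n (eta n \<epsilon>) (cut K U) x - U x\<bar> \<le> C * sqrt \<epsilon>)"
proof -
  obtain C where C: "C \<ge> 0" "\<And>x \<delta> \<epsilon>. ccube n x s0 \<subseteq> K \<Longrightarrow> 0 < \<delta> \<Longrightarrow> \<delta> \<le> \<epsilon> \<Longrightarrow> \<epsilon> < s0 \<Longrightarrow>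
    \<bar>conv n (eta n \<epsilon>) (cut K U) x - conv n (eta n \<delta>) (cut K U) x\<bar> \<le> C * sqrt \<epsilon>"
    using morrey_scales[OF assms, of s0] by blast
  obtain d where "mollify_seq n (cut K U) d" by (rule mollify_seq_exists[OF U])
  note d = mollify_seqD[OF this]
  have "AE x in lebn n. ccube n x s0 \<subseteq> K \<longrightarrow> \<bar>conv n (eta n \<epsilon>) (cut K U) x - U x\<bar> \<le> C * sqrt \<epsilon>"
    if \<epsilon>: "0 < \<epsilon>" "\<epsilon> < s0" for \<epsilon>
    using d(3) AE_space
  proof eventually_elim
    case (elim x)
    show ?case
    proof
      assume x: "ccube n x s0 \<subseteq> K"
      have "x \<in> ccube n x s0" using \<epsilon> elim(2) by (simp add: mem_ccube)
      then have cx: "cut K U x = U x" using x by auto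
      have lim: "(\<lambda>k. \<bar>conv n (eta n \<epsilon>) (cut K U) x - conv n (eta n (d k)) (cut K U) x\<bar>)
         \<longlonglongrightarrow> \<bar>conv n (eta n \<epsilon>) (cut K U) x - U x\<bar>"
        using elim(1) unfolding cx by (intro tendsto_intros)
      have "eventually (\<lambda>k. d k < \<epsilon>) sequentially" using order_tendstoD(2)[OF d(2)] \<epsilon>(1) by simp
      then have "eventually (\<lambda>k. \<bar>conv n (eta n \<epsilon>) (cut K U) x - conv n (eta n (d k)) (cut K U) x\<bar> \<le> C * sqrt \<epsilon>) sequentially"
        by eventually_elim (use C(2)[OF x d(1)] \<epsilon> in auto)
      then show "\<bar>conv n (eta n \<epsilon>) (cut K U) x - U x\<bar> \<le> C * sqrt \<epsilon>"
        using lim by (intro tendsto_upperbound[OF lim]) auto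
    qed
  qed
  then show ?thesis using C(1) by blast
qed

section \<open>Classical and weak derivatives\<close>

lemma test_fun_integrable:
  assumes w: "w \<in> test_fun n \<Omega>" shows "integrable (lebn n) w"
proof -
  obtain K where K: "compactin (Rn_top n) K" "\<forall>x\<in>Rn n - K. w x = 0" using w unfolding test_fun_iff by blast
  obtain B where B: "B \<ge> 0" "\<And>x. x \<in> Rn n \<Longrightarrow> \<bar>w x\<bar> \<le> B" using test_fun_bounded[OF w] by blast
  show ?thesis
  proof (rule Bochner_Integration.integrable_bound)
    show "integrable (lebn n) (\<lambda>x. B * indicat_real K x)"
      using compactin_Rn_sets[OF K(1)] compactin_Rn_finite[OF K(1)] by (intro integrable_mult_right integrable_real_indicator)
    show "w \<in> borel_measurable (lebn n)" by (rule test_fun_borel[OF w])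
    show "AE x in lebn n. norm (w x) \<le> norm (B * indicat_real K x)"
    proof (rule AE_I2)
      fix x assume "x \<in> space (lebn n)"
      then show "norm (w x) \<le> norm (B * indicat_real K x)" using B K(2) by (cases "x \<in> K") auto
    qed
  qed
qed

lemma test_fun_kernel:
  assumes w: "w \<in> test_fun n \<Omega>"
  obtains R where "R > 0" "kernel n R w"
proof -
  obtain K where K: "compactin (Rn_top n) K" "\<forall>x\<in>Rn n - K. w x = 0" using w unfolding test_fun_iff by blast
  obtain R where R: "R > 0" "\<And>x i. x \<in> K \<Longrightarrow> i < n \<Longrightarrow> \<bar>x i\<bar> \<le> R" using compactin_Rn_bounded[OF K(1)] by blast
  have "w x = 0" if "x \<in> Rn n" "i < n" "R < \<bar>x i\<bar>" for x i
    using R(2)[of x i] K(2) that by fastforce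
  then have "kernel n R w" using w unfolding kernel_def test_fun_iff by blast
  then show ?thesis using that R(1) by blast
qed

text \<open>By translation invariance \<open>\<integral> w (x + t e\<^sub>i)\<close> does not depend on \<open>t\<close>.\<close>

lemma integral_partial_eq_0:
  assumes w: "w \<in> test_fun n (Rn n)" and i: "i < n"
  shows "(\<integral>x. partial i w x \<partial>lebn n) = 0"
proof -
  obtain R where R: "R > 0" "kernel n R w" using test_fun_kernel[OF w] by blast
  define z :: "nat \<Rightarrow> real" where "z = (\<lambda>i\<in>{..<n}. 0)"
  have z: "z \<in> Rn n" by (simp add: z_def)
  \<comment> \<open>Equal to 1 on the support of every kernel centred near the origin, so
    \<open>conv n w W\<close> is constant there. Its derivative is the convolution with
    \<open>partial i w\<close>, which is the integral in question.\<close>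
  define W where "W = indicat_real (ccube n z (R + 1))"
  have W: "integrable (lebn n) W" unfolding W_def
    using compactin_Rn_sets[OF compactin_ccube] compactin_Rn_finite[OF compactin_ccube] by (intro integrable_real_indicator)
  have sub: "y \<in> ccube n z (R + 1)" if "x \<in> cube n z 1" "y \<in> ccube n x R" for x y
    unfolding mem_ccube
  proof (intro conjI allI impI)
    show "y \<in> Rn n" using that by (simp add: mem_ccube)
    fix i assume "i < n"
    then have "\<bar>x i - z i\<bar> < 1" "\<bar>y i - x i\<bar> \<le> R" using that by (auto simp: mem_ccube mem_cube)
    then show "\<bar>y i - z i\<bar> \<le> R + 1" by linarith
  qed
  have one: "conv n k W x = (\<integral>y. k y \<partial>lebn n)" if k: "kernel n R k" and x: "x \<in> cube n z 1" for k x
  proof -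
    have "conv n k W x = conv n k (\<lambda>_. 1) x"
      by (rule conv_cong[OF k]) (use sub[OF x] in \<open>simp add: W_def\<close>)
    also have "\<dots> = (\<integral>y. k (vsub n x y) \<partial>lebn n)" by (simp add: conv_def)
    also have "\<dots> = (\<integral>y. k y \<partial>lebn n)" by (rule integral_vsub_right[OF test_fun_borel[OF kernel_test_fun[OF k]]])
    finally show ?thesis .
  qed
  have zz: "z \<in> cube n z 1" using cube_self[OF z] by simp
  have "has_partial i (conv n w W) (conv n (partial i w) W z) z" by (rule conv_has_partial[OF w W i z])
  moreover have "has_partial i (conv n w W) 0 z"
    using has_partial_cong[OF openin_cube[OF z] zz i, of "conv n w W" "\<lambda>_. \<integral>y. w y \<partial>lebn n"] one[OF R(2)]
      has_partial_const by blast
  ultimately have "conv n (partial i w) W z = 0" using has_partial_imp_partial by metis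
  then show ?thesis using one[OF kernel_partial[OF R(2) i] zz] by simp
qed

text \<open>Smoothness is local: the product is smooth on \<open>\<Omega>\<close> and vanishes on
  the complement of the support \<open>K\<close>, and these two open sets cover the space.\<close>

lemma test_fun_mult_extend:
  assumes \<Omega>: "openin (Rn_top n) \<Omega>" and v: "v \<in> C_inf n \<Omega>" and \<psi>: "\<psi> \<in> test_fun n \<Omega>"
  shows "(\<lambda>x. indicator \<Omega> x * (v x * \<psi> x)) \<in> test_fun n \<Omega>"
proof -
  obtain K where K: "compactin (Rn_top n) K" "K \<subseteq> \<Omega>" "\<forall>x\<in>Rn n - K. \<psi> x = 0" using \<psi> unfolding test_fun_iff by blast
  have op: "openin (Rn_top n) (Rn n - K)" using compactin_Rn_closedin[OF K(1)] by (simp add: closedin_def)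
  have "(\<lambda>x. indicator \<Omega> x * (v x * \<psi> x)) \<in> C_inf n (Rn n)"
  proof (rule C_inf_local[OF openin_Rn_UNIV])
    fix x assume x: "x \<in> Rn n"
    show "\<exists>V. openin (Rn_top n) V \<and> x \<in> V \<and> (\<lambda>x. indicator \<Omega> x * (v x * \<psi> x)) \<in> C_inf n V"
    proof (cases "x \<in> \<Omega>")
      case True
      have "\<psi> \<in> C_inf n \<Omega>" using \<psi> C_inf_mono[of \<psi> n "Rn n" \<Omega>] openin_subset[OF \<Omega>] by (simp add: test_fun_iff)
      then have "(\<lambda>x. indicator \<Omega> x * (v x * \<psi> x)) \<in> C_inf n \<Omega>"
        by (rule C_inf_cong[OF \<Omega> C_inf_mult[OF \<Omega> v]]) simp
      then show ?thesis using True \<Omega> by blast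
    next
      case False
      have "(\<lambda>x. indicator \<Omega> x * (v x * \<psi> x)) \<in> C_inf n (Rn n - K)"
        by (rule C_inf_cong[OF op C_inf_const[OF op, of 0]]) (use K(3) in simp)
      then show ?thesis using False K(2) x op by blast
    qed
  qed
  then show ?thesis unfolding test_fun_iff using K by (intro conjI exI[of _ K]) auto
qed

text \<open>Integration by parts without a boundary term: the product of \<open>v\<close> with a
  test function extends to a test function on the whole space, and its partial derivative has
  integral 0.\<close>

lemma weak_partial_C_inf:
  assumes \<Omega>: "openin (Rn_top n) \<Omega>" and v: "v \<in> C_inf n \<Omega>" and i: "i < n"
  shows "weak_partial n \<Omega> i v (partial i v)"
  unfolding weak_partial_def
proof
  fix \<psi> assume \<psi>: "\<psi> \<in> test_fun n \<Omega>"
  let ?w = "\<lambda>x. indicator \<Omega> x * (v x * \<psi> x)"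
  have w: "?w \<in> test_fun n \<Omega>" by (rule test_fun_mult_extend[OF \<Omega> v \<psi>])
  have sub: "\<Omega> \<subseteq> Rn n" using openin_subset[OF \<Omega>] by simp
  have w': "?w \<in> test_fun n (Rn n)" by (rule test_fun_mono[OF w sub])
  have i1: "integrable (lebn n) (\<lambda>x. indicator \<Omega> x * (v x * partial i \<psi> x))"
    by (rule test_fun_integrable[OF test_fun_mult_extend[OF \<Omega> v test_fun_partial[OF \<psi> i]]])
  have i2: "integrable (lebn n) (\<lambda>x. indicator \<Omega> x * (partial i v x * \<psi> x))"
    by (rule test_fun_integrable[OF test_fun_mult_extend[OF \<Omega> C_inf_partial[OF v i] \<psi>]])
  have "partial i ?w x = indicator \<Omega> x * (v x * partial i \<psi> x) + indicator \<Omega> x * (partial i v x * \<psi> x)"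
    if x: "x \<in> Rn n" for x
  proof (cases "x \<in> \<Omega>")
    case True
    have "partial i ?w x = partial i (\<lambda>x. v x * \<psi> x) x"
      by (rule partial_cong[OF \<Omega> True i]) simp
    also have "\<dots> = partial i v x * \<psi> x + v x * partial i \<psi> x"
      using \<psi> x by (intro has_partial_imp_partial has_partial_mult C_inf_has_partial[OF v i True] C_inf_has_partial[of \<psi> n "Rn n"] i) (auto simp: test_fun_iff)
    finally show ?thesis using True by simp
  next
    case False
    have "partial i ?w \<in> test_fun n \<Omega>" by (rule test_fun_partial[OF w i])
    then show ?thesis using False x unfolding test_fun_iff by auto
  qed
  then have "(\<integral>x. partial i ?w x \<partial>lebn n) = (\<integral>x. indicator \<Omega> x * (v x * partial i \<psi> x) + indicator \<Omega> x * (partial i v x * \<psi> x) \<partial>lebn n)"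
    by (intro Bochner_Integration.integral_cong) auto
  also have "\<dots> = (\<integral>x. indicator \<Omega> x * (v x * partial i \<psi> x) \<partial>lebn n) + (\<integral>x. indicator \<Omega> x * (partial i v x * \<psi> x) \<partial>lebn n)"
    by (rule Bochner_Integration.integral_add[OF i1 i2])
  finally show "(\<integral>x. indicator \<Omega> x * (v x * partial i \<psi> x) \<partial>lebn n) = - (\<integral>x. indicator \<Omega> x * (partial i v x * \<psi> x) \<partial>lebn n)"
    using integral_partial_eq_0[OF w' i] by linarith
qed

lemma loc_int_C_inf:
  assumes \<Omega>: "openin (Rn_top n) \<Omega>" and v: "v \<in> C_inf n \<Omega>"
  shows "loc_int n \<Omega> (cut \<Omega> v)"
  unfolding loc_int_def
proof (intro conjI allI impI)
  show bm: "cut \<Omega> v \<in> borel_measurable (lebn n)" by (rule C_inf_borel[OF \<Omega> v])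
  fix K assume "compactin (Rn_top n) K \<and> K \<subseteq> \<Omega>"
  then have K: "compactin (Rn_top n) K" "K \<subseteq> \<Omega>" by auto
  note KS = compactin_Rn_sets[OF K(1)]
  obtain B where B: "B \<ge> 0" "\<And>x. x \<in> K \<Longrightarrow> \<bar>v x\<bar> \<le> B" using cont_bounded_on_compact[OF K C_inf_cont[OF v]] by blast
  show "integrable (lebn n) (cut K (cut \<Omega> v))"
  proof (rule Bochner_Integration.integrable_bound)
    show "integrable (lebn n) (\<lambda>x. B * indicat_real K x)"
      using KS compactin_Rn_finite[OF K(1)] by (intro integrable_mult_right integrable_real_indicator)
    show "cut K (cut \<Omega> v) \<in> borel_measurable (lebn n)" using KS bm by measurable
    show "AE x in lebn n. norm (cut K (cut \<Omega> v) x) \<le> norm (B * indicat_real K x)"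
    proof (rule AE_I2)
      fix x
      show "norm (cut K (cut \<Omega> v) x) \<le> norm (B * indicat_real K x)"
        using B(1) B(2)[of x] K(2) by (cases "x \<in> K") auto
    qed
  qed
qed

text \<open>Functions of the statement are measurable only for the completed measure restricted to
  \<open>\<Omega>\<close>. \<open>U\<close> is a Borel function on the whole space in the same class
  on \<open>\<Omega>\<close>; its values outside are arbitrary.\<close>

definition rep :: "nat \<Rightarrow> (nat \<Rightarrow> real) set \<Rightarrow> ((nat \<Rightarrow> real) \<Rightarrow> real) \<Rightarrow> ((nat \<Rightarrow> real) \<Rightarrow> real) \<Rightarrow> bool" where
  "rep n \<Omega> v U \<longleftrightarrow> v \<in> borel_measurable (Rn_leb_on n \<Omega>) \<and> U \<in> borel_measurable (lebn n) \<and>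
     (AE x in lebn n. x \<in> \<Omega> \<longrightarrow> v x = U x)"

lemma borel_measurable_Rn_leb_on_iff:
  fixes v :: "(nat \<Rightarrow> real) \<Rightarrow> real"
  assumes "\<Omega> \<in> sets (lebn n)"
  shows "v \<in> borel_measurable (Rn_leb_on n \<Omega>) \<longleftrightarrow> (\<lambda>x. indicator \<Omega> x * v x) \<in> borel_measurable (completion (lebn n))"
proof -
  have "\<Omega> \<inter> space (completion (lebn n)) \<in> sets (completion (lebn n))" using assms by auto
  from borel_measurable_restrict_space_iff[OF this, of v] show ?thesis
    by (simp add: Rn_leb_on_def Rn_leb_def mult.commute)
qed

lemma rep_exists:
  assumes \<Omega>: "\<Omega> \<in> sets (lebn n)" and v: "v \<in> borel_measurable (Rn_leb_on n \<Omega>)"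
  obtains U where "rep n \<Omega> v U"
proof -
  have "(\<lambda>x. indicator \<Omega> x * v x) \<in> borel_measurable (completion (lebn n))"
    using v borel_measurable_Rn_leb_on_iff[OF \<Omega>] by blast
  from completion_ex_borel_measurable_real[OF this] obtain U
    where U: "U \<in> borel_measurable (lebn n)" "AE x in lebn n. indicator \<Omega> x * v x = U x" by blast
  have "AE x in lebn n. x \<in> \<Omega> \<longrightarrow> v x = U x" using U(2) by eventually_elim auto
  then show ?thesis using that U(1) v unfolding rep_def by blast
qed

lemma rep_I:
  assumes \<Omega>: "\<Omega> \<in> sets (lebn n)" and U: "U \<in> borel_measurable (lebn n)" and eq: "\<And>x. x \<in> \<Omega> \<Longrightarrow> v x = U x"
  shows "rep n \<Omega> v U"
proof -
  have "(\<lambda>x. indicator \<Omega> x * v x) = (\<lambda>x. indicator \<Omega> x * U x)" using eq by (auto simp: indicator_def)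
  moreover have "(\<lambda>x. indicator \<Omega> x * U x) \<in> borel_measurable (lebn n)" using \<Omega> U by measurable
  ultimately have "(\<lambda>x. indicator \<Omega> x * v x) \<in> borel_measurable (completion (lebn n))"
    by (simp add: measurable_completion)
  then have "v \<in> borel_measurable (Rn_leb_on n \<Omega>)" using borel_measurable_Rn_leb_on_iff[OF \<Omega>, of v] by blast
  then show ?thesis using eq U by (simp add: rep_def)
qed

lemma rep_subset:
  assumes "rep n \<Omega> v U" "\<Omega> \<in> sets (lebn n)" "K \<in> sets (lebn n)" "K \<subseteq> \<Omega>"
  shows "rep n K v U"
proof -
  have v: "(\<lambda>x. indicator \<Omega> x * v x) \<in> borel_measurable (completion (lebn n))"
    using assms(1) borel_measurable_Rn_leb_on_iff[OF assms(2)] unfolding rep_def by blast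
  have "K \<in> sets (completion (lebn n))" using assms(3) by auto
  then have "(\<lambda>x. indicator K x * (indicator \<Omega> x * v x)) \<in> borel_measurable (completion (lebn n))"
    using v by measurable
  also have "(\<lambda>x. indicator K x * (indicator \<Omega> x * v x)) = (\<lambda>x. indicator K x * v x)"
    using assms(4) by (auto simp: fun_eq_iff indicator_def)
  finally have "v \<in> borel_measurable (Rn_leb_on n K)" using borel_measurable_Rn_leb_on_iff[OF assms(3)] by blast
  moreover have "AE x in lebn n. x \<in> K \<longrightarrow> v x = U x"
    using assms(1,4) unfolding rep_def by (auto elim: AE_mp)
  ultimately show ?thesis using assms(1) unfolding rep_def by blast
qed

lemma rep_AE_completion:
  assumes "rep n \<Omega> v U"
  shows "AE x in completion (lebn n). indicator \<Omega> x * v x = indicator \<Omega> x * U x"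
proof -
  have "AE x in lebn n. indicator \<Omega> x * v x = indicator \<Omega> x * U x"
    using assms unfolding rep_def by (auto elim!: eventually_mono simp: indicator_def)
  then show ?thesis by (simp add: AE_completion_iff)
qed

lemma rep_integrable_iff:
  assumes \<Omega>: "\<Omega> \<in> sets (lebn n)" and r: "rep n \<Omega> v U"
  shows "integrable (Rn_leb_on n \<Omega>) v \<longleftrightarrow> integrable (lebn n) (cut \<Omega> U)"
proof -
  have m1: "(\<lambda>x. indicator \<Omega> x * v x) \<in> borel_measurable (completion (lebn n))"
    using r borel_measurable_Rn_leb_on_iff[OF \<Omega>] unfolding rep_def by blast
  have "U \<in> borel_measurable (lebn n)" using r unfolding rep_def by blast
  then have m2: "cut \<Omega> U \<in> borel_measurable (lebn n)" using \<Omega> by measurable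
  have "integrable (Rn_leb_on n \<Omega>) v \<longleftrightarrow> integrable (completion (lebn n)) (\<lambda>x. indicator \<Omega> x * v x)"
    unfolding Rn_leb_on_def Rn_leb_def using \<Omega> by (subst integrable_restrict_space) auto
  also have "\<dots> \<longleftrightarrow> integrable (completion (lebn n)) (cut \<Omega> U)"
    by (rule integrable_cong_AE[OF m1 measurable_completion[OF m2] rep_AE_completion[OF r]])
  also have "\<dots> \<longleftrightarrow> integrable (lebn n) (cut \<Omega> U)" by (rule integrable_completion[OF m2])
  finally show ?thesis .
qed

lemma rep_integral:
  assumes \<Omega>: "\<Omega> \<in> sets (lebn n)" and r: "rep n \<Omega> v U"
  shows "(LINT x|Rn_leb_on n \<Omega>. v x) = (\<integral>x. indicator \<Omega> x * U x \<partial>lebn n)"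
proof -
  have m1: "(\<lambda>x. indicator \<Omega> x * v x) \<in> borel_measurable (completion (lebn n))"
    using r borel_measurable_Rn_leb_on_iff[OF \<Omega>] unfolding rep_def by blast
  have "U \<in> borel_measurable (lebn n)" using r unfolding rep_def by blast
  then have m2: "cut \<Omega> U \<in> borel_measurable (lebn n)" using \<Omega> by measurable
  have "(LINT x|Rn_leb_on n \<Omega>. v x) = (\<integral>x. indicator \<Omega> x * v x \<partial>completion (lebn n))"
    unfolding Rn_leb_on_def Rn_leb_def using \<Omega> by (subst integral_restrict_space) auto
  also have "\<dots> = (\<integral>x. cut \<Omega> U x \<partial>completion (lebn n))"
    by (rule integral_cong_AE[OF m1 measurable_completion[OF m2] rep_AE_completion[OF r]])
  also have "\<dots> = (\<integral>x. indicator \<Omega> x * U x \<partial>lebn n)" by (rule integral_completion[OF m2])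
  finally show ?thesis .
qed

lemma rep_mult:
  assumes \<Omega>: "\<Omega> \<in> sets (lebn n)" and r: "rep n \<Omega> v U" and f: "f \<in> borel_measurable (lebn n)"
  shows "rep n \<Omega> (\<lambda>x. v x * f x) (\<lambda>x. U x * f x)"
proof -
  have "(\<lambda>x. indicator \<Omega> x * v x) \<in> borel_measurable (completion (lebn n))"
    using r borel_measurable_Rn_leb_on_iff[OF \<Omega>] unfolding rep_def by blast
  from borel_measurable_times[OF this measurable_completion[OF f]]
  have "(\<lambda>x. indicator \<Omega> x * v x * f x) \<in> borel_measurable (completion (lebn n))" .
  then have "(\<lambda>x. v x * f x) \<in> borel_measurable (Rn_leb_on n \<Omega>)"
    using borel_measurable_Rn_leb_on_iff[OF \<Omega>] by (simp add: mult.assoc)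
  moreover have "(\<lambda>x. U x * f x) \<in> borel_measurable (lebn n)"
    using r f unfolding rep_def by (intro borel_measurable_times) auto
  moreover have "AE x in lebn n. x \<in> \<Omega> \<longrightarrow> v x * f x = U x * f x"
    using r unfolding rep_def by (auto elim!: eventually_mono)
  ultimately show ?thesis unfolding rep_def by blast
qed

lemma rep_modular:
  assumes \<Omega>: "\<Omega> \<in> sets (lebn n)" and r: "AE x in lebn n. x \<in> \<Omega> \<longrightarrow> v x = U x"
  shows "modular n \<Omega> \<phi> v = (\<integral>\<^sup>+x. indicator \<Omega> x * ennreal (\<phi> \<bar>U x\<bar>) \<partial>lebn n)"
proof -
  have "modular n \<Omega> \<phi> v = (\<integral>\<^sup>+x. ennreal (\<phi> \<bar>v x\<bar>) * indicator \<Omega> x \<partial>completion (lebn n))"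
    unfolding modular_def Rn_leb_on_def Rn_leb_def using \<Omega> by (subst nn_integral_restrict_space) auto
  also have "\<dots> = (\<integral>\<^sup>+x. ennreal (\<phi> \<bar>v x\<bar>) * indicator \<Omega> x \<partial>lebn n)" by (rule nn_integral_completion)
  also have "\<dots> = (\<integral>\<^sup>+x. indicator \<Omega> x * ennreal (\<phi> \<bar>U x\<bar>) \<partial>lebn n)"
    using r by (intro nn_integral_cong_AE) (auto elim!: eventually_mono simp: indicator_def)
  finally show ?thesis .
qed

lemma rep_L1_loc_iff:
  assumes \<Omega>: "\<Omega> \<in> sets (lebn n)" and r: "rep n \<Omega> v U"
  shows "v \<in> L1_loc n \<Omega> \<longleftrightarrow> loc_int n \<Omega> U"
proof -
  have "integrable (Rn_leb_on n K) v \<longleftrightarrow> integrable (lebn n) (cut K U)"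
    if "compactin (Rn_top n) K" "K \<subseteq> \<Omega>" for K
    using rep_integrable_iff[OF compactin_Rn_sets[OF that(1)] rep_subset[OF r \<Omega> compactin_Rn_sets[OF that(1)] that(2)]] .
  then show ?thesis using r unfolding L1_loc_def loc_int_def rep_def by blast
qed

text \<open>Products with test functions preserve \<open>rep\<close>, so every integral in the
  definition can be evaluated on representatives.\<close>

lemma has_weak_deriv_iff:
  assumes \<Omega>: "\<Omega> \<in> sets (lebn n)" and v: "rep n \<Omega> v U" and g: "rep n \<Omega> g G" and i: "i < n"
  shows "has_weak_deriv n \<Omega> i v g \<longleftrightarrow> loc_int n \<Omega> G \<and> weak_partial n \<Omega> i U G"
proof -
  have "(LINT x|Rn_leb_on n \<Omega>. v x * partial i \<psi> x) = (\<integral>x. indicator \<Omega> x * (U x * partial i \<psi> x) \<partial>lebn n)"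
    "(LINT x|Rn_leb_on n \<Omega>. g x * \<psi> x) = (\<integral>x. indicator \<Omega> x * (G x * \<psi> x) \<partial>lebn n)"
    if \<psi>: "\<psi> \<in> test_fun n \<Omega>" for \<psi>
    using rep_integral[OF \<Omega> rep_mult[OF \<Omega> v test_fun_borel[OF test_fun_partial[OF \<psi> i]]]]
      rep_integral[OF \<Omega> rep_mult[OF \<Omega> g test_fun_borel[OF \<psi>]]] by auto
  then show ?thesis
    unfolding has_weak_deriv_def weak_partial_def rep_L1_loc_iff[OF \<Omega> g] by auto
qed

text \<open>Controls the choice made in \<open>weak_deriv\<close>: any weak derivative agrees almost
  everywhere with one that is known explicitly.\<close>

lemma has_weak_deriv_unique:
  assumes \<Omega>: "openin (Rn_top n) \<Omega>" and i: "i < n" and v: "rep n \<Omega> v U"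
    and g: "has_weak_deriv n \<Omega> i v g" and H: "loc_int n \<Omega> H" "weak_partial n \<Omega> i U H"
  shows "rep n \<Omega> g H"
proof -
  note \<Omega>S = openin_imp_sets_lebn[OF \<Omega>]
  have gm: "g \<in> borel_measurable (Rn_leb_on n \<Omega>)" using g unfolding has_weak_deriv_def L1_loc_def by blast
  obtain G where G: "rep n \<Omega> g G" using rep_exists[OF \<Omega>S gm] by blast
  have G': "loc_int n \<Omega> G" "weak_partial n \<Omega> i U G" using g has_weak_deriv_iff[OF \<Omega>S v G i] by auto
  have "AE x in lebn n. x \<in> \<Omega> \<longrightarrow> G x = H x"
    by (rule test_fun_unique[OF \<Omega> G'(1) H(1)]) (use G'(2) H(2) in \<open>simp add: weak_partial_def\<close>)
  moreover have "AE x in lebn n. x \<in> \<Omega> \<longrightarrow> g x = G x" using G unfolding rep_def by blast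
  ultimately have "AE x in lebn n. x \<in> \<Omega> \<longrightarrow> g x = H x" by eventually_elim auto
  then show ?thesis using gm H(1) unfolding rep_def loc_int_def by blast
qed

section \<open>Growth of the Orlicz function\<close>

lemma power_div_fact_le_exp: "0 \<le> (y::real) \<Longrightarrow> y ^ k / fact k \<le> exp y"
proof -
  assume y: "0 \<le> y"
  have "(\<Sum>m\<in>{k}. y ^ m /\<^sub>R fact m) \<le> exp y"
    unfolding exp_def using y by (intro sum_le_suminf summable_exp_generic) auto
  then show ?thesis by (simp add: divide_inverse mult.commute)
qed

text \<open>The properties of the Orlicz function on which the construction rests:
  \<open>growth_support\<close> is convexity as Jensen's inequality uses it,
  \<open>growth_increment\<close> substitutes for a doubling condition under perturbations of size
  at most 1, \<open>growth_power\<close> puts gradients locally into every \<open>L^p\<close>, and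
  continuity serves Fatou's lemma.\<close>

locale growth =
  fixes \<phi> :: "real \<Rightarrow> real"
  assumes growth_0: "\<phi> 0 = 0"
    and growth_mono: "\<And>s t. 0 \<le> s \<Longrightarrow> s \<le> t \<Longrightarrow> \<phi> s \<le> \<phi> t"
    and growth_support: "\<And>a. 0 \<le> a \<Longrightarrow> \<exists>m. \<forall>t\<ge>0. \<phi> a + m * (t - a) \<le> \<phi> t"
    and growth_increment: "\<exists>C\<ge>0. \<forall>t\<ge>0. \<forall>s\<in>{0..1}. \<phi> (t + s) \<le> \<phi> t + C * s * (1 + \<phi> t)"
    and growth_power: "\<And>p. \<exists>C\<ge>0. \<forall>t\<ge>0. t ^ p \<le> C * (1 + \<phi> t)"
    and growth_cont: "continuous_on {0..} \<phi>"
    and growth_borel [measurable]: "\<phi> \<in> borel_measurable borel"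

lemma (in growth) growth_nonneg: "0 \<le> t \<Longrightarrow> 0 \<le> \<phi> t"
  using growth_mono[of 0 t] growth_0 by simp

section \<open>The exponential functions: convexity, power bounds, increments\<close>

context
  fixes \<gamma> \<tau> :: real
  assumes \<gamma>: "0 \<le> \<gamma>" "\<gamma> \<le> 1" and \<tau>: "8 \<le> \<tau>"
begin

private definition L :: "real \<Rightarrow> real" where "L t = ln (t + \<tau>)"
private definition g :: "real \<Rightarrow> real" where "g t = t * L t powr (- \<gamma>)"
private definition g' :: "real \<Rightarrow> real" where "g' t = L t powr (- \<gamma> - 1) * (L t - \<gamma> * (t / (t + \<tau>)))"

text \<open>The origin of the threshold 8: the square of \<open>exp 1\<close> is at most
  \<open>2.8^2 = 7.84\<close>.\<close>

private lemma L_ge: "0 \<le> t \<Longrightarrow> 2 \<le> L t"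
proof -
  assume t: "0 \<le> t"
  have "exp (1::real) \<le> 2.8" using e_less_272 by simp
  then have "exp (1::real) ^ 2 \<le> 2.8 ^ 2" by (intro power_mono) auto
  then have "exp (2::real) \<le> 8" by (simp add: power2_eq_square exp_add[symmetric])
  also have "\<dots> \<le> t + \<tau>" using t \<tau> by simp
  finally have "exp 2 \<le> t + \<tau>" .
  then show ?thesis unfolding L_def using t \<tau> by (subst ln_ge_iff) auto
qed

private lemma exp_gt_eq: "exp_gt \<gamma> \<tau> t = exp (g t)"
  by (simp add: exp_gt_def g_def L_def powr_minus divide_inverse)

private lemma tilde_eq: "exp_tilde \<gamma> \<tau> t = exp (g t) - 1 - t * L 0 powr (- \<gamma>)"
  by (simp add: exp_tilde_def exp_gt_eq L_def powr_minus divide_inverse)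

private lemma L_DERIV: "0 \<le> t \<Longrightarrow> (L has_real_derivative 1 / (t + \<tau>)) (at t)"
  unfolding L_def using \<tau> by (auto intro!: derivative_eq_intros)

private lemma Lp_DERIV: "0 \<le> t \<Longrightarrow> ((\<lambda>t. L t powr a) has_real_derivative a * L t powr (a - 1) * (1 / (t + \<tau>))) (at t)"
proof -
  assume t: "0 \<le> t"
  have "L t > 0" using L_ge[OF t] by simp
  from DERIV_powr[OF L_DERIV[OF t] this DERIV_const[of a]] 
  have "((\<lambda>t. L t powr a) has_real_derivative L t powr a * (0 * ln (L t) + 1 / (t + \<tau>) * a / L t)) (at t)" .
  then show ?thesis by (rule DERIV_cong) (use \<open>L t > 0\<close> in \<open>simp add: powr_diff mult_ac\<close>)
qed

private lemma g_DERIV: "0 \<le> t \<Longrightarrow> (g has_real_derivative g' t) (at t)"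
proof -
  assume t: "0 \<le> t"
  have L0: "L t > 0" using L_ge[OF t] by simp
  have "((\<lambda>t. t * L t powr (- \<gamma>)) has_real_derivative 1 * L t powr (- \<gamma>) + (- \<gamma> * L t powr (- \<gamma> - 1) * (1 / (t + \<tau>))) * t) (at t)"
    by (intro DERIV_mult DERIV_ident Lp_DERIV t)
  moreover have "L t powr (- \<gamma>) = L t powr (- \<gamma> - 1) * L t"
    using L0 by (simp add: powr_diff)
  then have "1 * L t powr (- \<gamma>) + (- \<gamma> * L t powr (- \<gamma> - 1) * (1 / (t + \<tau>))) * t = g' t"
    by (simp add: g'_def right_diff_distrib)
  ultimately show ?thesis by (simp add: g_def[abs_def])
qed

private lemma tilde_DERIV:
  "0 \<le> t \<Longrightarrow> (exp_tilde \<gamma> \<tau> has_real_derivative g' t * exp (g t) - L 0 powr (- \<gamma>)) (at t)"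
proof -
  assume t: "0 \<le> t"
  have "((\<lambda>t. exp (g t) - 1 - t * L 0 powr (- \<gamma>)) has_real_derivative exp (g t) * g' t - 0 - 1 * L 0 powr (- \<gamma>)) (at t)"
    by (intro DERIV_diff DERIV_cmult_right DERIV_const DERIV_ident DERIV_fun_exp g_DERIV t)
  moreover have "exp_tilde \<gamma> \<tau> = (\<lambda>t. exp (g t) - 1 - t * L 0 powr (- \<gamma>))" by (simp add: fun_eq_iff tilde_eq)
  ultimately show ?thesis by (simp add: mult.commute)
qed

text \<open>Convexity of \<open>exp_tilde\<close>, whose derivative differs from this one by a
  constant. The sign of \<open>g'' + g'^2\<close> decides: the logarithm can make \<open>g''\<close>
  negative, but \<open>g'^2\<close> outweighs it for \<open>\<tau> \<ge> 8\<close>.\<close>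

private lemma tilde'_mono:
  assumes "0 \<le> s" "s \<le> t" shows "g' s * exp (g s) \<le> g' t * exp (g t)"
proof (rule DERIV_nonneg_imp_nondecreasing[OF assms(2)])
  fix x assume "s \<le> x" "x \<le> t"
  then have x: "0 \<le> x" using assms(1) by simp
  define X where "X = x + \<tau>"
  have X: "X \<ge> 8" using x \<tau> by (simp add: X_def)
  have L2: "L x \<ge> 2" by (rule L_ge[OF x])
  define P where "P = L x powr (- \<gamma> - 1)"
  define Q where "Q = L x - \<gamma> * (x / X)"
  have P0: "P > 0" using L2 by (simp add: P_def)
  have "\<gamma> * (x / X) \<le> 1 * 1" using \<gamma> x X \<tau> by (intro mult_mono) (auto simp: X_def)
  then have Q1: "Q \<ge> L x - 1" by (simp add: Q_def)
  have dq: "((\<lambda>t. L t - \<gamma> * (t / (t + \<tau>))) has_real_derivative 1 / X - \<gamma> * (\<tau> / X\<^sup>2)) (at x)"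
  proof -
    have "((\<lambda>t. t / (t + \<tau>)) has_real_derivative (1 * (x + \<tau>) - x * 1) / ((x + \<tau>) * (x + \<tau>))) (at x)"
      using X by (intro DERIV_divide) (auto intro!: derivative_eq_intros simp: X_def)
    then have "((\<lambda>t. t / (t + \<tau>)) has_real_derivative \<tau> / X\<^sup>2) (at x)"
      by (simp add: X_def power2_eq_square)
    then show ?thesis using L_DERIV[OF x] unfolding X_def by (intro DERIV_diff DERIV_cmult)
  qed
  have dp: "((\<lambda>t. L t powr (- \<gamma> - 1)) has_real_derivative (- \<gamma> - 1) * (P / L x) * (1 / X)) (at x)"
  proof -
    have "L x powr (- \<gamma> - 1 - 1) = P / L x"
      unfolding P_def using L2 powr_diff[of "L x" "- \<gamma> - 1" 1] by simp
    then show ?thesis by (intro DERIV_cong[OF Lp_DERIV[OF x]]) (simp only: X_def)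
  qed
  have dg': "(g' has_real_derivative ((- \<gamma> - 1) * (P / L x) * (1 / X)) * Q + (1 / X - \<gamma> * (\<tau> / X\<^sup>2)) * P) (at x)"
    using DERIV_mult[OF dp dq] by (simp add: g'_def[abs_def] P_def Q_def X_def)
  have d1: "((\<lambda>t. g' t * exp (g t)) has_real_derivative
     (((- \<gamma> - 1) * (P / L x) * (1 / X)) * Q + (1 / X - \<gamma> * (\<tau> / X\<^sup>2)) * P) * exp (g x) + (exp (g x) * g' x) * g' x) (at x)"
    by (intro DERIV_mult dg' DERIV_fun_exp g_DERIV x)
  have e1: "g' x = P * Q" by (simp add: g'_def P_def Q_def X_def)
  \<comment> \<open>With \<open>g' = P Q\<close> the negative part of \<open>g''\<close> is
    \<open>(\<gamma> + 1) P Q / (L x X)\<close>. From \<open>P \<ge> 1 / (L x)^2\<close> and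
    \<open>2 L x \<le> Q X\<close> it is at most \<open>(P Q)^2\<close>; the other part of
    \<open>g''\<close> is nonnegative.\<close>
  have "0 \<le> (((- \<gamma> - 1) * (P / L x) * (1 / X)) * Q + (1 / X - \<gamma> * (\<tau> / X\<^sup>2)) * P) + (P * Q) * (P * Q)"
  proof -
    have Q0: "Q > 0" using Q1 L2 by linarith
    have "\<gamma> * \<tau> \<le> 1 * X" using \<gamma> \<tau> x by (intro mult_mono) (auto simp: X_def)
    then have "\<gamma> * (\<tau> / X\<^sup>2) \<le> X / X\<^sup>2" using X by (simp add: divide_right_mono)
    then have 1: "0 \<le> (1 / X - \<gamma> * (\<tau> / X\<^sup>2)) * P" using P0 X by (simp add: power2_eq_square)
    have "L x powr (- \<gamma> - 1) \<ge> L x powr (- 2)" using L2 \<gamma> by (intro powr_mono) auto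
    then have P2: "P \<ge> 1 / (L x)\<^sup>2" using L2 by (simp add: P_def powr_minus_divide powr_numeral)
    have "2 * L x \<le> (L x - 1) * X"
    proof -
      have "2 * L x \<le> (L x - 1) * 8" using L2 by simp
      also have "\<dots> \<le> (L x - 1) * X" using X L2 by (intro mult_left_mono) auto
      finally show ?thesis .
    qed
    also have "\<dots> \<le> Q * X" using Q1 X by (intro mult_right_mono) auto
    finally have QX: "2 * L x \<le> Q * X" .
    have "(\<gamma> + 1) / (L x * X) \<le> 2 / (L x * X)" using \<gamma> L2 X by (intro divide_right_mono) auto
    also have "\<dots> = (2 * L x) / ((L x)\<^sup>2 * X)" using L2 by (simp add: power2_eq_square)
    also have "\<dots> \<le> (Q * X) / ((L x)\<^sup>2 * X)" using QX X L2 by (intro divide_right_mono) auto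
    also have "\<dots> = (1 / (L x)\<^sup>2) * Q" using X by simp
    also have "\<dots> \<le> P * Q" using P2 Q0 by (intro mult_right_mono) auto
    finally have "(\<gamma> + 1) / (L x * X) * (P * Q) \<le> P * Q * (P * Q)"
      using P0 Q0 by (intro mult_right_mono) auto
    moreover have "((- \<gamma> - 1) * (P / L x) * (1 / X)) * Q = - ((\<gamma> + 1) / (L x * X) * (P * Q))"
      using L2 X by (simp add: field_simps)
    ultimately show ?thesis using 1 by linarith
  qed
  then have "0 \<le> exp (g x) * ((((- \<gamma> - 1) * (P / L x) * (1 / X)) * Q + (1 / X - \<gamma> * (\<tau> / X\<^sup>2)) * P) + (P * Q) * (P * Q))"
    by (intro mult_nonneg_nonneg) auto
  then have "0 \<le> (((- \<gamma> - 1) * (P / L x) * (1 / X)) * Q + (1 / X - \<gamma> * (\<tau> / X\<^sup>2)) * P) * exp (g x) + (exp (g x) * (P * Q)) * (P * Q)"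
    by (simp only: distrib_left mult.assoc mult.commute[of _ "exp (g x)"])
  then show "\<exists>y. ((\<lambda>t. g' t * exp (g t)) has_real_derivative y) (at x) \<and> 0 \<le> y"
    using d1[unfolded e1] by blast
qed

private lemma tilde_0: "exp_tilde \<gamma> \<tau> 0 = 0"
  by (simp add: tilde_eq g_def)

text \<open>The terms subtracted in \<open>exp_tilde\<close> form the tangent of
  \<open>exp_gt\<close> at 0. Its derivative therefore starts at 0 and, being monotone, stays
  nonnegative.\<close>

private lemma tilde'_0: "g' 0 * exp (g 0) = L 0 powr (- \<gamma>)"
  using L_ge[of 0] by (simp add: g'_def g_def powr_diff)

private lemma tilde_mono:
  assumes "0 \<le> s" "s \<le> t" shows "exp_tilde \<gamma> \<tau> s \<le> exp_tilde \<gamma> \<tau> t"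
proof (rule DERIV_nonneg_imp_nondecreasing[OF assms(2)])
  fix x assume "s \<le> x" "x \<le> t"
  then have x: "0 \<le> x" using assms(1) by simp
  show "\<exists>y. (exp_tilde \<gamma> \<tau> has_real_derivative y) (at x) \<and> 0 \<le> y"
  proof (intro exI conjI)
    show "(exp_tilde \<gamma> \<tau> has_real_derivative g' x * exp (g x) - L 0 powr (- \<gamma>)) (at x)" by (rule tilde_DERIV[OF x])
    show "0 \<le> g' x * exp (g x) - L 0 powr (- \<gamma>)" using tilde'_mono[of 0 x] x tilde'_0 by simp
  qed
qed

text \<open>The tangent at \<open>a\<close> supports the graph by the mean value theorem and the
  monotonicity of the derivative.\<close>

private lemma tilde_support:
  assumes a: "0 \<le> a" and t: "0 \<le> t"
  shows "exp_tilde \<gamma> \<tau> a + (g' a * exp (g a) - L 0 powr (- \<gamma>)) * (t - a) \<le> exp_tilde \<gamma> \<tau> t"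
proof -
  consider "a < t" | "t < a" | "t = a" by linarith
  then show ?thesis
  proof cases
    case 1
    have "\<exists>z. a < z \<and> z < t \<and> exp_tilde \<gamma> \<tau> t - exp_tilde \<gamma> \<tau> a = (t - a) * (g' z * exp (g z) - L 0 powr (- \<gamma>))"
      using a by (intro MVT2[OF 1] tilde_DERIV) auto
    then obtain z where z: "a < z" "exp_tilde \<gamma> \<tau> t - exp_tilde \<gamma> \<tau> a = (t - a) * (g' z * exp (g z) - L 0 powr (- \<gamma>))" by blast
    have "(t - a) * (g' a * exp (g a) - L 0 powr (- \<gamma>)) \<le> (t - a) * (g' z * exp (g z) - L 0 powr (- \<gamma>))"
      using 1 tilde'_mono[OF a, of z] z(1) by (intro mult_left_mono) auto
    then show ?thesis using z(2) by (simp add: mult.commute)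
  next
    case 2
    have "\<exists>z. t < z \<and> z < a \<and> exp_tilde \<gamma> \<tau> a - exp_tilde \<gamma> \<tau> t = (a - t) * (g' z * exp (g z) - L 0 powr (- \<gamma>))"
      using t by (intro MVT2[OF 2] tilde_DERIV) auto
    then obtain z where z: "t < z" "z < a" "exp_tilde \<gamma> \<tau> a - exp_tilde \<gamma> \<tau> t = (a - t) * (g' z * exp (g z) - L 0 powr (- \<gamma>))" by blast
    have "(a - t) * (g' z * exp (g z) - L 0 powr (- \<gamma>)) \<le> (a - t) * (g' a * exp (g a) - L 0 powr (- \<gamma>))"
      using 2 tilde'_mono[of z a] z t by (intro mult_left_mono) auto
    moreover have "(g' a * exp (g a) - L 0 powr (- \<gamma>)) * (t - a) = - ((a - t) * (g' a * exp (g a) - L 0 powr (- \<gamma>)))"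
      by (simp add: algebra_simps)
    ultimately show ?thesis using z(3) by linarith
  qed auto
qed

text \<open>Up to \<open>\<tau>\<close> the constant \<open>\<tau> ^ p\<close> suffices. Beyond it
  \<open>\<gamma> \<le> 1\<close> gives \<open>g t \<ge> t / L t\<close>, and the logarithm is at
  most \<open>4 * sqrt t\<close>, so \<open>g t \<ge> sqrt t / 4\<close>.\<close>

private lemma power_le_exp_g: "\<exists>A\<ge>0. \<forall>t\<ge>0. t ^ p \<le> A * exp (g t)"
proof (intro exI conjI allI impI)
  show "0 \<le> \<tau> ^ p + 16 ^ p * fact (2 * p)" using \<tau> by simp
  fix t :: real assume t: "0 \<le> t"
  have L2: "L t \<ge> 2" by (rule L_ge[OF t])
  have g0: "g t \<ge> 0" using t by (simp add: g_def)
  show "t ^ p \<le> (\<tau> ^ p + 16 ^ p * fact (2 * p)) * exp (g t)"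
  proof (cases "t \<le> \<tau>")
    case True
    have "t ^ p \<le> \<tau> ^ p * 1" using t True by (simp add: power_mono)
    also have "\<dots> \<le> (\<tau> ^ p + 16 ^ p * fact (2 * p)) * exp (g t)"
      using \<tau> g0 by (intro mult_mono) auto
    finally show ?thesis .
  next
    case False
    have "L t powr (- 1) \<le> L t powr (- \<gamma>)" using L2 \<gamma> by (intro powr_mono) auto
    then have "t * L t powr (- 1) \<le> g t" using t unfolding g_def by (rule mult_left_mono)
    then have "t * (1 / L t) \<le> g t" using L2 by (simp add: powr_minus_divide)
    moreover have "L t \<le> 4 * sqrt t"
    proof -
      have "L t = 2 * ln (sqrt (t + \<tau>))" using t \<tau> by (simp add: L_def ln_sqrt)
      also have "\<dots> \<le> 2 * sqrt (t + \<tau>)" using ln_bound[of "sqrt (t + \<tau>)"] t \<tau> by simp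
      also have "sqrt (t + \<tau>) \<le> sqrt (4 * t)" using False \<tau> by simp
      also have "sqrt (4 * t) = 2 * sqrt t" by (simp add: real_sqrt_mult)
      finally show ?thesis by simp
    qed
    then have "t * (1 / (4 * sqrt t)) \<le> t * (1 / L t)"
      using t L2 False \<tau> by (intro mult_left_mono divide_left_mono) auto
    moreover have "t * (1 / (4 * sqrt t)) = sqrt t / 4" using t by (simp add: real_div_sqrt)
    ultimately have gs: "sqrt t / 4 \<le> g t" by simp
    \<comment> \<open>The term of order \<open>2 * p\<close> of the exponential series contains
      exactly \<open>t ^ p\<close>, hence the constant \<open>16 ^ p * fact (2 * p)\<close>.\<close>
    have "(sqrt t / 4) ^ (2 * p) / fact (2 * p) \<le> exp (sqrt t / 4)"
      using t by (intro power_div_fact_le_exp) auto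
    also have "\<dots> \<le> exp (g t)" using gs by simp
    finally have 1: "(sqrt t / 4) ^ (2 * p) / fact (2 * p) \<le> exp (g t)" .
    have "(sqrt t / 4) ^ (2 * p) = t ^ p / 16 ^ p"
      using t by (simp add: power_mult power_divide)
    then have "t ^ p / (16 ^ p * fact (2 * p)) \<le> exp (g t)" using 1 by simp
    then have "t ^ p \<le> (16 ^ p * fact (2 * p)) * exp (g t)"
      by (simp add: pos_divide_le_eq mult.commute)
    also have "\<dots> \<le> (\<tau> ^ p + 16 ^ p * fact (2 * p)) * exp (g t)"
      using \<tau> by (intro mult_right_mono) auto
    finally show ?thesis .
  qed
qed

private lemma g_mono_le:
  assumes "0 \<le> s" "s \<le> t" shows "g s \<le> g t"
proof (rule DERIV_nonneg_imp_nondecreasing[OF assms(2)])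
  fix x assume "s \<le> x" "x \<le> t"
  then have x: "0 \<le> x" using assms(1) by simp
  have "\<gamma> * (x / (x + \<tau>)) \<le> 1 * 1" using \<gamma> x \<tau> by (intro mult_mono) auto
  then have "0 \<le> g' x" unfolding g'_def using L_ge[OF x] by (intro mult_nonneg_nonneg) auto
  then show "\<exists>y. (g has_real_derivative y) (at x) \<and> 0 \<le> y" using g_DERIV[OF x] by blast
qed

text \<open>The subtracted linear term must not consume the exponential: beyond \<open>T\<close> it
  takes at most one half, and up to \<open>T\<close> the monotone \<open>g\<close> is bounded by
  \<open>g T\<close>.\<close>

private lemma exp_g_le_tilde: "\<exists>C\<ge>0. \<forall>t\<ge>0. exp (g t) \<le> C * (1 + exp_tilde \<gamma> \<tau> t)"
proof -
  obtain A where A: "A \<ge> 0" "\<And>t. t \<ge> 0 \<Longrightarrow> t ^ 2 \<le> A * exp (g t)" using power_le_exp_g[of 2] by blast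
  define c where "c = L 0 powr (- \<gamma>)"
  have c: "c \<ge> 0" by (simp add: c_def)
  \<comment> \<open>For \<open>t \<ge> 2 * c * A\<close> the bound
    \<open>t ^ 2 \<le> A * exp (g t)\<close> turns into
    \<open>2 * c * t \<le> exp (g t)\<close>.\<close>
  define T where "T = 2 * c * A + 1"
  have T: "T \<ge> 1" using A(1) c by (simp add: T_def)
  have "exp (g t) \<le> (exp (g T) + 2) * (1 + exp_tilde \<gamma> \<tau> t)" if t: "t \<ge> 0" for t
  proof -
    have p0: "exp_tilde \<gamma> \<tau> t \<ge> 0" using tilde_mono[of 0 t] t tilde_0 by simp
    show ?thesis
    proof (cases "t \<le> T")
      case True
      have "exp (g t) * 1 \<le> (exp (g T) + 2) * (1 + exp_tilde \<gamma> \<tau> t)"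
        using g_mono_le[OF t True] p0 by (intro mult_mono) (auto intro: order_trans)
      then show ?thesis by simp
    next
      case False
      have "T < t" using False by simp
      then have t1: "t > 0" "2 * c * A \<le> t" using T by (linarith, simp add: T_def)
      have "2 * c * t * t \<le> 2 * c * (A * exp (g t))"
        using A(2)[OF t] c by (simp add: power2_eq_square mult_left_mono mult.assoc)
      also have "\<dots> \<le> t * exp (g t)" using t1(2) by (simp add: mult_right_mono mult.assoc[symmetric])
      finally have "t * (2 * c * t) \<le> t * exp (g t)" by (simp add: mult_ac)
      then have "2 * c * t \<le> exp (g t)" using t1(1) by simp
      then have "exp (g t) \<le> 2 * (1 + exp_tilde \<gamma> \<tau> t)" by (simp add: tilde_eq c_def mult.commute)
      also have "\<dots> \<le> (exp (g T) + 2) * (1 + exp_tilde \<gamma> \<tau> t)" using p0 by (intro mult_right_mono) auto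
      finally show ?thesis .
    qed
  qed
  then show ?thesis by (intro exI[of _ "exp (g T) + 2"]) auto
qed

text \<open>The factor \<open>L t powr (- \<gamma>)\<close> is nonincreasing and at most 1, because
  \<open>L t \<ge> 2\<close>. So an increment \<open>s\<close> multiplies \<open>exp (g t)\<close>
  by at most \<open>exp s\<close>, which is the source of \<open>growth_increment\<close>.\<close>

private lemma g_add: "0 \<le> t \<Longrightarrow> 0 \<le> s \<Longrightarrow> g (t + s) \<le> g t + s"
proof -
  assume t: "0 \<le> t" and s: "0 \<le> s"
  have LL: "L t \<le> L (t + s)" unfolding L_def using t s \<tau> by simp
  have L2: "L t \<ge> 2" "L (t + s) \<ge> 2" using L_ge t s by auto
  have 1: "L (t + s) powr (- \<gamma>) \<le> L t powr (- \<gamma>)"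
    using LL L2 \<gamma> by (intro powr_mono2') auto
  have "L (t + s) powr (- \<gamma>) \<le> L (t + s) powr 0" using L2 \<gamma> by (intro powr_mono) auto
  then have 2: "L (t + s) powr (- \<gamma>) \<le> 1" using L2 by simp
  have "t * L (t + s) powr (- \<gamma>) \<le> t * L t powr (- \<gamma>)" using 1 t by (rule mult_left_mono)
  moreover have "s * L (t + s) powr (- \<gamma>) \<le> s * 1" using 2 s by (rule mult_left_mono)
  ultimately show ?thesis by (simp add: g_def distrib_right)
qed

lemma growth_exp_tilde: "growth (exp_tilde \<gamma> \<tau>)"
proof
  show "exp_tilde \<gamma> \<tau> 0 = 0" by (rule tilde_0)
  show "exp_tilde \<gamma> \<tau> s \<le> exp_tilde \<gamma> \<tau> t" if "0 \<le> s" "s \<le> t" for s t using tilde_mono that .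
  show "\<exists>m. \<forall>t\<ge>0. exp_tilde \<gamma> \<tau> a + m * (t - a) \<le> exp_tilde \<gamma> \<tau> t" if "0 \<le> a" for a
    using tilde_support[OF that] by blast
  obtain C where C: "C \<ge> 0" "\<And>t. t \<ge> 0 \<Longrightarrow> exp (g t) \<le> C * (1 + exp_tilde \<gamma> \<tau> t)" using exp_g_le_tilde by blast
  have "exp_tilde \<gamma> \<tau> (t + s) \<le> exp_tilde \<gamma> \<tau> t + 2 * C * s * (1 + exp_tilde \<gamma> \<tau> t)"
    if t: "0 \<le> t" and s: "s \<in> {0..1}" for t s
  proof -
    have s01: "0 \<le> s" "s \<le> 1" using s by auto
    have "exp (g (t + s)) \<le> exp (g t) * exp s" using g_add[OF t s01(1)] by (simp add: exp_add[symmetric])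
    also have "\<dots> \<le> exp (g t) * (1 + 2 * s)"
    proof (rule mult_left_mono)
      have "exp s \<le> 1 + s + s\<^sup>2" using s01 by (rule exp_bound)
      moreover have "s\<^sup>2 \<le> s" using s01 by (simp add: power2_eq_square mult_left_le)
      ultimately show "exp s \<le> 1 + 2 * s" by linarith
    qed auto
    finally have "exp (g (t + s)) \<le> exp (g t) + 2 * s * exp (g t)" by (simp add: algebra_simps)
    also have "\<dots> \<le> exp (g t) + 2 * s * (C * (1 + exp_tilde \<gamma> \<tau> t))"
      using C(2)[OF t] s01 by (intro add_left_mono mult_left_mono) auto
    finally have "exp (g (t + s)) \<le> exp (g t) + 2 * C * s * (1 + exp_tilde \<gamma> \<tau> t)" by (simp add: mult_ac)
    moreover have "exp_tilde \<gamma> \<tau> (t + s) \<le> exp (g (t + s)) - 1 - t * L 0 powr (- \<gamma>)"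
      using s01 by (simp add: tilde_eq mult_right_mono)
    moreover have "exp_tilde \<gamma> \<tau> t = exp (g t) - 1 - t * L 0 powr (- \<gamma>)" by (rule tilde_eq)
    ultimately show ?thesis by linarith
  qed
  then show "\<exists>C\<ge>0. \<forall>t\<ge>0. \<forall>s\<in>{0..1}. exp_tilde \<gamma> \<tau> (t + s) \<le> exp_tilde \<gamma> \<tau> t + C * s * (1 + exp_tilde \<gamma> \<tau> t)"
    using C(1) by (intro exI[of _ "2 * C"]) auto
  show "\<exists>C\<ge>0. \<forall>t\<ge>0. t ^ p \<le> C * (1 + exp_tilde \<gamma> \<tau> t)" for p
  proof -
    obtain A where A: "A \<ge> 0" "\<And>t. t \<ge> 0 \<Longrightarrow> t ^ p \<le> A * exp (g t)" using power_le_exp_g[of p] by blast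
    have "t ^ p \<le> (A * C) * (1 + exp_tilde \<gamma> \<tau> t)" if "t \<ge> 0" for t
      using order_trans[OF A(2)[OF that] mult_left_mono[OF C(2)[OF that] A(1)]] by (simp add: mult.assoc)
    then show ?thesis using A(1) C(1) by (intro exI[of _ "A * C"]) auto
  qed
  show "continuous_on {0..} (exp_tilde \<gamma> \<tau>)"
    by (rule DERIV_continuous_on[OF has_field_derivative_at_within[OF tilde_DERIV]]) simp
  show "exp_tilde \<gamma> \<tau> \<in> borel_measurable borel"
    unfolding exp_tilde_def[abs_def] exp_gt_def by measurable
qed

end

section \<open>Cutoff functions\<close>

text \<open>\<open>F j\<close> carries \<open>\<zeta> j\<close>, \<open>K j\<close> is the compact
  set from which the mollification over \<open>F j\<close> draws its data, and \<open>m j\<close>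
  bounds the scales for which the kernel stays inside \<open>K j\<close>. The sum is required to be
  1 on a whole cube because its derivatives have to vanish too.\<close>

locale cutoffs =
  fixes n :: nat and \<Omega> :: "(nat \<Rightarrow> real) set" and \<zeta> :: "nat \<Rightarrow> (nat \<Rightarrow> real) \<Rightarrow> real"
    and F K :: "nat \<Rightarrow> (nat \<Rightarrow> real) set" and m :: "nat \<Rightarrow> real"
  assumes open_\<Omega>: "openin (Rn_top n) \<Omega>"
    and zeta_test: "\<And>j. \<zeta> j \<in> test_fun n \<Omega>"
    and zeta_nonneg: "\<And>j x. x \<in> Rn n \<Longrightarrow> 0 \<le> \<zeta> j x"
    and zeta_le_1: "\<And>j x. x \<in> Rn n \<Longrightarrow> \<zeta> j x \<le> 1"
    and zeta_outside: "\<And>j x. x \<in> Rn n \<Longrightarrow> x \<notin> F j \<Longrightarrow> \<zeta> j x = 0"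
    and compact_F: "\<And>j. compactin (Rn_top n) (F j)"
    and compact_K: "\<And>j. compactin (Rn_top n) (K j)"
    and K_subset: "\<And>j. K j \<subseteq> \<Omega>"
    and m_pos: "\<And>j. 0 < m j"
    and F_margin: "\<And>j x. x \<in> F j \<Longrightarrow> ccube n x (m j) \<subseteq> K j"
    and zeta_local: "\<And>x. x \<in> \<Omega> \<Longrightarrow> \<exists>r>0. \<exists>J. cube n x r \<subseteq> \<Omega> \<and>
       (\<forall>y\<in>cube n x r. (\<forall>j>J. \<zeta> j y = 0) \<and> (\<Sum>j\<le>J. \<zeta> j y) = 1)"

text \<open>Smoothed indicators \<open>\<theta> j\<close> of an exhaustion by cores, each equal to 1
  wherever its predecessor is nonzero. The cutoffs are consecutive differences, so partial sums
  telescope to \<open>\<theta> J\<close>; near any point all late \<open>\<theta> j\<close> are 1,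
  which gives local finiteness.\<close>

lemma cutoffs_exist:
  assumes \<Omega>: "openin (Rn_top n) \<Omega>"
  obtains \<zeta> F K m where "cutoffs n \<Omega> \<zeta> F K m"
proof -
  define a :: "nat \<Rightarrow> real" where "a j = (1/4) ^ j" for j
  have a: "a j > 0" "a j \<le> 1" "a (Suc j) = a j / 4" for j
    by (auto simp: a_def power_le_one)
  define W where "W j = indicat_real (core n \<Omega> (a j) (real j))" for j
  have W: "integrable (lebn n) (W j)" for j unfolding W_def
    using compactin_Rn_sets[OF compactin_core] compactin_Rn_finite[OF compactin_core] by (intro integrable_real_indicator)
  have mk: "mollifier n (a j / 4) (eta n (a j / 4))" for j using a(1) by (intro mollifier_eta) simp
  define \<theta> where "\<theta> j = conv n (eta n (a j / 4)) (W j)" for j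
  \<comment> \<open>\<open>F j\<close> is the core enlarged by the kernel radius, so
    \<open>\<theta> j\<close> vanishes off it; \<open>K j\<close> adds the same margin
    \<open>a j / 4\<close> a second time, and this margin serves as \<open>m j\<close>.\<close>
  define F where "F j = core n \<Omega> (a j - a j / 4) (real j + a j / 4)" for j
  define K where "K j = core n \<Omega> (a j / 2) (real j + a j / 2)" for j
  have \<theta>0: "\<theta> j x = 0" if x: "x \<in> Rn n" "x \<notin> F j" for j x
    unfolding \<theta>_def
  proof (rule conv_mollifier_eq[OF mk])
    fix y assume y: "y \<in> ccube n x (a j / 4)"
    have "y \<notin> core n \<Omega> (a j) (real j)"
    proof
      assume "y \<in> core n \<Omega> (a j) (real j)"
      moreover have "x \<in> ccube n y (a j / 4)" using y x(1) by (simp add: mem_ccube abs_minus_commute)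
      ultimately have "x \<in> F j" unfolding F_def by (rule ccube_core)
      then show False using x(2) by simp
    qed
    then show "W j y = 0" by (simp add: W_def)
  qed
  have \<theta>1: "\<theta> j x = 1" if x: "x \<in> core n \<Omega> (a j + a j / 4) (real j - a j / 4)" for j x
    unfolding \<theta>_def
  proof (rule conv_mollifier_eq[OF mk])
    fix y assume y: "y \<in> ccube n x (a j / 4)"
    have "y \<in> core n \<Omega> (a j) (real j)" using ccube_core[OF x y] by simp
    then show "W j y = 1" by (simp add: W_def)
  qed
  have \<theta>ge: "0 \<le> \<theta> j x" for j x
    unfolding \<theta>_def by (rule conv_nonneg[OF mk]) (simp add: W_def)
  have \<theta>le: "\<theta> j x \<le> 1" for j x
  proof -
    have "\<theta> j x \<le> (\<integral>y. eta n (a j / 4) (vsub n x y) \<partial>lebn n)"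
      unfolding \<theta>_def conv_def
      using mollifier_nonneg[OF mk[of j]] a(1)[of j]
      by (intro integral_mono conv_integrable[OF mollifier_test_fun[OF mk] W] mollifier_integrable[OF mk])
        (auto simp: W_def indicator_def)
    then show ?thesis using mollifier_integral[OF mk] by simp
  qed
  \<comment> \<open>The ratio 1/4 is ample here: \<open>a (Suc j) * 5/4 = a j * 5/16\<close> is
    below \<open>a j * 3/4\<close>. Hence \<open>\<theta>\<close> increases with \<open>j\<close>
    and the differences are nonnegative.\<close>
  have F1: "\<theta> (Suc j) x = 1" if "x \<in> F j" for j x
  proof -
    have "a (Suc j) + a (Suc j) / 4 \<le> a j - a j / 4" "real j + a j / 4 \<le> real (Suc j) - a (Suc j) / 4"
      using a(1,2)[of j] a(3)[of j] by auto
    then show ?thesis using \<theta>1[OF subsetD[OF core_mono that[unfolded F_def]]] by simp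
  qed
  have FF: "F j \<subseteq> F (Suc j)" for j
    unfolding F_def using a(1,2)[of j] a(3)[of j] by (intro core_mono) auto
  have \<theta>C: "\<theta> j \<in> C_inf n (Rn n)" for j
    unfolding \<theta>_def by (rule conv_C_inf[OF mollifier_test_fun[OF mk] W])
  define \<zeta> where "\<zeta> j x = \<theta> j x - (if j = 0 then 0 else \<theta> (j - 1) x)" for j x
  have \<zeta>0: "\<zeta> 0 = \<theta> 0" and \<zeta>S: "\<zeta> (Suc j) = (\<lambda>x. \<theta> (Suc j) x + (- 1) * \<theta> j x)" for j
    by (auto simp: \<zeta>_def fun_eq_iff)
  have \<zeta>C: "\<zeta> j \<in> C_inf n (Rn n)" for j
  proof (cases j)
    case (Suc k)
    have "(\<lambda>x. \<theta> (Suc k) x + (- 1) * \<theta> k x) \<in> C_inf n (Rn n)"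
      by (rule C_inf_add[OF openin_Rn_UNIV \<theta>C C_inf_mult[OF openin_Rn_UNIV C_inf_const[OF openin_Rn_UNIV] \<theta>C]])
    then show ?thesis unfolding Suc \<zeta>S .
  qed (simp add: \<zeta>0 \<theta>C)
  have \<zeta>out: "\<zeta> j x = 0" if "x \<in> Rn n" "x \<notin> F j" for j x
  proof (cases j)
    case (Suc k)
    then have "x \<notin> F k" using that(2) FF[of k] by auto
    then show ?thesis using that \<theta>0 Suc by (simp add: \<zeta>S)
  qed (use that \<theta>0 in \<open>simp add: \<zeta>0\<close>)
  have mono: "\<theta> j x \<le> \<theta> (Suc j) x" if "x \<in> Rn n" for j x
    using F1[of x j] \<theta>le[of j x] \<theta>0[OF that, of j] \<theta>ge[of "Suc j" x] by (cases "x \<in> F j") auto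
  have sum: "(\<Sum>j\<le>J. \<zeta> j x) = \<theta> J x" for J x
    by (induction J) (auto simp: \<zeta>0 \<zeta>S)
  have Fsub: "F j \<subseteq> \<Omega>" and Ksub: "K j \<subseteq> \<Omega>" for j
    unfolding F_def K_def using a(1)[of j] by (auto intro!: core_subset)
  show ?thesis
  proof (rule that, unfold_locales)
    show "openin (Rn_top n) \<Omega>" by (rule \<Omega>)
    show "compactin (Rn_top n) (F j)" "compactin (Rn_top n) (K j)" for j
      unfolding F_def K_def by (rule compactin_core)+
    show "\<zeta> j \<in> test_fun n \<Omega>" for j
      unfolding test_fun_iff
    proof (intro conjI exI[of _ "F j"] \<zeta>C Fsub)
      show "compactin (Rn_top n) (F j)" unfolding F_def by (rule compactin_core)
      show "\<forall>x\<in>Rn n - F j. \<zeta> j x = 0" using \<zeta>out by simp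
    qed
    show "0 \<le> \<zeta> j x" if "x \<in> Rn n" for j x
    proof (cases j)
      case (Suc k)
      then show ?thesis using mono[OF that, of k] by (simp add: \<zeta>S)
    qed (simp add: \<zeta>0 \<theta>ge)
    show "\<zeta> j x \<le> 1" for j x
      using \<theta>le[of j x] \<theta>ge[of "j - 1" x] by (cases "j = 0") (simp_all add: \<zeta>_def)
    show "\<zeta> j x = 0" if "x \<in> Rn n" "x \<notin> F j" for j x by (rule \<zeta>out[OF that])
    show "K j \<subseteq> \<Omega>" for j by (rule Ksub)
    show "0 < a j / 4" for j using a(1) by simp
    show "ccube n x (a j / 4) \<subseteq> K j" if "x \<in> F j" for j x
    proof
      fix y assume "y \<in> ccube n x (a j / 4)"
      from ccube_core[OF that[unfolded F_def] this] show "y \<in> K j" by (simp add: K_def add.commute)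
    qed
    fix x assume x: "x \<in> \<Omega>"
    obtain r R where r: "r > 0" "cube n x r \<subseteq> core n \<Omega> r R" by (rule core_exhaust[OF \<Omega> x])
    have "a \<longlonglongrightarrow> 0" unfolding a_def by (intro LIMSEQ_realpow_zero) auto
    then have "eventually (\<lambda>j. a j < r / 2) sequentially" using order_tendstoD(2)[of a 0 _ "r/2"] r by simp
    then obtain J1 where J1: "\<And>j. j \<ge> J1 \<Longrightarrow> a j < r / 2" by (auto simp: eventually_sequentially)
    obtain J2 :: nat where J2: "R + 1 < real J2" using reals_Archimedean2[of "R + 1"] by auto
    have one: "\<theta> j y = 1" if "j \<ge> J1 + J2" "y \<in> cube n x r" for j y
    proof -
      have "a j + a j / 4 \<le> r" using J1[of j] a(1)[of j] that by simp
      moreover have "R \<le> real j - a j / 4" using J2 that(1) a(2)[of j] by simp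
      ultimately show ?thesis using \<theta>1[OF subsetD[OF core_mono subsetD[OF r(2) that(2)]]] by simp
    qed
    show "\<exists>r>0. \<exists>J. cube n x r \<subseteq> \<Omega> \<and> (\<forall>y\<in>cube n x r. (\<forall>j>J. \<zeta> j y = 0) \<and> (\<Sum>j\<le>J. \<zeta> j y) = 1)"
    proof (intro exI[of _ r] exI[of _ "J1 + J2"] conjI ballI allI impI)
      show "cube n x r \<subseteq> \<Omega>" by (rule order_trans[OF r(2) core_subset[OF r(1)]])
      fix y assume y: "y \<in> cube n x r"
      show "(\<Sum>j\<le>J1 + J2. \<zeta> j y) = 1" using one[of "J1 + J2" y] y by (simp add: sum)
      fix j assume "J1 + J2 < j"
      then obtain k where "j = Suc k" "J1 + J2 \<le> k" by (cases j) auto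
      then show "\<zeta> j y = 0" using one[of k y] one[of "Suc k" y] y by (simp add: \<zeta>S)
    qed (rule r(1))
  qed
qed

text \<open>The norm of a vector-valued average is at most the average of the norms.\<close>

lemma L2_set_conv_le:
  assumes k: "mollifier n s k" and I: "finite I" and f: "\<And>i. i \<in> I \<Longrightarrow> integrable (lebn n) (f i)"
    and N: "integrable (lebn n) N" and le: "\<And>y. y \<in> Rn n \<Longrightarrow> L2_set (\<lambda>i. f i y) I \<le> N y"
  shows "L2_set (\<lambda>i. conv n k (f i) x) I \<le> conv n k N x"
proof -
  define c where "c i = conv n k (f i) x" for i
  define S where "S = L2_set c I"
  note tk = mollifier_test_fun[OF k]
  have S0: "S \<ge> 0" unfolding S_def by (rule L2_set_nonneg)
  have N0: "0 \<le> conv n k N x"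
    by (rule conv_nonneg[OF k]) (use le L2_set_nonneg order_trans in blast)
  \<comment> \<open>The averaged vector \<open>c\<close> is paired with itself; Cauchy-Schwarz under
    the integral leaves one factor \<open>S\<close>, which is then cancelled.\<close>
  have "S * S = (\<Sum>i\<in>I. c i * c i)"
    unfolding S_def L2_set_def by (simp add: sum_nonneg power2_eq_square)
  also have "\<dots> = (\<Sum>i\<in>I. \<integral>y. c i * (k (vsub n x y) * f i y) \<partial>lebn n)"
    by (simp add: c_def conv_def)
  also have "\<dots> = (\<integral>y. (\<Sum>i\<in>I. c i * (k (vsub n x y) * f i y)) \<partial>lebn n)"
    by (intro Bochner_Integration.integral_sum[symmetric] integrable_mult_right conv_integrable[OF tk] f)
  also have "\<dots> \<le> (\<integral>y. S * (k (vsub n x y) * N y) \<partial>lebn n)"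
  proof (rule integral_mono)
    show "integrable (lebn n) (\<lambda>y. \<Sum>i\<in>I. c i * (k (vsub n x y) * f i y))"
      by (intro Bochner_Integration.integrable_sum integrable_mult_right conv_integrable[OF tk] f)
    show "integrable (lebn n) (\<lambda>y. S * (k (vsub n x y) * N y))"
      by (intro integrable_mult_right conv_integrable[OF tk] N)
    fix y assume y: "y \<in> space (lebn n)"
    have k0: "0 \<le> k (vsub n x y)" by (rule mollifier_nonneg[OF k])
    have "(\<Sum>i\<in>I. c i * f i y) \<le> (\<Sum>i\<in>I. \<bar>c i\<bar> * \<bar>f i y\<bar>)"
      by (intro sum_mono) (metis abs_ge_self abs_mult)
    also have "\<dots> \<le> S * L2_set (\<lambda>i. f i y) I" unfolding S_def by (rule L2_set_mult_ineq)
    also have "\<dots> \<le> S * N y" using le[of y] y S0 by (intro mult_left_mono) auto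
    finally have "k (vsub n x y) * (\<Sum>i\<in>I. c i * f i y) \<le> k (vsub n x y) * (S * N y)" using k0 by (rule mult_left_mono)
    then show "(\<Sum>i\<in>I. c i * (k (vsub n x y) * f i y)) \<le> S * (k (vsub n x y) * N y)"
      by (simp add: sum_distrib_left mult_ac)
  qed
  also have "\<dots> = S * conv n k N x" by (simp add: conv_def)
  finally have "S * S \<le> S * conv n k N x" .
  then have "S \<le> conv n k N x" using S0 N0 by (cases "S = 0") (auto simp: mult_le_cancel_left)
  then show ?thesis by (simp add: S_def c_def[abs_def])
qed

lemma L2_set_sum_le:
  "finite J \<Longrightarrow> (\<And>j. j \<in> J \<Longrightarrow> 0 \<le> z j) \<Longrightarrow>
     L2_set (\<lambda>i. \<Sum>j\<in>J. z j * c j i) I \<le> (\<Sum>j\<in>J. z j * L2_set (c j) I)"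
proof (induction J rule: finite_induct)
  case (insert j J)
  have "L2_set (\<lambda>i. z j * c j i + (\<Sum>j\<in>J. z j * c j i)) I
     \<le> L2_set (\<lambda>i. z j * c j i) I + L2_set (\<lambda>i. \<Sum>j\<in>J. z j * c j i) I"
    by (rule L2_set_triangle_ineq)
  also have "L2_set (\<lambda>i. z j * c j i) I = z j * L2_set (c j) I"
    using insert.prems by (simp add: L2_set_right_distrib)
  finally show ?case using insert by simp
qed (simp add: L2_set_def)

lemma L2_set_diff_le:
  assumes "finite I" "\<And>i. i \<in> I \<Longrightarrow> \<bar>f i - g i\<bar> \<le> d"
  shows "L2_set f I \<le> L2_set g I + real (card I) * d"
proof -
  have "L2_set f I = L2_set (\<lambda>i. g i + (f i - g i)) I" by simp
  also have "\<dots> \<le> L2_set g I + L2_set (\<lambda>i. f i - g i) I" by (rule L2_set_triangle_ineq)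
  also have "L2_set (\<lambda>i. f i - g i) I \<le> (\<Sum>i\<in>I. \<bar>f i - g i\<bar>)" by (rule L2_set_le_sum_abs)
  also have "\<dots> \<le> (\<Sum>i\<in>I. d)" using assms(2) by (rule sum_mono)
  finally show ?thesis by simp
qed

section \<open>Glued mollifications\<close>

locale approx = growth \<phi> + cutoffs n \<Omega> \<zeta> F K m
  for \<phi> :: "real \<Rightarrow> real" and n :: nat and \<Omega> \<zeta> F K m +
  fixes U :: "(nat \<Rightarrow> real) \<Rightarrow> real" and G :: "nat \<Rightarrow> (nat \<Rightarrow> real) \<Rightarrow> real"
  assumes n1: "n \<ge> 1"
    and U_loc: "loc_int n \<Omega> U" and G_loc: "\<And>i. i < n \<Longrightarrow> loc_int n \<Omega> (G i)"
    and G_weak: "\<And>i. i < n \<Longrightarrow> weak_partial n \<Omega> i U (G i)"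
    and U_class: "(\<integral>\<^sup>+x. indicator \<Omega> x * ennreal (\<phi> \<bar>U x\<bar>) \<partial>lebn n) < \<infinity>"
    and G_class: "\<And>i. i < n \<Longrightarrow> (\<integral>\<^sup>+x. indicator \<Omega> x * ennreal (\<phi> \<bar>G i x\<bar>) \<partial>lebn n) < \<infinity>"
begin

definition N :: "nat set \<Rightarrow> (nat \<Rightarrow> real) \<Rightarrow> real" where
  "N I x = L2_set (\<lambda>i. G i x) I"

text \<open>Singletons are always good, the full index set only if the modular of the gradient norm
  is finite. Treating all such \<open>I\<close> alike yields membership of the partial derivatives
  and convergence of the energy from one argument.\<close>

definition good :: "nat set \<Rightarrow> bool" where
  "good I \<longleftrightarrow> I \<subseteq> {..<n} \<and> (\<integral>\<^sup>+x. indicator \<Omega> x * ennreal (\<phi> (N I x)) \<partial>lebn n) < \<infinity>"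

lemma \<Omega>_sub: "\<Omega> \<subseteq> Rn n"
  using openin_subset[OF open_\<Omega>] by simp

lemma \<Omega>_sets [measurable]: "\<Omega> \<in> sets (lebn n)"
  by (rule openin_imp_sets_lebn[OF open_\<Omega>])

lemma F_sets [measurable]: "F j \<in> sets (lebn n)" and K_sets [measurable]: "K j \<in> sets (lebn n)"
  using compactin_Rn_sets compact_F compact_K by auto

lemma F_sub_K: "x \<in> F j \<Longrightarrow> x \<in> K j"
  using F_margin[of x j] m_pos[of j] compactin_subset_topspace[OF compact_F[of j]]
  by (auto simp: subset_iff mem_ccube less_imp_le)

lemma U_borel [measurable]: "U \<in> borel_measurable (lebn n)"
  using U_loc by (simp add: loc_int_def)

lemma G_borel [measurable]: "i < n \<Longrightarrow> G i \<in> borel_measurable (lebn n)"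
  using G_loc by (simp add: loc_int_def)

lemma N_nonneg: "0 \<le> N I x"
  by (simp add: N_def L2_set_nonneg)

lemma N_borel: "I \<subseteq> {..<n} \<Longrightarrow> N I \<in> borel_measurable (lebn n)"
proof -
  assume "I \<subseteq> {..<n}"
  then have [measurable]: "(\<lambda>x. \<Sum>i\<in>I. (G i x)\<^sup>2) \<in> borel_measurable (lebn n)"
    by (intro borel_measurable_sum borel_measurable_power G_borel) auto
  show ?thesis unfolding N_def[abs_def] L2_set_def by measurable
qed

lemma U_int: "integrable (lebn n) (cut (K j) U)"
  by (rule loc_intD[OF U_loc compact_K K_subset])

lemma G_int: "i < n \<Longrightarrow> integrable (lebn n) (cut (K j) (G i))"
  by (rule loc_intD[OF G_loc compact_K K_subset])

lemma N_int:
  assumes I: "I \<subseteq> {..<n}" shows "integrable (lebn n) (cut (K j) (N I))"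
proof (rule Bochner_Integration.integrable_bound)
  show "integrable (lebn n) (\<lambda>x. \<Sum>i\<in>I. \<bar>cut (K j) (G i) x\<bar>)"
    using I by (intro Bochner_Integration.integrable_sum integrable_abs G_int) auto
  show "cut (K j) (N I) \<in> borel_measurable (lebn n)" using N_borel[OF I] by measurable
  show "AE x in lebn n. norm (cut (K j) (N I) x) \<le> norm (\<Sum>i\<in>I. \<bar>cut (K j) (G i) x\<bar>)"
  proof (rule AE_I2)
    fix x
    have "N I x \<le> (\<Sum>i\<in>I. \<bar>G i x\<bar>)" unfolding N_def by (rule L2_set_le_sum_abs)
    then show "norm (cut (K j) (N I) x) \<le> norm (\<Sum>i\<in>I. \<bar>cut (K j) (G i) x\<bar>)"
      using N_nonneg[of I x] by (cases "x \<in> K j") (auto simp: sum_nonneg)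
  qed
qed

lemma phi_int:
  assumes I: "good I" shows "integrable (lebn n) (cut (K j) (\<lambda>x. \<phi> (N I x)))"
proof -
  have [measurable]: "N I \<in> borel_measurable (lebn n)" using I by (intro N_borel) (simp add: good_def)
  have "(\<integral>\<^sup>+x. ennreal (norm (cut (K j) (\<lambda>x. \<phi> (N I x)) x)) \<partial>lebn n)
     \<le> (\<integral>\<^sup>+x. indicator \<Omega> x * ennreal (\<phi> (N I x)) \<partial>lebn n)"
    using K_subset[of j] growth_nonneg[OF N_nonneg] by (intro nn_integral_mono) (auto simp: indicator_def)
  then show ?thesis using I unfolding good_def integrable_iff_bounded by (auto intro: le_less_trans)
qed

text \<open>The integrability that Morrey's estimate asks for. The constant in
  \<open>1 + \<phi> t\<close> is harmless because \<open>K j\<close> has finite measure.\<close>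

lemma G_power_int:
  assumes i: "i < n" shows "integrable (lebn n) (\<lambda>x. \<bar>cut (K j) (G i) x\<bar> ^ (2 * n))"
proof -
  obtain C where C: "C \<ge> 0" "\<And>t. t \<ge> 0 \<Longrightarrow> t ^ (2 * n) \<le> C * (1 + \<phi> t)" using growth_power by blast
  have "good {i}" using G_class[OF i] i by (simp add: good_def N_def L2_set_def)
  from phi_int[OF this, of j] have p: "integrable (lebn n) (cut (K j) (\<lambda>x. \<phi> \<bar>G i x\<bar>))" by (simp add: N_def L2_set_def)
  show ?thesis
  proof (rule Bochner_Integration.integrable_bound)
    show "integrable (lebn n) (\<lambda>x. C * (indicat_real (K j) x + cut (K j) (\<lambda>x. \<phi> \<bar>G i x\<bar>) x))"
      using K_sets compactin_Rn_finite[OF compact_K[of j]]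
      by (intro integrable_mult_right Bochner_Integration.integrable_add p integrable_real_indicator)
    show "(\<lambda>x. \<bar>cut (K j) (G i) x\<bar> ^ (2 * n)) \<in> borel_measurable (lebn n)" using i by measurable
    show "AE x in lebn n. norm (\<bar>cut (K j) (G i) x\<bar> ^ (2 * n)) \<le> norm (C * (indicat_real (K j) x + cut (K j) (\<lambda>x. \<phi> \<bar>G i x\<bar>) x))"
    proof (rule AE_I2)
      fix x
      show "norm (\<bar>cut (K j) (G i) x\<bar> ^ (2 * n)) \<le> norm (C * (indicat_real (K j) x + cut (K j) (\<lambda>x. \<phi> \<bar>G i x\<bar>) x))"
        using C(2)[of "\<bar>G i x\<bar>"] n1 by (cases "x \<in> K j") (auto simp: zero_power)
    qed
  qed
qed

lemma eventually_L1:
  assumes W: "integrable (lebn n) W" and e: "e > 0"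
  shows "\<forall>\<^sub>F s in at_right 0. (\<integral>\<^sup>+x. ennreal \<bar>conv n (eta n s) W x - W x\<bar> \<partial>lebn n) \<le> ennreal e"
proof -
  obtain d where d: "d > 0" "\<And>s k. mollifier n s k \<Longrightarrow> s < d \<Longrightarrow> (\<integral>\<^sup>+x. ennreal \<bar>conv n k W x - W x\<bar> \<partial>lebn n) \<le> ennreal e"
    by (rule mollify_L1[OF W e]) blast
  show ?thesis
    by (rule eventually_at_rightI[OF _ d(1)]) (use d(2) mollifier_eta in auto)
qed

text \<open>At points of \<open>F j\<close> the cube of radius \<open>m j\<close> lies in
  \<open>K j\<close>, so the rate \<open>sqrt s\<close> of \<open>morrey\<close> is uniform over
  \<open>F j\<close>.\<close>

lemma eventually_morrey:
  assumes d: "d > 0"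
  shows "\<forall>\<^sub>F s in at_right 0. AE x in lebn n. x \<in> F j \<longrightarrow> \<bar>conv n (eta n s) (cut (K j) U) x - U x\<bar> \<le> d"
proof -
  obtain C where C: "C \<ge> 0" "\<And>s. 0 < s \<Longrightarrow> s < m j \<Longrightarrow>
    AE x in lebn n. ccube n x (m j) \<subseteq> K j \<longrightarrow> \<bar>conv n (eta n s) (cut (K j) U) x - U x\<bar> \<le> C * sqrt s"
    using morrey[OF n1 G_weak K_subset[of j] U_int G_int G_power_int, where ?s0.0 = "m j"] by blast
  have "((\<lambda>s. C * sqrt s) \<longlongrightarrow> C * sqrt 0) (at_right 0)" by (intro tendsto_intros)
  then have "\<forall>\<^sub>F s in at_right 0. C * sqrt s < d" using d by (intro order_tendstoD(2)) auto
  moreover have "\<forall>\<^sub>F s in at_right 0. s \<in> {0<..<m j}" by (rule eventually_at_right_real[OF m_pos])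
  ultimately show ?thesis
  proof eventually_elim
    case (elim s)
    have "AE x in lebn n. ccube n x (m j) \<subseteq> K j \<longrightarrow> \<bar>conv n (eta n s) (cut (K j) U) x - U x\<bar> \<le> C * sqrt s"
      using C(2)[of s] elim(2) by auto
    then show ?case
    proof eventually_elim
      case (elim x)
      then show ?case using F_margin[of x j] \<open>C * sqrt s < d\<close> by auto
    qed
  qed
qed

text \<open>Each requirement holds for all small scales, and there are only finitely many:
  \<open>n\<close> components and at most \<open>2^n\<close> good index sets.\<close>

lemma scale_exists:
  assumes d: "d > 0" and e: "e > 0"
  shows "\<exists>s. 0 < s \<and> s < m j \<and>
     (AE x in lebn n. x \<in> F j \<longrightarrow> \<bar>conv n (eta n s) (cut (K j) U) x - U x\<bar> \<le> d) \<and>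
     (\<forall>i<n. (\<integral>\<^sup>+x. ennreal \<bar>conv n (eta n s) (cut (K j) (G i)) x - cut (K j) (G i) x\<bar> \<partial>lebn n) \<le> ennreal e) \<and>
     (\<forall>I. good I \<longrightarrow> (\<integral>\<^sup>+x. ennreal \<bar>conv n (eta n s) (cut (K j) (\<lambda>x. \<phi> (N I x))) x - cut (K j) (\<lambda>x. \<phi> (N I x)) x\<bar> \<partial>lebn n) \<le> ennreal e)"
proof -
  have 1: "\<forall>\<^sub>F s in at_right 0. s \<in> {0<..<m j}" by (rule eventually_at_right_real[OF m_pos])
  have 2: "\<forall>\<^sub>F s in at_right 0. \<forall>i\<in>{..<n}. (\<integral>\<^sup>+x. ennreal \<bar>conv n (eta n s) (cut (K j) (G i)) x - cut (K j) (G i) x\<bar> \<partial>lebn n) \<le> ennreal e"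
    by (intro eventually_ball_finite ballI eventually_L1 G_int e) auto
  have "finite {I. good I}" by (rule finite_subset[of _ "Pow {..<n}"]) (auto simp: good_def)
  then have 3: "\<forall>\<^sub>F s in at_right 0. \<forall>I\<in>{I. good I}. (\<integral>\<^sup>+x. ennreal \<bar>conv n (eta n s) (cut (K j) (\<lambda>x. \<phi> (N I x))) x - cut (K j) (\<lambda>x. \<phi> (N I x)) x\<bar> \<partial>lebn n) \<le> ennreal e"
    by (intro eventually_ball_finite ballI eventually_L1 phi_int e) auto
  from eventually_conj[OF 1 eventually_conj[OF eventually_morrey[OF d, of j] eventually_conj[OF 2 3]]]
  show ?thesis
    by (rule eventually_happens'[OF trivial_limit_at_right_real, THEN exE]) auto
qed

definition scale :: "(nat \<Rightarrow> real) \<Rightarrow> (nat \<Rightarrow> real) \<Rightarrow> (nat \<Rightarrow> real) \<Rightarrow> bool" where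
  "scale d e s \<longleftrightarrow> (\<forall>j. 0 < s j \<and> s j < m j \<and>
     (AE x in lebn n. x \<in> F j \<longrightarrow> \<bar>conv n (eta n (s j)) (cut (K j) U) x - U x\<bar> \<le> d j) \<and>
     (\<forall>i<n. (\<integral>\<^sup>+x. ennreal \<bar>conv n (eta n (s j)) (cut (K j) (G i)) x - cut (K j) (G i) x\<bar> \<partial>lebn n) \<le> ennreal (e j)) \<and>
     (\<forall>I. good I \<longrightarrow> (\<integral>\<^sup>+x. ennreal \<bar>conv n (eta n (s j)) (cut (K j) (\<lambda>x. \<phi> (N I x))) x - cut (K j) (\<lambda>x. \<phi> (N I x)) x\<bar> \<partial>lebn n) \<le> ennreal (e j)))"

lemma scale_exists_seq:
  assumes "\<And>j. d j > 0" "\<And>j. e j > 0"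
  obtains s where "scale d e s"
proof -
  have "\<exists>s. \<forall>j. 0 < s j \<and> s j < m j \<and>
     (AE x in lebn n. x \<in> F j \<longrightarrow> \<bar>conv n (eta n (s j)) (cut (K j) U) x - U x\<bar> \<le> d j) \<and>
     (\<forall>i<n. (\<integral>\<^sup>+x. ennreal \<bar>conv n (eta n (s j)) (cut (K j) (G i)) x - cut (K j) (G i) x\<bar> \<partial>lebn n) \<le> ennreal (e j)) \<and>
     (\<forall>I. good I \<longrightarrow> (\<integral>\<^sup>+x. ennreal \<bar>conv n (eta n (s j)) (cut (K j) (\<lambda>x. \<phi> (N I x))) x - cut (K j) (\<lambda>x. \<phi> (N I x)) x\<bar> \<partial>lebn n) \<le> ennreal (e j))"
    by (rule choice) (intro allI scale_exists assms)
  then show ?thesis using that unfolding scale_def by blast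
qed

section \<open>Gluing the mollifications with the cutoffs\<close>

definition glue :: "(nat \<Rightarrow> real) \<Rightarrow> (nat \<Rightarrow> (nat \<Rightarrow> real) \<Rightarrow> real) \<Rightarrow> (nat \<Rightarrow> real) \<Rightarrow> real" where
  "glue s W x = (\<Sum>j. \<zeta> j x * conv n (eta n (s j)) (cut (K j) (W j)) x)"

lemma zeta_sums:
  assumes "\<And>j. j > J \<Longrightarrow> \<zeta> j x = 0"
  shows "(\<lambda>j. \<zeta> j x * c j) sums (\<Sum>j\<le>J. \<zeta> j x * c j)"
  by (rule sums_finite) (use assms in \<open>auto simp: not_le\<close>)

lemma glue_eq:
  assumes "\<And>j. j > J \<Longrightarrow> \<zeta> j x = 0"
  shows "glue s W x = (\<Sum>j\<le>J. \<zeta> j x * conv n (eta n (s j)) (cut (K j) (W j)) x)"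
  unfolding glue_def using zeta_sums[OF assms] by (simp add: sums_iff)

lemma zeta_partial_outside:
  assumes "x \<in> Rn n" "x \<notin> F j" "i < n" shows "partial i (\<zeta> j) x = 0"
proof -
  have op: "openin (Rn_top n) (Rn n - F j)" using compactin_Rn_closedin[OF compact_F] by (simp add: closedin_def)
  have "partial i (\<zeta> j) x = partial i (\<lambda>_. 0) x"
    by (rule partial_cong[OF op]) (use assms zeta_outside in auto)
  then show ?thesis using has_partial_imp_partial[OF has_partial_const[of i 0 x]] by simp
qed

lemma zeta_localE:
  assumes "x \<in> \<Omega>"
  obtains r J where "r > 0" "cube n x r \<subseteq> \<Omega>" "\<forall>y\<in>cube n x r. \<forall>j>J. \<zeta> j y = 0"
    "\<forall>y\<in>cube n x r. (\<Sum>j\<le>J. \<zeta> j y) = 1"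
  using zeta_local[OF assms] by blast

lemma zeta_C_inf: "\<zeta> j \<in> C_inf n (Rn n)"
  using zeta_test[of j] by (simp add: test_fun_iff)

lemma zeta_borel [measurable]: "\<zeta> j \<in> borel_measurable (lebn n)"
  by (rule test_fun_borel[OF zeta_test])

context
  fixes d e s assumes s: "scale d e s"
begin

lemma s_pos: "0 < s j" and s_less: "s j < m j"
  using s unfolding scale_def by auto

lemma mol: "mollifier n (s j) (eta n (s j))"
  by (rule mollifier_eta[OF s_pos])

lemma ccube_s: "x \<in> F j \<Longrightarrow> ccube n x (s j) \<subseteq> K j"
  using F_margin[of x j] ccube_mono[of "s j" "m j" n x] s_less[of j] by auto

lemma glue_C_inf: "glue s (\<lambda>_. U) \<in> C_inf n \<Omega>"
proof (rule C_inf_local[OF open_\<Omega>])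
  fix x assume x: "x \<in> \<Omega>"
  obtain r J where r: "r > 0" "cube n x r \<subseteq> \<Omega>" and z: "\<And>y j. y \<in> cube n x r \<Longrightarrow> j > J \<Longrightarrow> \<zeta> j y = 0"
    using zeta_local[OF x] by blast
  have xR: "x \<in> Rn n" using x \<Omega>_sub by auto
  note op = openin_cube[OF xR, of r]
  have sub: "cube n x r \<subseteq> Rn n" by (simp add: cube_def)
  have "(\<lambda>y. \<Sum>j\<in>{..J}. \<zeta> j y * conv n (eta n (s j)) (cut (K j) U) y) \<in> C_inf n (cube n x r)"
    by (intro C_inf_sum C_inf_mult op C_inf_mono[OF zeta_C_inf sub]
        C_inf_mono[OF conv_C_inf[OF mollifier_test_fun[OF mol] U_int] sub]) auto
  then have "glue s (\<lambda>_. U) \<in> C_inf n (cube n x r)"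
    by (rule C_inf_cong[OF op]) (use z in \<open>simp add: glue_eq[of J]\<close>)
  then show "\<exists>V. openin (Rn_top n) V \<and> x \<in> V \<and> glue s (\<lambda>_. U) \<in> C_inf n V"
    using op cube_self[OF xR r(1)] by blast
qed

text \<open>The gradient of the glued function is a convex combination of mollified gradients, up to terms with
  \<open>D \<zeta>\<^sub>j\<close>, from which \<open>U x\<close> may be subtracted because \<open>\<Sum>\<^sub>j D \<zeta>\<^sub>j = 0\<close>.\<close>

lemma glue_partial:
  assumes x: "x \<in> \<Omega>" and i: "i < n"
    and r: "r > 0" "cube n x r \<subseteq> \<Omega>"
    and z: "\<And>y j. y \<in> cube n x r \<Longrightarrow> j > J \<Longrightarrow> \<zeta> j y = 0"
    and one: "\<And>y. y \<in> cube n x r \<Longrightarrow> (\<Sum>j\<le>J. \<zeta> j y) = 1"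
  shows "partial i (glue s (\<lambda>_. U)) x = glue s (\<lambda>_. G i) x +
    (\<Sum>j\<le>J. partial i (\<zeta> j) x * (conv n (eta n (s j)) (cut (K j) U) x - U x))"
proof -
  have xR: "x \<in> Rn n" using x \<Omega>_sub by auto
  note op = openin_cube[OF xR, of r]
  have xc: "x \<in> cube n x r" by (rule cube_self[OF xR r(1)])
  let ?v = "\<lambda>j. conv n (eta n (s j)) (cut (K j) U)"
  have zp: "has_partial i (\<zeta> j) (partial i (\<zeta> j) x) x" for j
    by (rule C_inf_has_partial[OF zeta_C_inf i xR])
  have "partial i (glue s (\<lambda>_. U)) x = partial i (\<lambda>y. \<Sum>j\<in>{..J}. \<zeta> j y * ?v j y) x"
    by (rule partial_cong[OF op xc i]) (use z in \<open>simp add: glue_eq[of J]\<close>)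
  also have "\<dots> = (\<Sum>j\<in>{..J}. partial i (\<zeta> j) x * ?v j x + \<zeta> j x * conv n (partial i (eta n (s j))) (cut (K j) U) x)"
    by (intro has_partial_imp_partial has_partial_sum has_partial_mult zp
        conv_has_partial[OF mollifier_test_fun[OF mol] U_int i xR])
  also have "\<dots> = (\<Sum>j\<le>J. partial i (\<zeta> j) x * ?v j x + \<zeta> j x * conv n (eta n (s j)) (cut (K j) (G i)) x)"
  proof (rule sum.cong[OF refl])
    fix j
    show "partial i (\<zeta> j) x * ?v j x + \<zeta> j x * conv n (partial i (eta n (s j))) (cut (K j) U) x
      = partial i (\<zeta> j) x * ?v j x + \<zeta> j x * conv n (eta n (s j)) (cut (K j) (G i)) x"
    \<comment> \<open>The derivative may be moved onto \<open>U\<close> only when the kernel at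
      \<open>x\<close> stays inside \<open>K j\<close>, which is guaranteed on \<open>F j\<close>;
      elsewhere the factor \<open>\<zeta> j x\<close> is 0.\<close>
    proof (cases "x \<in> F j")
      case True
      then show ?thesis
        by (simp add: conv_weak_partial[OF G_weak[OF i] K_subset mollifier_kernel[OF mol] ccube_s i])
    qed (simp add: zeta_outside[OF xR])
  qed
  also have "\<dots> = glue s (\<lambda>_. G i) x + (\<Sum>j\<le>J. partial i (\<zeta> j) x * ?v j x)"
    by (simp add: glue_eq[OF z[OF xc]] sum.distrib)
  also have "(\<Sum>j\<le>J. partial i (\<zeta> j) x * ?v j x) = (\<Sum>j\<le>J. partial i (\<zeta> j) x * (?v j x - U x))"
  proof -
    have "(\<Sum>j\<in>{..J}. partial i (\<zeta> j) x) = partial i (\<lambda>y. \<Sum>j\<in>{..J}. \<zeta> j y) x"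
      by (intro has_partial_imp_partial[symmetric] has_partial_sum zp)
    also have "\<dots> = partial i (\<lambda>_. 1) x" by (rule partial_cong[OF op xc i]) (use one in simp)
    also have "\<dots> = 0" using has_partial_imp_partial[OF has_partial_const[of i 1 x]] by simp
    finally have "(\<Sum>j\<le>J. partial i (\<zeta> j) x * U x) = 0" by (simp add: sum_distrib_right[symmetric])
    then show ?thesis by (simp add: right_diff_distrib sum_subtractf)
  qed
  finally show ?thesis .
qed

text \<open>Two averages are nested, over \<open>j\<close> with weights \<open>\<zeta> j x\<close>
  and over \<open>y\<close> with the mollifiers. A single supporting line of \<open>\<phi>\<close>,
  taken at the averaged norm \<open>a\<close>, handles both.\<close>

lemma jensen:
  assumes x: "x \<in> \<Omega>" and I: "good I" and z: "\<And>j. j > J \<Longrightarrow> \<zeta> j x = 0" and one: "(\<Sum>j\<le>J. \<zeta> j x) = 1"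
  shows "\<phi> (L2_set (\<lambda>i. glue s (\<lambda>_. G i) x) I) \<le> glue s (\<lambda>_. \<lambda>x. \<phi> (N I x)) x"
proof -
  have xR: "x \<in> Rn n" using x \<Omega>_sub by auto
  have I': "I \<subseteq> {..<n}" "finite I" using I finite_subset[of I "{..<n}"] by (auto simp: good_def)
  let ?c = "\<lambda>j W. conv n (eta n (s j)) (cut (K j) W) x"
  define a where "a = (\<Sum>j\<le>J. \<zeta> j x * ?c j (N I))"
  have a0: "0 \<le> a" unfolding a_def
    by (intro sum_nonneg mult_nonneg_nonneg zeta_nonneg[OF xR] conv_nonneg[OF mol]) (simp_all add: N_nonneg)
  have "L2_set (\<lambda>i. glue s (\<lambda>_. G i) x) I = L2_set (\<lambda>i. \<Sum>j\<le>J. \<zeta> j x * ?c j (G i)) I"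
    by (simp add: glue_eq[OF z])
  also have "\<dots> \<le> (\<Sum>j\<le>J. \<zeta> j x * L2_set (\<lambda>i. ?c j (G i)) I)"
    by (rule L2_set_sum_le) (auto simp: zeta_nonneg[OF xR])
  also have "\<dots> \<le> a" unfolding a_def
  proof (intro sum_mono mult_left_mono zeta_nonneg[OF xR])
    fix j
    show "L2_set (\<lambda>i. ?c j (G i)) I \<le> ?c j (N I)"
    proof (rule L2_set_conv_le[OF mol I'(2) _ N_int[OF I'(1)]])
      show "integrable (lebn n) (cut (K j) (G i))" if "i \<in> I" for i using G_int that I'(1) by auto
      show "L2_set (\<lambda>i. cut (K j) (G i) y) I \<le> cut (K j) (N I) y" for y
        by (simp add: N_def L2_set_right_distrib)
    qed
  qed
  finally have "\<phi> (L2_set (\<lambda>i. glue s (\<lambda>_. G i) x) I) \<le> \<phi> a" by (intro growth_mono L2_set_nonneg)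
  also have "\<phi> a \<le> (\<Sum>j\<le>J. \<zeta> j x * ?c j (\<lambda>x. \<phi> (N I x)))"
  proof -
    \<comment> \<open>The line is affine, so averaging it reproduces its value at \<open>a\<close>,
      while averaging the inequality gives the right-hand side.\<close>
    obtain q where q: "\<And>t. t \<ge> 0 \<Longrightarrow> \<phi> a + q * (t - a) \<le> \<phi> t" using growth_support[OF a0] by blast
    have one_int: "integrable (lebn n) (indicat_real (K j))" for j
      using K_sets compactin_Rn_finite[OF compact_K[of j]] by (intro integrable_real_indicator)
    have "(\<phi> a - q * a) * (\<Sum>j\<le>J. \<zeta> j x) + q * a = (\<Sum>j\<le>J. \<zeta> j x * ((\<phi> a - q * a) + q * ?c j (N I)))"
      unfolding a_def by (simp add: distrib_left sum.distrib sum_distrib_left sum_distrib_right mult_ac)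
    also have "\<dots> \<le> (\<Sum>j\<le>J. \<zeta> j x * ?c j (\<lambda>x. \<phi> (N I x)))"
    proof (rule sum_mono)
      fix j
      show "\<zeta> j x * ((\<phi> a - q * a) + q * ?c j (N I)) \<le> \<zeta> j x * ?c j (\<lambda>x. \<phi> (N I x))"
      proof (cases "x \<in> F j")
        case True
        have i1: "integrable (lebn n) (\<lambda>y. eta n (s j) (vsub n x y) * indicat_real (K j) y)"
          and i2: "integrable (lebn n) (\<lambda>y. eta n (s j) (vsub n x y) * cut (K j) (N I) y)"
          by (rule conv_integrable[OF mollifier_test_fun[OF mol]], rule one_int N_int[OF I'(1)])+
        \<comment> \<open>No mass of the kernel lies outside \<open>K j\<close>, so the constant
          part of the supporting line passes through the average unchanged.\<close>
        have c1: "conv n (eta n (s j)) (indicat_real (K j)) x = 1"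
          by (rule conv_mollifier_eq[OF mol]) (use ccube_s[OF True] in auto)
        have "(\<phi> a - q * a) + q * ?c j (N I) = (\<phi> a - q * a) * conv n (eta n (s j)) (indicat_real (K j)) x + q * ?c j (N I)"
          using c1 by simp
        also have "\<dots> = conv n (eta n (s j)) (\<lambda>y. (\<phi> a - q * a) * indicat_real (K j) y + q * cut (K j) (N I) y) x"
        proof -
          have "conv n (eta n (s j)) (\<lambda>y. (\<phi> a - q * a) * indicat_real (K j) y + q * cut (K j) (N I) y) x
            = (\<integral>y. (\<phi> a - q * a) * (eta n (s j) (vsub n x y) * indicat_real (K j) y) + q * (eta n (s j) (vsub n x y) * cut (K j) (N I) y) \<partial>lebn n)"
            unfolding conv_def by (intro Bochner_Integration.integral_cong refl) (simp add: distrib_left mult_ac)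
          also have "\<dots> = (\<phi> a - q * a) * conv n (eta n (s j)) (indicat_real (K j)) x + q * ?c j (N I)"
            unfolding conv_def using i1 i2 by (subst Bochner_Integration.integral_add) auto
          finally show ?thesis by simp
        qed
        also have "\<dots> \<le> ?c j (\<lambda>x. \<phi> (N I x))"
        proof (rule conv_mono[OF mol])
          show "integrable (lebn n) (\<lambda>y. (\<phi> a - q * a) * indicat_real (K j) y + q * cut (K j) (N I) y)"
            by (intro Bochner_Integration.integrable_add integrable_mult_right one_int N_int[OF I'(1)])
          show "integrable (lebn n) (cut (K j) (\<lambda>x. \<phi> (N I x)))" by (rule phi_int[OF I])
          fix y
          show "(\<phi> a - q * a) * indicat_real (K j) y + q * cut (K j) (N I) y \<le> cut (K j) (\<lambda>x. \<phi> (N I x)) y"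
            using q[OF N_nonneg[of I y]] by (cases "y \<in> K j") (auto simp: right_diff_distrib)
        qed
        finally show ?thesis by (rule mult_left_mono[OF _ zeta_nonneg[OF xR]])
      qed (simp add: zeta_outside[OF xR])
    qed
    finally show ?thesis using one by simp
  qed
  also have "\<dots> = glue s (\<lambda>_. \<lambda>x. \<phi> (N I x)) x" by (simp add: glue_eq[OF z])
  finally show ?thesis .
qed

end

end

section \<open>Error budget of a glued approximation\<close>

context approx
begin

lemma glue_borel:
  assumes "\<And>j. integrable (lebn n) (cut (K j) (W j))" "\<And>j. 0 < s j"
  shows "glue s W \<in> borel_measurable (lebn n)"
  unfolding glue_def[abs_def]
proof (rule borel_measurable_suminf)
  fix j
  show "(\<lambda>x. \<zeta> j x * conv n (eta n (s j)) (cut (K j) (W j)) x) \<in> borel_measurable (lebn n)"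
    by (rule borel_measurable_times[OF zeta_borel conv_borel[OF mollifier_test_fun[OF mollifier_eta[OF assms(2)]] assms(1)]])
qed

lemma half_series: "(\<Sum>j. ennreal (q * (1/2) ^ Suc j)) = ennreal q" if "0 \<le> q"
proof -
  have "(\<lambda>j. q * (1/2) ^ Suc j) sums (q * 1)" by (intro sums_mult power_half_series)
  then show ?thesis using that by (intro suminf_ennreal_eq) auto
qed

text \<open>Locally \<open>V\<close> is the sum of \<open>\<zeta> j * V\<close>, and the weights are
  at most 1, so the errors of the pieces simply add up; the geometric budget has sum
  \<open>q\<close>.\<close>

lemma glue_L1:
  assumes q: "0 \<le> q" and s: "\<And>j. 0 < s j" and V: "\<And>j. integrable (lebn n) (cut (K j) V)"
    and le: "\<And>j. (\<integral>\<^sup>+x. ennreal \<bar>conv n (eta n (s j)) (cut (K j) V) x - cut (K j) V x\<bar> \<partial>lebn n) \<le> ennreal (q * (1/2) ^ Suc j)"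
  shows "(\<integral>\<^sup>+x. indicator \<Omega> x * ennreal \<bar>glue s (\<lambda>_. V) x - V x\<bar> \<partial>lebn n) \<le> ennreal q"
proof -
  let ?c = "\<lambda>j x. conv n (eta n (s j)) (cut (K j) V) x - cut (K j) V x"
  have pt: "indicator \<Omega> x * ennreal \<bar>glue s (\<lambda>_. V) x - V x\<bar> \<le> (\<Sum>j. ennreal \<bar>?c j x\<bar>)" for x
  proof (cases "x \<in> \<Omega>")
    case True
    have xR: "x \<in> Rn n" using True \<Omega>_sub by auto
    obtain r J where r: "r > 0" "cube n x r \<subseteq> \<Omega>" and z: "\<forall>y\<in>cube n x r. \<forall>j>J. \<zeta> j y = 0"
        and one: "\<forall>y\<in>cube n x r. (\<Sum>j\<le>J. \<zeta> j y) = 1"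
        by (rule zeta_localE[OF True])
      note z = z[rule_format] and one = one[rule_format]
    note xc = cube_self[OF xR r(1)]
    have "V x = (\<Sum>j\<le>J. \<zeta> j x) * V x" using one[OF xc] by simp
    also have "\<dots> = (\<Sum>j\<le>J. \<zeta> j x * cut (K j) V x)"
      unfolding sum_distrib_right
    proof (rule sum.cong[OF refl])
      fix j
      show "\<zeta> j x * V x = \<zeta> j x * cut (K j) V x"
        using F_sub_K[of x j] zeta_outside[OF xR, of j] by (cases "x \<in> F j") auto
    qed
    finally have eq: "glue s (\<lambda>_. V) x - V x = (\<Sum>j\<le>J. \<zeta> j x * ?c j x)"
      by (simp add: glue_eq[OF z[OF xc]] right_diff_distrib sum_subtractf)
    have "\<bar>glue s (\<lambda>_. V) x - V x\<bar> \<le> (\<Sum>j\<le>J. \<bar>?c j x\<bar>)"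
      unfolding eq
    proof (rule order_trans[OF sum_abs sum_mono])
      fix j
      have "\<bar>\<zeta> j x\<bar> * \<bar>?c j x\<bar> \<le> 1 * \<bar>?c j x\<bar>"
        using zeta_nonneg[OF xR, of j] zeta_le_1[OF xR, of j] by (intro mult_right_mono) auto
      then show "\<bar>\<zeta> j x * ?c j x\<bar> \<le> \<bar>?c j x\<bar>" by (simp add: abs_mult)
    qed
    then have "ennreal \<bar>glue s (\<lambda>_. V) x - V x\<bar> \<le> ennreal (\<Sum>j\<le>J. \<bar>?c j x\<bar>)" by (rule ennreal_leI)
    also have "\<dots> = (\<Sum>j\<le>J. ennreal \<bar>?c j x\<bar>)" by (rule sum_ennreal[symmetric]) simp
    also have "\<dots> \<le> (\<Sum>j. ennreal \<bar>?c j x\<bar>)" by (rule sum_le_suminf) auto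
    finally show ?thesis using True by simp
  qed simp
  have cb: "?c j \<in> borel_measurable (lebn n)" for j
    by (rule borel_measurable_diff[OF conv_borel[OF mollifier_test_fun[OF mollifier_eta[OF s]] V] borel_measurable_integrable[OF V]])
  have "(\<integral>\<^sup>+x. indicator \<Omega> x * ennreal \<bar>glue s (\<lambda>_. V) x - V x\<bar> \<partial>lebn n) \<le> (\<integral>\<^sup>+x. (\<Sum>j. ennreal \<bar>?c j x\<bar>) \<partial>lebn n)"
    by (rule nn_integral_mono[OF pt])
  also have "\<dots> = (\<Sum>j. \<integral>\<^sup>+x. ennreal \<bar>?c j x\<bar> \<partial>lebn n)"
    by (rule nn_integral_suminf) (rule measurable_compose[OF borel_measurable_abs[OF cb] measurable_ennreal])
  also have "\<dots> \<le> (\<Sum>j. ennreal (q * (1/2) ^ Suc j))" by (rule suminf_le[OF le]) auto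
  also have "\<dots> = ennreal q" by (rule half_series[OF q])
  finally show ?thesis .
qed

text \<open>\<open>w\<close> is the smooth function, \<open>D\<close> the averaged part of its
  gradient, and \<open>R I\<close> the Jensen majorant of \<open>\<phi>\<close> of the norm of
  \<open>D\<close>. The error \<open>e\<close> bounds both \<open>w - U\<close> and the part of the
  gradient that comes from the derivatives of the cutoffs; it is small uniformly and in
  integral.\<close>

definition approximant ::
  "real \<Rightarrow> ((nat \<Rightarrow> real) \<Rightarrow> real) \<Rightarrow> (nat \<Rightarrow> (nat \<Rightarrow> real) \<Rightarrow> real) \<Rightarrow> ((nat \<Rightarrow> real) \<Rightarrow> real) \<Rightarrow>
   (nat set \<Rightarrow> (nat \<Rightarrow> real) \<Rightarrow> real) \<Rightarrow> bool" where
  "approximant q w D e R \<longleftrightarrow> w \<in> C_inf n \<Omega> \<and>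
     e \<in> borel_measurable (lebn n) \<and> (\<forall>x. 0 \<le> e x \<and> e x \<le> q) \<and> (\<integral>\<^sup>+x. ennreal (e x) \<partial>lebn n) \<le> ennreal q \<and>
     (AE x in lebn n. x \<in> \<Omega> \<longrightarrow> \<bar>w x - U x\<bar> \<le> e x \<and> (\<forall>i<n. \<bar>partial i w x - D i x\<bar> \<le> e x / real n)) \<and>
     (\<forall>i<n. D i \<in> borel_measurable (lebn n) \<and> (\<integral>\<^sup>+x. indicator \<Omega> x * ennreal \<bar>D i x - G i x\<bar> \<partial>lebn n) \<le> ennreal q) \<and>
     (\<forall>I. good I \<longrightarrow> R I \<in> borel_measurable (lebn n) \<and> (\<forall>x\<in>\<Omega>. \<phi> (L2_set (\<lambda>i. D i x) I) \<le> R I x) \<and>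
        (\<integral>\<^sup>+x. indicator \<Omega> x * ennreal (R I x) \<partial>lebn n) \<le> (\<integral>\<^sup>+x. indicator \<Omega> x * ennreal (\<phi> (N I x)) \<partial>lebn n) + ennreal q)"

lemma zeta_partial_bounded: "\<exists>B. \<forall>j. 1 \<le> B j \<and> (\<forall>i<n. \<forall>x\<in>Rn n. \<bar>partial i (\<zeta> j) x\<bar> \<le> B j)"
proof (rule choice, rule allI)
  fix j
  have "\<exists>b\<ge>0. \<forall>x\<in>Rn n. \<bar>partial i (\<zeta> j) x\<bar> \<le> b" if "i < n" for i
    using test_fun_bounded[OF test_fun_partial[OF zeta_test that, of j]] by metis
  then obtain b where b: "\<And>i. i < n \<Longrightarrow> b i \<ge> 0 \<and> (\<forall>x\<in>Rn n. \<bar>partial i (\<zeta> j) x\<bar> \<le> b i)" by metis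
  show "\<exists>B. 1 \<le> B \<and> (\<forall>i<n. \<forall>x\<in>Rn n. \<bar>partial i (\<zeta> j) x\<bar> \<le> B)"
  proof (intro exI[of _ "1 + (\<Sum>i<n. b i)"] conjI allI impI ballI)
    have "0 \<le> (\<Sum>i<n. b i)" using b by (intro sum_nonneg) auto
    then show "1 \<le> 1 + (\<Sum>i<n. b i)" by simp
    fix i x assume i: "i < n" and x: "x \<in> Rn n"
    have "\<bar>partial i (\<zeta> j) x\<bar> \<le> b i" using b i x by blast
    also have "b i \<le> (\<Sum>i<n. b i)" using b i by (intro member_le_sum) auto
    finally show "\<bar>partial i (\<zeta> j) x\<bar> \<le> 1 + (\<Sum>i<n. b i)" by simp
  qed
qed

lemma approximant_exists:
  assumes q: "0 < q"
  shows "\<exists>w D e R. approximant q w D e R"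
proof -
  obtain B where B: "\<And>j. 1 \<le> B j" "\<And>j i x. i < n \<Longrightarrow> x \<in> Rn n \<Longrightarrow> \<bar>partial i (\<zeta> j) x\<bar> \<le> B j"
    using zeta_partial_bounded by blast
  define vol where "vol j = measure (lebn n) (F j)" for j
  have vol: "emeasure (lebn n) (F j) = ennreal (vol j)" "0 \<le> vol j" for j
    using compactin_Rn_finite[OF compact_F[of j]] by (auto simp: vol_def emeasure_eq_ennreal_measure)
  \<comment> \<open>Dividing by \<open>1 + vol j\<close> keeps \<open>c j\<close> within the
    geometric budget both as a number (\<open>c2\<close>) and after integration over
    \<open>F j\<close> (\<open>c3\<close>).\<close>
  define c where "c j = q * (1/2) ^ Suc j / (1 + vol j)" for j
  have c0: "c j > 0" for j unfolding c_def using q vol(2)[of j] by simp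
  have c1: "c j * (1 + vol j) = q * (1/2) ^ Suc j" for j
  proof -
    have "1 + vol j \<noteq> 0" using vol(2)[of j] by linarith
    then show ?thesis using c_def[of j] nonzero_eq_divide_eq[of "1 + vol j" "c j" "q * (1/2) ^ Suc j"] by blast
  qed
  have c2: "c j \<le> q * (1/2) ^ Suc j" for j
  proof -
    have "c j * 1 \<le> c j * (1 + vol j)" using c0[of j] vol(2)[of j] by (intro mult_left_mono) auto
    then show ?thesis unfolding c1 by simp
  qed
  have c3: "c j * vol j \<le> q * (1/2) ^ Suc j" for j
  proof -
    have "c j * vol j \<le> c j * (1 + vol j)" using c0[of j] by (intro mult_left_mono) auto
    then show ?thesis unfolding c1 .
  qed
  \<comment> \<open>\<open>B j\<close> pays for the derivative of \<open>\<zeta> j\<close>, and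
    \<open>real n\<close> for the passage from the components to the Euclidean norm.\<close>
  define d where "d j = c j / (real n * B j)" for j
  have n0: "real n \<ge> 1" using n1 by simp
  have nB: "real n * B j \<ge> 1" for j using mult_mono[OF n0 B(1)[of j]] by simp
  have d0: "d j > 0" for j unfolding d_def using c0[of j] nB[of j] by (intro divide_pos_pos) auto
  have dc: "d j \<le> c j" for j unfolding d_def using c0[of j] nB[of j] by (simp add: divide_le_eq mult_le_cancel_left1)
  have Bd: "B j * d j = c j / real n" for j unfolding d_def using B(1)[of j] n0 by (simp add: field_simps)
  have e0: "q * (1/2) ^ Suc j > 0" for j using q by simp
  obtain s where s: "scale d (\<lambda>j. q * (1/2) ^ Suc j) s" by (rule scale_exists_seq[of d, OF d0 e0])
  note sp = s_pos[OF s]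
  \<comment> \<open>A sum localized to the sets \<open>F j\<close> instead of a constant, so that
    the error has small integral even when \<open>\<Omega>\<close> has infinite measure.\<close>
  define e where "e x = (\<Sum>j. indicator (F j) x * c j)" for x
  have qs: "(\<lambda>j. q * (1/2) ^ Suc j) sums (q * 1)" by (intro sums_mult power_half_series)
  have esum: "summable (\<lambda>j. indicator (F j) x * c j)" for x
  proof (rule summable_comparison_test'[OF sums_summable[OF qs], of 0])
    fix k
    show "norm (indicator (F k) x * c k) \<le> q * (1/2) ^ Suc k"
      using c0[of k] c2[of k] e0[of k] by (cases "x \<in> F k") auto
  qed
  have e_nonneg: "0 \<le> e x" for x
    unfolding e_def by (intro suminf_nonneg esum) (simp add: less_imp_le[OF c0])
  have e_le: "e x \<le> q" for x
  proof -
    have "e x \<le> (\<Sum>j. q * (1/2) ^ Suc j)"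
      unfolding e_def
    proof (rule suminf_le[OF _ esum sums_summable[OF qs]])
      fix k
      show "indicator (F k) x * c k \<le> q * (1/2) ^ Suc k"
        using c2[of k] e0[of k] by (cases "x \<in> F k") auto
    qed
    then show ?thesis using qs by (simp add: sums_iff)
  qed
  have e_part: "(\<Sum>j\<le>J. indicator (F j) x * c j) \<le> e x" for J x
    unfolding e_def by (intro sum_le_suminf esum) (simp_all add: less_imp_le[OF c0])
  have e_borel: "e \<in> borel_measurable (lebn n)" unfolding e_def[abs_def]
    by (rule borel_measurable_suminf, rule borel_measurable_times[OF borel_measurable_indicator[OF F_sets] borel_measurable_const])
  have e_int: "(\<integral>\<^sup>+x. ennreal (e x) \<partial>lebn n) \<le> ennreal q"
  proof -
    have "ennreal (e x) = (\<Sum>j. ennreal (indicator (F j) x * c j))" for x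
      unfolding e_def by (rule suminf_ennreal2[symmetric, OF _ esum]) (simp add: less_imp_le[OF c0])
    then have "(\<integral>\<^sup>+x. ennreal (e x) \<partial>lebn n) = (\<Sum>j. \<integral>\<^sup>+x. ennreal (indicator (F j) x * c j) \<partial>lebn n)"
      by (simp only:) (rule nn_integral_suminf, rule measurable_compose[OF borel_measurable_times[OF borel_measurable_indicator[OF F_sets] borel_measurable_const] measurable_ennreal])
    also have "\<dots> \<le> (\<Sum>j. ennreal (q * (1/2) ^ Suc j))"
    proof (rule suminf_le)
      fix j
      have "(\<integral>\<^sup>+x. ennreal (indicator (F j) x * c j) \<partial>lebn n) = (\<integral>\<^sup>+x. ennreal (c j) * indicator (F j) x \<partial>lebn n)"
        by (intro nn_integral_cong) (auto simp: indicator_def)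
      also have "\<dots> = ennreal (c j) * ennreal (vol j)"
        by (simp add: nn_integral_cmult_indicator vol(1))
      also have "\<dots> = ennreal (c j * vol j)" using c0[of j] vol(2) by (simp add: ennreal_mult)
      also have "\<dots> \<le> ennreal (q * (1/2) ^ Suc j)" by (rule ennreal_leI[OF c3])
      finally show "(\<integral>\<^sup>+x. ennreal (indicator (F j) x * c j) \<partial>lebn n) \<le> ennreal (q * (1/2) ^ Suc j)" .
    qed auto
    also have "\<dots> = ennreal q" using q by (intro half_series) simp
    finally show ?thesis .
  qed
  let ?w = "glue s (\<lambda>_. U)" and ?D = "\<lambda>i. glue s (\<lambda>_. G i)" and ?R = "\<lambda>I. glue s (\<lambda>_. \<lambda>x. \<phi> (N I x))"
  have "AE x in lebn n. \<forall>j. x \<in> F j \<longrightarrow> \<bar>conv n (eta n (s j)) (cut (K j) U) x - U x\<bar> \<le> d j"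
    unfolding AE_all_countable using s by (auto simp: scale_def)
  then have close: "AE x in lebn n. x \<in> \<Omega> \<longrightarrow> \<bar>?w x - U x\<bar> \<le> e x \<and> (\<forall>i<n. \<bar>partial i ?w x - ?D i x\<bar> \<le> e x / real n)"
  proof eventually_elim
    case (elim x)
    let ?v = "\<lambda>j. conv n (eta n (s j)) (cut (K j) U) x"
    show ?case
    proof (intro impI conjI allI)
      assume x: "x \<in> \<Omega>"
      have xR: "x \<in> Rn n" using x \<Omega>_sub by auto
      obtain r J where r: "r > 0" "cube n x r \<subseteq> \<Omega>" and z: "\<forall>y\<in>cube n x r. \<forall>j>J. \<zeta> j y = 0"
        and one: "\<forall>y\<in>cube n x r. (\<Sum>j\<le>J. \<zeta> j y) = 1"
        by (rule zeta_localE[OF x])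
      note z = z[rule_format] and one = one[rule_format]
      note xc = cube_self[OF xR r(1)]
      have "U x = (\<Sum>j\<le>J. \<zeta> j x * U x)" using one[OF xc] sum_distrib_right[of "\<lambda>j. \<zeta> j x" "{..J}" "U x"] by simp
      then have eq: "?w x - U x = (\<Sum>j\<le>J. \<zeta> j x * (?v j - U x))"
        by (simp add: glue_eq[OF z[OF xc]] right_diff_distrib sum_subtractf)
      have "\<bar>?w x - U x\<bar> \<le> (\<Sum>j\<le>J. indicator (F j) x * c j)"
        unfolding eq
      proof (rule order_trans[OF sum_abs sum_mono])
        fix j
        show "\<bar>\<zeta> j x * (?v j - U x)\<bar> \<le> indicator (F j) x * c j"
        proof (cases "x \<in> F j")
          case True
          have "\<bar>\<zeta> j x\<bar> * \<bar>?v j - U x\<bar> \<le> 1 * d j"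
            using elim True zeta_nonneg[OF xR, of j] zeta_le_1[OF xR, of j] d0[of j] by (intro mult_mono) auto
          then show ?thesis using True dc[of j] by (simp add: abs_mult)
        qed (simp add: zeta_outside[OF xR])
      qed
      then show "\<bar>?w x - U x\<bar> \<le> e x" using e_part[where J=J and x=x] by linarith
      fix i assume i: "i < n"
      have eq': "partial i ?w x - ?D i x = (\<Sum>j\<le>J. partial i (\<zeta> j) x * (?v j - U x))"
        using glue_partial[OF s x i r z one] by (simp only: add_diff_cancel_left')
      have "\<bar>partial i ?w x - ?D i x\<bar> \<le> (\<Sum>j\<le>J. indicator (F j) x * c j / real n)"
        unfolding eq'
      proof (rule order_trans[OF sum_abs sum_mono])
        fix j
        show "\<bar>partial i (\<zeta> j) x * (?v j - U x)\<bar> \<le> indicator (F j) x * c j / real n"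
        proof (cases "x \<in> F j")
          case True
          have "\<bar>partial i (\<zeta> j) x\<bar> * \<bar>?v j - U x\<bar> \<le> B j * d j"
            using elim True B(2)[OF i xR, of j] B(1)[of j] by (intro mult_mono) auto
          then show ?thesis using True Bd[of j] by (simp add: abs_mult)
        qed (simp add: zeta_partial_outside[OF xR _ i])
      qed
      also have "\<dots> = (\<Sum>j\<le>J. indicator (F j) x * c j) / real n" by (rule sum_divide_distrib[symmetric])
      also have "\<dots> \<le> e x / real n" by (intro divide_right_mono e_part) simp
      finally show "\<bar>partial i ?w x - ?D i x\<bar> \<le> e x / real n" .
    qed
  qed
  have Rb: "?R I \<in> borel_measurable (lebn n)" if "good I" for I
    by (rule glue_borel[OF phi_int[OF that] sp])
  have Rj: "\<phi> (L2_set (\<lambda>i. ?D i x) I) \<le> ?R I x" if I: "good I" and x: "x \<in> \<Omega>" for I x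
  proof -
    have xR: "x \<in> Rn n" using x \<Omega>_sub by auto
    obtain r J where r: "r > 0" "cube n x r \<subseteq> \<Omega>" and z: "\<forall>y\<in>cube n x r. \<forall>j>J. \<zeta> j y = 0"
        and one: "\<forall>y\<in>cube n x r. (\<Sum>j\<le>J. \<zeta> j y) = 1"
        by (rule zeta_localE[OF x])
      note z = z[rule_format] and one = one[rule_format]
    note xc = cube_self[OF xR r(1)]
    show ?thesis by (rule jensen[OF s x I z[OF xc] one[OF xc]])
  qed
  have Ri: "(\<integral>\<^sup>+x. indicator \<Omega> x * ennreal (?R I x) \<partial>lebn n) \<le> (\<integral>\<^sup>+x. indicator \<Omega> x * ennreal (\<phi> (N I x)) \<partial>lebn n) + ennreal q"
    if I: "good I" for I
  proof -
    have NI: "N I \<in> borel_measurable (lebn n)" using I by (intro N_borel) (simp add: good_def)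
    note [measurable] = Rb[OF I] measurable_compose[OF NI growth_borel]
    have "(\<integral>\<^sup>+x. indicator \<Omega> x * ennreal (?R I x) \<partial>lebn n)
      \<le> (\<integral>\<^sup>+x. indicator \<Omega> x * ennreal (\<phi> (N I x)) + indicator \<Omega> x * ennreal \<bar>?R I x - \<phi> (N I x)\<bar> \<partial>lebn n)"
    proof (rule nn_integral_mono)
      fix x
      have "ennreal (?R I x) \<le> ennreal (\<phi> (N I x) + \<bar>?R I x - \<phi> (N I x)\<bar>)" by (rule ennreal_leI) simp
      then show "indicator \<Omega> x * ennreal (?R I x) \<le> indicator \<Omega> x * ennreal (\<phi> (N I x)) + indicator \<Omega> x * ennreal \<bar>?R I x - \<phi> (N I x)\<bar>"
        using growth_nonneg[OF N_nonneg[of I x]] by (cases "x \<in> \<Omega>") (auto simp: ennreal_plus)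
    qed
    also have "\<dots> = (\<integral>\<^sup>+x. indicator \<Omega> x * ennreal (\<phi> (N I x)) \<partial>lebn n) + (\<integral>\<^sup>+x. indicator \<Omega> x * ennreal \<bar>?R I x - \<phi> (N I x)\<bar> \<partial>lebn n)"
      by (rule nn_integral_add) measurable
    also have "(\<integral>\<^sup>+x. indicator \<Omega> x * ennreal \<bar>?R I x - \<phi> (N I x)\<bar> \<partial>lebn n) \<le> ennreal q"
      by (rule glue_L1[OF less_imp_le[OF q] sp phi_int[OF I]]) (use s I in \<open>simp add: scale_def\<close>)
    finally show ?thesis by (simp add: add_left_mono)
  qed
  have "approximant q ?w ?D e ?R"
    unfolding approximant_def
  proof (intro conjI allI impI ballI)
    show "?w \<in> C_inf n \<Omega>" by (rule glue_C_inf[OF s])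
    show "?D i \<in> borel_measurable (lebn n)" if "i < n" for i
      by (rule glue_borel[OF G_int[OF that] sp])
    show "(\<integral>\<^sup>+x. indicator \<Omega> x * ennreal \<bar>?D i x - G i x\<bar> \<partial>lebn n) \<le> ennreal q" if "i < n" for i
      by (rule glue_L1[OF less_imp_le[OF q] sp G_int[OF that]]) (use s that in \<open>simp add: scale_def\<close>)
  qed (fact e_borel e_nonneg e_le e_int close Rb Rj Ri)+
  then show ?thesis by blast
qed

end

lemma L2_set_single: "L2_set f {i} = \<bar>f i\<bar>"
  by (simp add: L2_set_def)

section \<open>Energy bounds and passage to the limit\<close>

context approx
begin

lemma good_single: "i < n \<Longrightarrow> good {i}"
  using G_class[of i] by (simp add: good_def N_def L2_set_single)

text \<open>The perturbation is uniformly small, so \<open>growth_increment\<close> costs only a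
  factor \<open>1 + C * q\<close> on the Jensen majorant and an integrable remainder proportional to
  \<open>e\<close>. No multiple of the gradient ever enters \<open>\<phi>\<close>.\<close>

lemma approximant_energy:
  assumes a: "approximant q w D e R" and q: "0 < q" "q \<le> 1" and I: "good I"
    and C: "0 \<le> C" "\<And>t s. 0 \<le> t \<Longrightarrow> s \<in> {0..1} \<Longrightarrow> \<phi> (t + s) \<le> \<phi> t + C * s * (1 + \<phi> t)"
  shows "(\<integral>\<^sup>+x. indicator \<Omega> x * ennreal (\<phi> (L2_set (\<lambda>i. partial i w x) I)) \<partial>lebn n)
    \<le> ennreal (1 + C * q) * ((\<integral>\<^sup>+x. indicator \<Omega> x * ennreal (\<phi> (N I x)) \<partial>lebn n) + ennreal q) + ennreal (C * q)"
proof -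
  have I': "I \<subseteq> {..<n}" "finite I" using I finite_subset[of I "{..<n}"] by (auto simp: good_def)
  have card: "card I \<le> n" using card_mono[OF _ I'(1)] by simp
  have e: "0 \<le> e x" "e x \<le> q" for x using a by (auto simp: approximant_def)
  have [measurable]: "e \<in> borel_measurable (lebn n)" "R I \<in> borel_measurable (lebn n)"
    using a I by (auto simp: approximant_def)
  have close: "AE x in lebn n. x \<in> \<Omega> \<longrightarrow> (\<forall>i<n. \<bar>partial i w x - D i x\<bar> \<le> e x / real n)"
    using a unfolding approximant_def by (auto elim!: eventually_mono)
  have R: "\<phi> (L2_set (\<lambda>i. D i x) I) \<le> R I x" if "x \<in> \<Omega>" for x
    using a I that unfolding approximant_def by blast
  have "(\<integral>\<^sup>+x. indicator \<Omega> x * ennreal (\<phi> (L2_set (\<lambda>i. partial i w x) I)) \<partial>lebn n)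
    \<le> (\<integral>\<^sup>+x. ennreal (1 + C * q) * (indicator \<Omega> x * ennreal (R I x)) + ennreal C * ennreal (e x) \<partial>lebn n)"
  proof (rule nn_integral_mono_AE)
    show "AE x in lebn n. indicator \<Omega> x * ennreal (\<phi> (L2_set (\<lambda>i. partial i w x) I))
      \<le> ennreal (1 + C * q) * (indicator \<Omega> x * ennreal (R I x)) + ennreal C * ennreal (e x)"
      using close
    proof eventually_elim
      case (elim x)
      show ?case
      proof (cases "x \<in> \<Omega>")
        case True
        define t where "t = L2_set (\<lambda>i. D i x) I"
        have t: "0 \<le> t" by (simp add: t_def L2_set_nonneg)
        have "L2_set (\<lambda>i. partial i w x) I \<le> t + real (card I) * (e x / real n)"
          unfolding t_def using elim True I' by (intro L2_set_diff_le) auto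
        \<comment> \<open>The division of \<open>e\<close> by \<open>n\<close> in
          \<open>approximant\<close> was made for this step: all components together contribute at
          most \<open>e x\<close>.\<close>
        also have "real (card I) * (e x / real n) \<le> real n * (e x / real n)"
          using card e(1)[of x] by (intro mult_right_mono) auto
        also have "\<dots> = e x" using n1 by simp
        finally have "\<phi> (L2_set (\<lambda>i. partial i w x) I) \<le> \<phi> (t + e x)"
          by (intro growth_mono L2_set_nonneg) simp
        also have "\<dots> \<le> \<phi> t + C * e x * (1 + \<phi> t)" using t e[of x] q by (intro C(2)) auto
        also have "\<dots> \<le> R I x + C * e x * (1 + R I x)"
          using R[OF True] C(1) e(1)[of x] by (intro add_mono mult_left_mono) (auto simp: t_def)
        also have "\<dots> = R I x + C * e x * R I x + C * e x" by (simp add: distrib_left)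
        also have "C * e x * R I x \<le> C * q * R I x"
          using e[of x] C(1) growth_nonneg[OF t] R[OF True]
          by (intro mult_right_mono mult_left_mono) (auto simp: t_def)
        finally have "\<phi> (L2_set (\<lambda>i. partial i w x) I) \<le> (1 + C * q) * R I x + C * e x"
          by (simp add: distrib_right)
        then have "ennreal (\<phi> (L2_set (\<lambda>i. partial i w x) I)) \<le> ennreal ((1 + C * q) * R I x + C * e x)"
          by (rule ennreal_leI)
        also have "\<dots> = ennreal (1 + C * q) * ennreal (R I x) + ennreal C * ennreal (e x)"
        proof -
          have "0 \<le> R I x" using growth_nonneg[OF t] R[OF True] by (simp add: t_def)
          moreover have "0 \<le> 1 + C * q" using C(1) q(1) by simp
          ultimately show ?thesis using C(1) e(1)[of x] by (simp add: ennreal_plus ennreal_mult)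
        qed
        finally show ?thesis using True by simp
      qed simp
    qed
  qed
  also have "\<dots> = ennreal (1 + C * q) * (\<integral>\<^sup>+x. indicator \<Omega> x * ennreal (R I x) \<partial>lebn n) + ennreal C * (\<integral>\<^sup>+x. ennreal (e x) \<partial>lebn n)"
    by (simp add: nn_integral_add nn_integral_cmult)
  also have "\<dots> \<le> ennreal (1 + C * q) * ((\<integral>\<^sup>+x. indicator \<Omega> x * ennreal (\<phi> (N I x)) \<partial>lebn n) + ennreal q) + ennreal C * ennreal q"
    using a I unfolding approximant_def by (intro add_mono mult_left_mono) auto
  also have "ennreal C * ennreal q = ennreal (C * q)" using C(1) q(1) by (simp add: ennreal_mult)
  finally show ?thesis .
qed

text \<open>\<open>growth_increment\<close> is used twice: at \<open>t = 0\<close>, where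
  \<open>\<phi> 0 = 0\<close> makes \<open>\<phi>\<close> of the error linear in \<open>e\<close>,
  and at \<open>t = \<bar>U x\<bar>\<close>, where it compares the modular of \<open>w\<close> with
  that of \<open>U\<close>.\<close>

lemma approximant_modular:
  assumes a: "approximant q w D e R" and q: "0 < q" "q \<le> 1"
    and C: "0 \<le> C" "\<And>t s. 0 \<le> t \<Longrightarrow> s \<in> {0..1} \<Longrightarrow> \<phi> (t + s) \<le> \<phi> t + C * s * (1 + \<phi> t)"
  shows "(\<integral>\<^sup>+x. indicator \<Omega> x * ennreal (\<phi> \<bar>w x\<bar>) \<partial>lebn n) < \<infinity>"
    and "(\<integral>\<^sup>+x. indicator \<Omega> x * ennreal (\<phi> \<bar>w x - U x\<bar>) \<partial>lebn n) \<le> ennreal (C * q)"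
proof -
  have e: "0 \<le> e x" "e x \<le> q" for x using a by (auto simp: approximant_def)
  have [measurable]: "e \<in> borel_measurable (lebn n)" using a by (auto simp: approximant_def)
  have ei: "(\<integral>\<^sup>+x. ennreal (e x) \<partial>lebn n) \<le> ennreal q" using a by (auto simp: approximant_def)
  have [measurable]: "(\<lambda>x. \<phi> \<bar>U x\<bar>) \<in> borel_measurable (lebn n)" by measurable
  have close: "AE x in lebn n. x \<in> \<Omega> \<longrightarrow> \<bar>w x - U x\<bar> \<le> e x"
    using a unfolding approximant_def by (auto elim!: eventually_mono)
  have "(\<integral>\<^sup>+x. indicator \<Omega> x * ennreal (\<phi> \<bar>w x - U x\<bar>) \<partial>lebn n) \<le> (\<integral>\<^sup>+x. ennreal C * ennreal (e x) \<partial>lebn n)"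
  proof (rule nn_integral_mono_AE)
    show "AE x in lebn n. indicator \<Omega> x * ennreal (\<phi> \<bar>w x - U x\<bar>) \<le> ennreal C * ennreal (e x)"
      using close
    proof eventually_elim
      case (elim x)
      show ?case
      proof (cases "x \<in> \<Omega>")
        case True
        have "\<phi> \<bar>w x - U x\<bar> \<le> \<phi> (0 + e x)" using elim True by (intro growth_mono) auto
        also have "\<dots> \<le> \<phi> 0 + C * e x * (1 + \<phi> 0)" using e[of x] q by (intro C(2)) auto
        finally have "\<phi> \<bar>w x - U x\<bar> \<le> C * e x" by (simp add: growth_0)
        then show ?thesis using True C(1) e(1)[of x] by (simp add: ennreal_leI ennreal_mult[symmetric])
      qed simp
    qed
  qed
  also have "\<dots> = ennreal C * (\<integral>\<^sup>+x. ennreal (e x) \<partial>lebn n)" by (rule nn_integral_cmult) measurable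
  also have "\<dots> \<le> ennreal C * ennreal q" by (intro mult_left_mono ei) simp
  also have "\<dots> = ennreal (C * q)" using C(1) q(1) by (simp add: ennreal_mult)
  finally show "(\<integral>\<^sup>+x. indicator \<Omega> x * ennreal (\<phi> \<bar>w x - U x\<bar>) \<partial>lebn n) \<le> ennreal (C * q)" .
  have "(\<integral>\<^sup>+x. indicator \<Omega> x * ennreal (\<phi> \<bar>w x\<bar>) \<partial>lebn n)
    \<le> (\<integral>\<^sup>+x. ennreal (1 + C) * (indicator \<Omega> x * ennreal (\<phi> \<bar>U x\<bar>)) + ennreal C * ennreal (e x) \<partial>lebn n)"
  proof (rule nn_integral_mono_AE)
    show "AE x in lebn n. indicator \<Omega> x * ennreal (\<phi> \<bar>w x\<bar>)
      \<le> ennreal (1 + C) * (indicator \<Omega> x * ennreal (\<phi> \<bar>U x\<bar>)) + ennreal C * ennreal (e x)"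
      using close
    proof eventually_elim
      case (elim x)
      show ?case
      proof (cases "x \<in> \<Omega>")
        case True
        have p0: "0 \<le> \<phi> \<bar>U x\<bar>" by (rule growth_nonneg) simp
        have "\<phi> \<bar>w x\<bar> \<le> \<phi> (\<bar>U x\<bar> + e x)" using elim True by (intro growth_mono) auto
        also have "\<dots> \<le> \<phi> \<bar>U x\<bar> + C * e x * (1 + \<phi> \<bar>U x\<bar>)" using e[of x] q by (intro C(2)) auto
        also have "\<dots> = \<phi> \<bar>U x\<bar> + C * e x * \<phi> \<bar>U x\<bar> + C * e x" by (simp add: distrib_left)
        also have "C * e x * \<phi> \<bar>U x\<bar> \<le> C * 1 * \<phi> \<bar>U x\<bar>"
          using e[of x] q C(1) p0 by (intro mult_right_mono mult_left_mono) auto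
        finally have "\<phi> \<bar>w x\<bar> \<le> (1 + C) * \<phi> \<bar>U x\<bar> + C * e x" by (simp add: distrib_right)
        then have "ennreal (\<phi> \<bar>w x\<bar>) \<le> ennreal ((1 + C) * \<phi> \<bar>U x\<bar> + C * e x)" by (rule ennreal_leI)
        also have "\<dots> = ennreal (1 + C) * ennreal (\<phi> \<bar>U x\<bar>) + ennreal C * ennreal (e x)"
          using C(1) e(1)[of x] p0 by (simp add: ennreal_plus[symmetric] ennreal_mult[symmetric] del: ennreal_plus)
        finally show ?thesis using True by simp
      qed simp
    qed
  qed
  also have "\<dots> = ennreal (1 + C) * (\<integral>\<^sup>+x. indicator \<Omega> x * ennreal (\<phi> \<bar>U x\<bar>) \<partial>lebn n) + ennreal C * (\<integral>\<^sup>+x. ennreal (e x) \<partial>lebn n)"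
    by (simp add: nn_integral_add nn_integral_cmult)
  also have "\<dots> < \<infinity>"
    using U_class le_less_trans[OF ei, of top] by (simp add: ennreal_mult_less_top)
  finally show "(\<integral>\<^sup>+x. indicator \<Omega> x * ennreal (\<phi> \<bar>w x\<bar>) \<partial>lebn n) < \<infinity>" .
qed

text \<open>Summable \<open>L^1\<close> errors make the series of the pointwise errors finite almost
  everywhere, so the whole sequence converges and no subsequence has to be chosen.\<close>

lemma AE_tendsto_of_summable_L1:
  assumes D: "\<And>h. D h \<in> borel_measurable M" and V: "V \<in> borel_measurable M" and A: "A \<in> sets M"
    and le: "\<And>h. (\<integral>\<^sup>+x. indicator A x * ennreal \<bar>D h x - V x\<bar> \<partial>M) \<le> ennreal (1 * (1/2) ^ Suc h)"
  shows "AE x in M. x \<in> A \<longrightarrow> (\<lambda>h. D h x) \<longlonglongrightarrow> (V x :: real)"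
proof -
  note [measurable] = D V A
  have m: "(\<lambda>x. indicator A x * ennreal \<bar>D h x - V x\<bar>) \<in> borel_measurable M" for h by measurable
  have "(\<integral>\<^sup>+x. (\<Sum>h. indicator A x * ennreal \<bar>D h x - V x\<bar>) \<partial>M) = (\<Sum>h. \<integral>\<^sup>+x. indicator A x * ennreal \<bar>D h x - V x\<bar> \<partial>M)"
    by (rule nn_integral_suminf[OF m])
  also have "\<dots> \<le> (\<Sum>h. ennreal (1 * (1/2) ^ Suc h))" by (rule suminf_le[OF le]) auto
  also have "\<dots> = ennreal 1" by (rule half_series) simp
  finally have "(\<integral>\<^sup>+x. (\<Sum>h. indicator A x * ennreal \<bar>D h x - V x\<bar>) \<partial>M) \<noteq> \<infinity>"
    by (auto simp: top_unique)
  then have "AE x in M. (\<Sum>h. indicator A x * ennreal \<bar>D h x - V x\<bar>) \<noteq> \<infinity>"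
    by (rule nn_integral_noteq_infinite[rotated]) measurable
  then show ?thesis
  proof eventually_elim
    case (elim x)
    show ?case
    proof
      assume "x \<in> A"
      then have "(\<Sum>h. ennreal \<bar>D h x - V x\<bar>) \<noteq> top" using elim by simp
      then have "summable (\<lambda>h. \<bar>D h x - V x\<bar>)" by (intro summable_suminf_not_top) auto
      then have "(\<lambda>h. \<bar>D h x - V x\<bar>) \<longlonglongrightarrow> 0" by (rule summable_LIMSEQ_zero)
      then have "(\<lambda>h. D h x - V x) \<longlonglongrightarrow> 0" by (rule tendsto_rabs_zero_cancel)
      then show "(\<lambda>h. D h x) \<longlonglongrightarrow> V x" by (rule LIM_zero_cancel)
    qed
  qed
qed

theorem smooth_approximation:
  obtains w where "\<And>h. w h \<in> C_inf n \<Omega>"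
    and "\<And>h. (\<integral>\<^sup>+x. indicator \<Omega> x * ennreal (\<phi> \<bar>w h x\<bar>) \<partial>lebn n) < \<infinity>"
    and "\<And>h i. i < n \<Longrightarrow> (\<integral>\<^sup>+x. indicator \<Omega> x * ennreal (\<phi> \<bar>partial i (w h) x\<bar>) \<partial>lebn n) < \<infinity>"
    and "(\<lambda>h. \<integral>\<^sup>+x. indicator \<Omega> x * ennreal (\<phi> \<bar>w h x - U x\<bar>) \<partial>lebn n) \<longlonglongrightarrow> 0"
    and "(\<lambda>h. \<integral>\<^sup>+x. indicator \<Omega> x * ennreal (\<phi> (L2_set (\<lambda>i. partial i (w h) x) {..<n})) \<partial>lebn n)
      \<longlonglongrightarrow> (\<integral>\<^sup>+x. indicator \<Omega> x * ennreal (\<phi> (N {..<n} x)) \<partial>lebn n)"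
    and "\<And>h. good {..<n} \<Longrightarrow> (\<integral>\<^sup>+x. indicator \<Omega> x * ennreal (\<phi> (L2_set (\<lambda>i. partial i (w h) x) {..<n})) \<partial>lebn n) < \<infinity>"
proof -
  \<comment> \<open>The accuracies are summable so that \<open>AE_tendsto_of_summable_L1\<close>
    applies.\<close>
  define q :: "nat \<Rightarrow> real" where "q h = 1 * (1/2) ^ Suc h" for h
  have q: "0 < q h" "q h \<le> 1" for h
  proof -
    show "0 < q h" by (simp add: q_def)
    have "(1/2::real) ^ Suc h \<le> 1" by (rule power_le_one) auto
    then show "q h \<le> 1" by (simp add: q_def)
  qed
  have q0: "q \<longlonglongrightarrow> 0"
    unfolding q_def using sums_summable[OF power_half_series, THEN summable_LIMSEQ_zero] by simp
  have "\<exists>w. \<forall>h. \<exists>D e R. approximant (q h) (w h) D e R"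
    by (rule choice) (intro allI approximant_exists q)
  then obtain w where "\<forall>h. \<exists>D e R. approximant (q h) (w h) D e R" by (rule exE)
  then have "\<exists>D. \<forall>h. \<exists>e R. approximant (q h) (w h) (D h) e R" by (rule choice)
  then obtain D where "\<forall>h. \<exists>e R. approximant (q h) (w h) (D h) e R" by (rule exE)
  then have "\<exists>e. \<forall>h. \<exists>R. approximant (q h) (w h) (D h) (e h) R" by (rule choice)
  then obtain e where "\<forall>h. \<exists>R. approximant (q h) (w h) (D h) (e h) R" by (rule exE)
  then have "\<exists>R. \<forall>h. approximant (q h) (w h) (D h) (e h) (R h)" by (rule choice)
  then obtain R where a': "\<forall>h. approximant (q h) (w h) (D h) (e h) (R h)" by (rule exE)
  note a = a'[rule_format]
  obtain C where C0: "0 \<le> C" and C': "\<forall>t\<ge>0. \<forall>s\<in>{0..1}. \<phi> (t + s) \<le> \<phi> t + C * s * (1 + \<phi> t)"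
    using growth_increment by blast
  have C: "\<phi> (t + s) \<le> \<phi> t + C * s * (1 + \<phi> t)" if "0 \<le> t" "s \<in> {0..1}" for t s using C' that by blast
  let ?E = "\<lambda>I h. \<integral>\<^sup>+x. indicator \<Omega> x * ennreal (\<phi> (L2_set (\<lambda>i. partial i (w h) x) I)) \<partial>lebn n"
  let ?T = "\<lambda>I. \<integral>\<^sup>+x. indicator \<Omega> x * ennreal (\<phi> (N I x)) \<partial>lebn n"
  note upper = approximant_energy[OF a q _ C0 C]
  have fin: "?E I h < \<infinity>" if I: "good I" for I h
  proof (rule le_less_trans[OF upper[OF I]])
    have "?T I < \<infinity>" using I by (simp add: good_def)
    then show "ennreal (1 + C * q h) * (?T I + ennreal (q h)) + ennreal (C * q h) < \<infinity>"
      by (simp add: ennreal_mult_less_top)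
  qed
  have wC: "w h \<in> C_inf n \<Omega>" for h using a[of h] by (simp add: approximant_def)
  have mean: "(\<lambda>h. \<integral>\<^sup>+x. indicator \<Omega> x * ennreal (\<phi> \<bar>w h x - U x\<bar>) \<partial>lebn n) \<longlonglongrightarrow> 0"
  proof (rule tendsto_sandwich[OF _ _ tendsto_const])
    show "\<forall>\<^sub>F h in sequentially. (\<integral>\<^sup>+x. indicator \<Omega> x * ennreal (\<phi> \<bar>w h x - U x\<bar>) \<partial>lebn n) \<le> ennreal (C * q h)"
      by (intro always_eventually allI approximant_modular(2)[OF a q C0 C])
    have "(\<lambda>h. ennreal (C * q h)) \<longlonglongrightarrow> ennreal (C * 0)" by (intro tendsto_ennrealI tendsto_intros q0)
    then show "(\<lambda>h. ennreal (C * q h)) \<longlonglongrightarrow> 0" by simp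
  qed simp
  have conv_pt: "AE x in lebn n. x \<in> \<Omega> \<longrightarrow> (\<forall>i\<in>{..<n}. (\<lambda>h. partial i (w h) x) \<longlonglongrightarrow> G i x)"
  proof -
    have D: "D h i \<in> borel_measurable (lebn n)" "(\<integral>\<^sup>+x. indicator \<Omega> x * ennreal \<bar>D h i x - G i x\<bar> \<partial>lebn n) \<le> ennreal (1 * (1/2) ^ Suc h)"
      if "i < n" for h i using a[of h] that by (auto simp: approximant_def q_def)
    have 1: "AE x in lebn n. \<forall>i\<in>{..<n}. x \<in> \<Omega> \<longrightarrow> (\<lambda>h. D h i x) \<longlonglongrightarrow> G i x"
    proof (rule AE_finite_allI)
      fix i assume "i \<in> {..<n}"
      then have i: "i < n" by simp
      show "AE x in lebn n. x \<in> \<Omega> \<longrightarrow> (\<lambda>h. D h i x) \<longlonglongrightarrow> G i x"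
        by (rule AE_tendsto_of_summable_L1[OF D(1)[OF i] G_borel[OF i] \<Omega>_sets D(2)[OF i]])
    qed simp
    have 2: "AE x in lebn n. \<forall>h. x \<in> \<Omega> \<longrightarrow> (\<forall>i<n. \<bar>partial i (w h) x - D h i x\<bar> \<le> e h x / real n)"
      unfolding AE_all_countable
    proof
      fix h
      show "AE x in lebn n. x \<in> \<Omega> \<longrightarrow> (\<forall>i<n. \<bar>partial i (w h) x - D h i x\<bar> \<le> e h x / real n)"
        using a[of h] unfolding approximant_def by (auto elim!: eventually_mono)
    qed
    show ?thesis
      using 1 2
    proof eventually_elim
      case (elim x)
      show ?case
      proof (intro impI ballI)
        fix i assume x: "x \<in> \<Omega>" and i: "i \<in> {..<n}"
        have "\<bar>partial i (w h) x - D h i x\<bar> \<le> q h" for h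
        proof -
          have "\<bar>partial i (w h) x - D h i x\<bar> \<le> e h x / real n" using elim(2) x i by auto
          also have "\<dots> \<le> e h x / 1" using a[of h] n1 by (intro divide_left_mono) (auto simp: approximant_def)
          also have "\<dots> \<le> q h" using a[of h] by (simp add: approximant_def)
          finally show ?thesis .
        qed
        then have "(\<lambda>h. partial i (w h) x - D h i x) \<longlonglongrightarrow> 0"
          by (intro Lim_null_comparison[OF always_eventually q0]) auto
        moreover have "(\<lambda>h. D h i x) \<longlonglongrightarrow> G i x" using elim(1) x i by blast
        ultimately have "(\<lambda>h. (partial i (w h) x - D h i x) + D h i x) \<longlonglongrightarrow> 0 + G i x" by (rule tendsto_add)
        then show "(\<lambda>h. partial i (w h) x) \<longlonglongrightarrow> G i x" by simp
      qed
    qed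
  qed
  \<comment> \<open>Fatou's lemma along the almost everywhere convergent gradients; the left-hand
    side may be infinite.\<close>
  have lower: "?T {..<n} \<le> liminf (?E {..<n})"
  proof -
    let ?u = "\<lambda>h x. indicator \<Omega> x * ennreal (\<phi> (L2_set (\<lambda>i. partial i (w h) x) {..<n}))"
    have um: "?u h \<in> borel_measurable (lebn n)" for h
    proof -
      have "(\<lambda>x. \<Sum>i<n. (indicator \<Omega> x * partial i (w h) x)\<^sup>2) \<in> borel_measurable (lebn n)"
        by (intro borel_measurable_sum borel_measurable_power C_inf_borel[OF open_\<Omega>] C_inf_partial[OF wC]) auto
      then have "(\<lambda>x. indicator \<Omega> x * ennreal (\<phi> (sqrt (\<Sum>i<n. (indicator \<Omega> x * partial i (w h) x)\<^sup>2)))) \<in> borel_measurable (lebn n)"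
        by measurable
      also have "(\<lambda>x. indicator \<Omega> x * ennreal (\<phi> (sqrt (\<Sum>i<n. (indicator \<Omega> x * partial i (w h) x)\<^sup>2)))) = ?u h"
        by (intro ext) (simp add: indicator_def L2_set_def)
      finally show ?thesis .
    qed
    have "?T {..<n} \<le> (\<integral>\<^sup>+x. liminf (\<lambda>h. ?u h x) \<partial>lebn n)"
    proof (rule nn_integral_mono_AE)
      show "AE x in lebn n. indicator \<Omega> x * ennreal (\<phi> (N {..<n} x)) \<le> liminf (\<lambda>h. ?u h x)"
        using conv_pt
      proof eventually_elim
        case (elim x)
        show ?case
        proof (cases "x \<in> \<Omega>")
          case True
          have L: "(\<lambda>h. L2_set (\<lambda>i. partial i (w h) x) {..<n}) \<longlonglongrightarrow> N {..<n} x"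
            unfolding N_def L2_set_def using elim True by (intro tendsto_intros) auto
          have "(\<lambda>h. \<phi> (L2_set (\<lambda>i. partial i (w h) x) {..<n})) \<longlonglongrightarrow> \<phi> (N {..<n} x)"
            by (rule continuous_on_tendsto_compose[OF growth_cont L]) (auto simp: N_nonneg L2_set_nonneg)
          then have "(\<lambda>h. ennreal (\<phi> (L2_set (\<lambda>i. partial i (w h) x) {..<n}))) \<longlonglongrightarrow> ennreal (\<phi> (N {..<n} x))"
            by (rule tendsto_ennrealI)
          from lim_imp_Liminf[OF _ this] show ?thesis using True by simp
        qed simp
      qed
    qed
    also have "\<dots> \<le> liminf (\<lambda>h. integral\<^sup>N (lebn n) (?u h))" by (rule nn_integral_liminf[OF um])
    finally show ?thesis .
  qed
  have energy: "?E {..<n} \<longlonglongrightarrow> ?T {..<n}"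
  proof -
    have "limsup (?E {..<n}) \<le> ?T {..<n}"
    \<comment> \<open>For a good full index set the bounds of \<open>approximant_energy\<close>
      converge to the target. Otherwise the target is \<open>top\<close> and there is nothing to
      bound.\<close>
    proof (cases "good {..<n}")
      case True
      let ?b = "\<lambda>h. ennreal (1 + C * q h) * (?T {..<n} + ennreal (q h)) + ennreal (C * q h)"
      have f: "?T {..<n} \<noteq> top" using True by (auto simp: good_def)
      obtain p where p: "0 \<le> p" "?T {..<n} = ennreal p" using f by (cases "?T {..<n}") auto
      have b: "?b h = ennreal ((1 + C * q h) * (p + q h) + C * q h)" for h
        using p C0 q(1)[of h] by (simp add: ennreal_plus ennreal_mult add_nonneg_nonneg)
      have "(\<lambda>h. ennreal ((1 + C * q h) * (p + q h) + C * q h)) \<longlonglongrightarrow> ennreal ((1 + C * 0) * (p + 0) + C * 0)"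
        by (intro tendsto_ennrealI tendsto_intros q0)
      then have "?b \<longlonglongrightarrow> ennreal p" by (simp only: b mult_zero_right add_0_right mult_1)
      then have "?b \<longlonglongrightarrow> ?T {..<n}" by (simp only: p(2)[symmetric])
      then have "limsup ?b = ?T {..<n}" by (intro lim_imp_Limsup) auto
      moreover have "limsup (?E {..<n}) \<le> limsup ?b"
        by (intro Limsup_mono always_eventually allI upper[OF True])
      ultimately show ?thesis by simp
    next
      case False
      then have "\<not> ?T {..<n} < top" by (auto simp: good_def)
      then have "?T {..<n} = top" using top.not_eq_extremum by blast
      then show ?thesis by simp
    qed
    then have "liminf (?E {..<n}) = ?T {..<n}" "limsup (?E {..<n}) = ?T {..<n}"
      using lower Liminf_le_Limsup[of sequentially "?E {..<n}"] by (auto intro: antisym order_trans)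
    then show ?thesis by (subst tendsto_iff_Liminf_eq_Limsup) auto
  qed
  show ?thesis
  proof (rule that[OF wC _ _ mean energy fin])
    show "(\<integral>\<^sup>+x. indicator \<Omega> x * ennreal (\<phi> \<bar>w h x\<bar>) \<partial>lebn n) < \<infinity>" for h
      by (rule approximant_modular(1)[OF a q C0 C])
    show "(\<integral>\<^sup>+x. indicator \<Omega> x * ennreal (\<phi> \<bar>partial i (w h) x\<bar>) \<partial>lebn n) < \<infinity>" if "i < n" for h i
      using fin[OF good_single[OF that], of h] by (simp add: L2_set_single)
  qed
qed

end

section \<open>Smooth approximation in the Orlicz--Sobolev class\<close>

lemma Orlicz_class_imp_space: "v \<in> Orlicz_class n \<Omega> \<phi> \<Longrightarrow> v \<in> Orlicz_space n \<Omega> \<phi>"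
  unfolding Orlicz_space_def
  by (intro CollectI exI[of _ 1] exI[of _ "\<lambda>_. 1"] exI[of _ "\<lambda>_. v"]) auto

lemma has_weak_deriv_weak_deriv: "has_weak_deriv n \<Omega> i v g \<Longrightarrow> has_weak_deriv n \<Omega> i v (weak_deriv n \<Omega> i v)"
  unfolding weak_deriv_def by (rule someI[of "has_weak_deriv n \<Omega> i v"])

lemma grad_norm_AE:
  assumes "\<And>i. i < n \<Longrightarrow> rep n \<Omega> (weak_deriv n \<Omega> i v) (G i)"
  shows "AE x in lebn n. x \<in> \<Omega> \<longrightarrow> grad_norm n \<Omega> v x = L2_set (\<lambda>i. G i x) {..<n}"
proof -
  have "AE x in lebn n. \<forall>i\<in>{..<n}. x \<in> \<Omega> \<longrightarrow> weak_deriv n \<Omega> i v x = G i x"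
    by (rule AE_finite_allI) (use assms in \<open>auto simp: rep_def\<close>)
  then show ?thesis
  proof eventually_elim
    case (elim x)
    show ?case
    proof
      assume "x \<in> \<Omega>"
      then show "grad_norm n \<Omega> v x = L2_set (\<lambda>i. G i x) {..<n}"
        unfolding grad_norm_def using elim by (intro L2_set_cong) auto
    qed
  qed
qed

lemma grad_norm_borel:
  assumes "\<And>i. i < n \<Longrightarrow> rep n \<Omega> (weak_deriv n \<Omega> i v) (G i)"
  shows "grad_norm n \<Omega> v \<in> borel_measurable (Rn_leb_on n \<Omega>)"
proof -
  have [measurable]: "(\<lambda>x. \<Sum>i<n. (weak_deriv n \<Omega> i v x)\<^sup>2) \<in> borel_measurable (Rn_leb_on n \<Omega>)"
    by (intro borel_measurable_sum borel_measurable_power) (use assms in \<open>auto simp: rep_def\<close>)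
  show ?thesis unfolding grad_norm_def[abs_def] L2_set_def by measurable
qed

text \<open>The classical derivative is a weak derivative, and uniqueness identifies with it the one
  selected by \<open>weak_deriv\<close>. This makes the gradient norms of the approximations
  computable.\<close>

lemma rep_weak_deriv_C_inf:
  assumes \<Omega>: "openin (Rn_top n) \<Omega>" and v: "v \<in> C_inf n \<Omega>" and i: "i < n"
  shows "has_weak_deriv n \<Omega> i v (partial i v)"
    and "rep n \<Omega> (weak_deriv n \<Omega> i v) (cut \<Omega> (partial i v))"
proof -
  note S = openin_imp_sets_lebn[OF \<Omega>]
  have rv: "rep n \<Omega> v (cut \<Omega> v)" by (rule rep_I[OF S C_inf_borel[OF \<Omega> v]]) simp
  have rp: "rep n \<Omega> (partial i v) (cut \<Omega> (partial i v))"
    by (rule rep_I[OF S C_inf_borel[OF \<Omega> C_inf_partial[OF v i]]]) simp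
  have ind: "indicator \<Omega> x * (indicator \<Omega> x * a * b) = (indicator \<Omega> x * (a * b) :: real)" for x a b
    by (simp add: indicator_def)
  have wp: "weak_partial n \<Omega> i (cut \<Omega> v) (cut \<Omega> (partial i v))"
    using weak_partial_C_inf[OF \<Omega> v i] unfolding weak_partial_def ind .
  have li: "loc_int n \<Omega> (cut \<Omega> (partial i v))" by (rule loc_int_C_inf[OF \<Omega> C_inf_partial[OF v i]])
  show h: "has_weak_deriv n \<Omega> i v (partial i v)"
    using has_weak_deriv_iff[OF S rv rp i] li wp by blast
  show "rep n \<Omega> (weak_deriv n \<Omega> i v) (cut \<Omega> (partial i v))"
    by (rule has_weak_deriv_unique[OF \<Omega> i rv has_weak_deriv_weak_deriv[OF h] li wp])
qed

text \<open>Borel representatives of \<open>u\<close> and of its weak derivatives enter the locale,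
  and almost everywhere equality carries modulars and limits back. If the gradient norm of
  \<open>u\<close> is in the class, the full index set is good, which makes the modulars of the
  approximating gradients finite.\<close>

lemma W1K_smooth_approximation:
  assumes g: "growth \<phi>" and n: "n \<ge> 1" and \<Omega>: "openin (Rn_top n) \<Omega>" and u: "u \<in> W1K n \<Omega> \<phi>"
  shows "\<exists>us. (\<forall>h. us h \<in> C_inf n \<Omega> \<inter> W1K n \<Omega> \<phi>) \<and>
              mean_convergent n \<Omega> \<phi> us u \<and>
              (\<lambda>h. modular n \<Omega> \<phi> (grad_norm n \<Omega> (us h))) \<longlonglongrightarrow> modular n \<Omega> \<phi> (grad_norm n \<Omega> u) \<and>
              (grad_norm n \<Omega> u \<in> Orlicz_class n \<Omega> \<phi> \<longrightarrow>
                 energy_convergent n \<Omega> \<phi> (\<lambda>h. grad_norm n \<Omega> (us h)) (grad_norm n \<Omega> u))"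
proof -
  note S = openin_imp_sets_lebn[OF \<Omega>]
  have uO: "u \<in> Orlicz_class n \<Omega> \<phi>" and uW: "u \<in> W11_loc n \<Omega>"
    and uD: "\<And>i. i < n \<Longrightarrow> weak_deriv n \<Omega> i u \<in> Orlicz_class n \<Omega> \<phi>"
    using u by (auto simp: W1K_def)
  have "u \<in> borel_measurable (Rn_leb_on n \<Omega>)" using uO by (simp add: Orlicz_class_def)
  then obtain U where U: "rep n \<Omega> u U" by (rule rep_exists[OF S])
  have "\<exists>G. rep n \<Omega> (weak_deriv n \<Omega> i u) G" if "i < n" for i
  proof -
    have "weak_deriv n \<Omega> i u \<in> borel_measurable (Rn_leb_on n \<Omega>)" using uD[OF that] by (simp add: Orlicz_class_def)
    then show ?thesis by (rule rep_exists[OF S]) blast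
  qed
  then obtain G where G: "\<And>i. i < n \<Longrightarrow> rep n \<Omega> (weak_deriv n \<Omega> i u) (G i)" by metis
  have hw: "has_weak_deriv n \<Omega> i u (weak_deriv n \<Omega> i u)" if "i < n" for i
    using uW that has_weak_deriv_weak_deriv unfolding W11_loc_def by blast
  have AE_U: "AE x in lebn n. x \<in> \<Omega> \<longrightarrow> u x = U x" using U by (simp add: rep_def)
  have AE_G: "AE x in lebn n. x \<in> \<Omega> \<longrightarrow> weak_deriv n \<Omega> i u x = G i x" if "i < n" for i
    using G[OF that] by (simp add: rep_def)
  obtain \<zeta> F K m where "cutoffs n \<Omega> \<zeta> F K m" by (rule cutoffs_exist[OF \<Omega>])
  then interpret approx \<phi> n \<Omega> \<zeta> F K m U G
  proof (intro approx.intro g approx_axioms.intro n)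
    show "loc_int n \<Omega> U" using rep_L1_loc_iff[OF S U] uW by (simp add: W11_loc_def)
    show "loc_int n \<Omega> (G i)" "weak_partial n \<Omega> i U (G i)" if "i < n" for i
      using has_weak_deriv_iff[OF S U G[OF that] that] hw[OF that] by auto
    show "(\<integral>\<^sup>+x. indicator \<Omega> x * ennreal (\<phi> \<bar>U x\<bar>) \<partial>lebn n) < \<infinity>"
      using uO rep_modular[OF S AE_U, of \<phi>] by (simp add: Orlicz_class_def)
    show "(\<integral>\<^sup>+x. indicator \<Omega> x * ennreal (\<phi> \<bar>G i x\<bar>) \<partial>lebn n) < \<infinity>" if "i < n" for i
      using uD[OF that] rep_modular[OF S AE_G[OF that], of \<phi>] by (simp add: Orlicz_class_def)
  qed
  obtain w where w: "\<And>h. w h \<in> C_inf n \<Omega>"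
    "\<And>h. (\<integral>\<^sup>+x. indicator \<Omega> x * ennreal (\<phi> \<bar>w h x\<bar>) \<partial>lebn n) < \<infinity>"
    "\<And>h i. i < n \<Longrightarrow> (\<integral>\<^sup>+x. indicator \<Omega> x * ennreal (\<phi> \<bar>partial i (w h) x\<bar>) \<partial>lebn n) < \<infinity>"
    and mean: "(\<lambda>h. \<integral>\<^sup>+x. indicator \<Omega> x * ennreal (\<phi> \<bar>w h x - U x\<bar>) \<partial>lebn n) \<longlonglongrightarrow> 0"
    and energy: "(\<lambda>h. \<integral>\<^sup>+x. indicator \<Omega> x * ennreal (\<phi> (L2_set (\<lambda>i. partial i (w h) x) {..<n})) \<partial>lebn n)
      \<longlonglongrightarrow> (\<integral>\<^sup>+x. indicator \<Omega> x * ennreal (\<phi> (N {..<n} x)) \<partial>lebn n)"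
    and fin: "\<And>h. good {..<n} \<Longrightarrow> (\<integral>\<^sup>+x. indicator \<Omega> x * ennreal (\<phi> (L2_set (\<lambda>i. partial i (w h) x) {..<n})) \<partial>lebn n) < \<infinity>"
    using smooth_approximation by blast
  have rw: "rep n \<Omega> (w h) (cut \<Omega> (w h))" for h by (rule rep_I[OF S C_inf_borel[OF \<Omega> w(1)]]) simp
  note wd = rep_weak_deriv_C_inf[OF \<Omega> w(1)]
  have wO: "w h \<in> Orlicz_class n \<Omega> \<phi>" for h
  proof -
    have "AE x in lebn n. x \<in> \<Omega> \<longrightarrow> w h x = w h x" by simp
    from rep_modular[OF S this] show ?thesis using rw[of h] w(2)[of h] by (simp add: Orlicz_class_def rep_def)
  qed
  have wW: "w h \<in> W1K n \<Omega> \<phi>" for h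
    unfolding W1K_def W11_loc_def
  proof (intro CollectI conjI IntI wO allI impI)
    show "w h \<in> L1_loc n \<Omega>" using rep_L1_loc_iff[OF S rw] loc_int_C_inf[OF \<Omega> w(1)] by blast
    fix i assume i: "i < n"
    show "\<exists>g. has_weak_deriv n \<Omega> i (w h) g" using wd(1)[OF i] by blast
    have "AE x in lebn n. x \<in> \<Omega> \<longrightarrow> weak_deriv n \<Omega> i (w h) x = partial i (w h) x"
      using wd(2)[OF i, of h] by (auto simp: rep_def elim!: eventually_mono)
    from rep_modular[OF S this] show "weak_deriv n \<Omega> i (w h) \<in> Orlicz_class n \<Omega> \<phi>"
      using wd(2)[OF i, of h] w(3)[OF i, of h] by (simp add: Orlicz_class_def rep_def)
  qed
  have gw: "modular n \<Omega> \<phi> (grad_norm n \<Omega> (w h)) =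
     (\<integral>\<^sup>+x. indicator \<Omega> x * ennreal (\<phi> (L2_set (\<lambda>i. partial i (w h) x) {..<n})) \<partial>lebn n)" for h
  proof -
    have "AE x in lebn n. x \<in> \<Omega> \<longrightarrow> grad_norm n \<Omega> (w h) x = L2_set (\<lambda>i. partial i (w h) x) {..<n}"
      using grad_norm_AE[OF wd(2), of h] by (auto elim!: eventually_mono)
    from rep_modular[OF S this] show ?thesis by (simp add: L2_set_nonneg)
  qed
  have gu: "modular n \<Omega> \<phi> (grad_norm n \<Omega> u) = (\<integral>\<^sup>+x. indicator \<Omega> x * ennreal (\<phi> (N {..<n} x)) \<partial>lebn n)"
    using rep_modular[OF S grad_norm_AE[OF G]] by (simp add: N_def L2_set_nonneg)
  have md: "modular n \<Omega> \<phi> (\<lambda>x. w h x - u x) = (\<integral>\<^sup>+x. indicator \<Omega> x * ennreal (\<phi> \<bar>w h x - U x\<bar>) \<partial>lebn n)" for h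
    by (rule rep_modular[OF S]) (use AE_U in \<open>auto elim!: eventually_mono\<close>)
  have conv: "(\<lambda>h. modular n \<Omega> \<phi> (grad_norm n \<Omega> (w h))) \<longlonglongrightarrow> modular n \<Omega> \<phi> (grad_norm n \<Omega> u)"
    unfolding gw gu by (rule energy)
  have "mean_convergent n \<Omega> \<phi> w u"
    unfolding mean_convergent_def md using mean Orlicz_class_imp_space wO uO by blast
  moreover have "energy_convergent n \<Omega> \<phi> (\<lambda>h. grad_norm n \<Omega> (w h)) (grad_norm n \<Omega> u)"
    if gO: "grad_norm n \<Omega> u \<in> Orlicz_class n \<Omega> \<phi>"
  proof -
    have "good {..<n}" using gO gu by (simp add: good_def Orlicz_class_def)
    then have "modular n \<Omega> \<phi> (grad_norm n \<Omega> (w h)) < \<infinity>" for h using fin[of h] gw by simp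
    moreover have "grad_norm n \<Omega> (w h) \<in> borel_measurable (Rn_leb_on n \<Omega>)" for h
      by (rule grad_norm_borel[OF wd(2)])
    ultimately show ?thesis using conv gO unfolding energy_convergent_def Orlicz_class_def by blast
  qed
  ultimately show ?thesis using w(1) wW conv by (intro exI[of _ w]) blast
qed

text \<open>Convergence of the gradient modulars is stated in \<open>ennreal\<close>, where it keeps
  its meaning for an infinite limit. Energy convergence contains finiteness and is therefore
  asserted for gradient norms in the class.\<close>

theorem theorem5:
  "\<exists>\<tau>0::real. \<tau>0 > 0 \<and>
     (\<forall>\<gamma>\<in>{0..1}. \<forall>\<tau>\<ge>\<tau>0. \<forall>n\<ge>1. \<forall>\<Omega> \<phi> u.
        openin (Rn_top n) \<Omega> \<longrightarrow>
        \<phi> = exp_tilde \<gamma> \<tau> \<longrightarrow>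
        u \<in> W1K n \<Omega> \<phi> \<longrightarrow>
        integrable (Rn_leb_on n \<Omega>) (grad_norm n \<Omega> u) \<or> emeasure (Rn_leb n) \<Omega> < \<infinity> \<longrightarrow>
        (\<exists>us. (\<forall>h. us h \<in> C_inf n \<Omega> \<inter> W1K n \<Omega> \<phi>) \<and>
              mean_convergent n \<Omega> \<phi> us u \<and>
              (\<lambda>h. modular n \<Omega> \<phi> (grad_norm n \<Omega> (us h))) \<longlonglongrightarrow> modular n \<Omega> \<phi> (grad_norm n \<Omega> u) \<and>
              (grad_norm n \<Omega> u \<in> Orlicz_class n \<Omega> \<phi> \<longrightarrow>
                 energy_convergent n \<Omega> \<phi> (\<lambda>h. grad_norm n \<Omega> (us h)) (grad_norm n \<Omega> u))))"
\<comment> \<open>The threshold of \<open>growth_exp_tilde\<close>, which depends neither on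
  \<open>\<gamma>\<close> nor on the dimension.\<close>
proof (intro exI[of _ 8] conjI ballI allI impI)
  fix \<gamma> \<tau> :: real and n \<Omega> \<phi> u
  assume "\<gamma> \<in> {0..1}" "8 \<le> \<tau>" "1 \<le> n" "openin (Rn_top n) \<Omega>" "\<phi> = exp_tilde \<gamma> \<tau>" "u \<in> W1K n \<Omega> \<phi>"
  then show "\<exists>us. (\<forall>h. us h \<in> C_inf n \<Omega> \<inter> W1K n \<Omega> \<phi>) \<and>
              mean_convergent n \<Omega> \<phi> us u \<and>
              (\<lambda>h. modular n \<Omega> \<phi> (grad_norm n \<Omega> (us h))) \<longlonglongrightarrow> modular n \<Omega> \<phi> (grad_norm n \<Omega> u) \<and>
              (grad_norm n \<Omega> u \<in> Orlicz_class n \<Omega> \<phi> \<longrightarrow>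
                 energy_convergent n \<Omega> \<phi> (\<lambda>h. grad_norm n \<Omega> (us h)) (grad_norm n \<Omega> u))"
    using W1K_smooth_approximation[OF growth_exp_tilde[of \<gamma> \<tau>]] by auto
qed simp

end
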